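(* The centre of the higher level affine Hecke algebra is $$Z(H_{d,\mathbf Q}(q))=\mathbf k[x_1^{\pm1},\dots,x_d^{\pm1}]^{\mathfrak S_d}=(P_{d,\mathbf Q})^{\mathfrak S_{\ell+d}},$$ where $P_{d,\mathbf Q}=\bigoplus_{\mathbf c\in J^{\ell,d}}\mathbf k[x_1^{\pm1},\dots,x_d^{\pm1}]e(\mathbf c)$ is regarded as a subalgebra of $H_{d,\mathbf Q}(q)$ and $\mathfrak S_d$ permutes $x_1,\dots,x_d$.
   Context: Throughout, $\mathbf k$ is an algebraically closed field, $q\in\mathbf k^*$, $q\neq1$, $d,\ell\ge0$ are integers, $\mathbf Q=(Q_1,\dots,Q_\ell)\in(\mathbf k^* )^\ell$. $J^{\ell,d}\subset\{0,1\}^{\ell+d}$ is the set of tuples $\mathbf c=(c_1,\dots,c_{\ell+d})$ with exactly $\ell$ entries $1$ (red) and $d$ entries $0$ (black); $\mathfrak S_{\ell+d}$ acts on it by $\pi(\mathbf c)_m=c_{\pi^{-1}(m)}$, and $s_r=(r,r+1)$. For $\mathbf c\in J^{\ell,d}$ let $1_{\mathbf c}<\dots<d_{\mathbf c}$ be the positions of the black entries. **Higher level affine Hecke algebra** $H_{d,\mathbf Q}(q)$: the unital $\mathbf k$-algebra generated by $e(\mathbf c)$ ($\mathbf c\in J^{\ell,d}$), $T_r$ ($1\le r\le \ell+d-1$), $X_j,X_j'$ ($1\le j\le\ell+d$) with relations: the $e(\mathbf c)$ are orthogonal idempotents with $\sum_{\mathbf c}e(\mathbf c)=1$; $X_ie(\mathbf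 c)=X_i'e(\mathbf c)=0$ if $c_i=1$; $X_iX_i'e(\mathbf c)=X_i'X_ie(\mathbf c)=e(\mathbf c)$ if $c_i=0$; $X_i,X_i'$ commute with all $e(\mathbf c)$; $X_iX_j=X_jX_i$, $X_i'X_j'=X_j'X_i'$; $T_rT_s=T_sT_r$ if $|r-s|>1$; $T_rX_i=X_iT_r$ if $i\ne r,r+1$; $T_re(\mathbf c)=0$ if $c_r=c_{r+1}=1$; $T_re(\mathbf c)=e(s_r(\mathbf c))T_r$; $(T_rX_{r+1}-X_rT_r)e(\mathbf c)=(q-1)X_{r+1}e(\mathbf c)$ and $(T_rX_r-X_{r+1}T_r)e(\mathbf c)=-(q-1)X_{r+1}e(\mathbf c)$ if $c_r=c_{r+1}=0$, both being $0$ otherwise; $T_r^2e(\mathbf c)=(q-1)T_re(\mathbf c)+qe(\mathbf c)$ if $c_r=c_{r+1}=0$, $T_r^2e(\mathbf c)=(X_r-Q_{\sum_{j\le r+1}c_j})e(\mathbf c)$ if $c_r=0,c_{r+1}=1$, $T_r^2e(\mathbf c)=(X_{r+1}-Q_{\sum_{j\le r}c_j})e(\mathbf c)$ if $c_r=1,c_{r+1}=0$; and for $r<\ell+d-1$, $(T_rT_{r+1}T_r-T_{r+1}T_rT_{r+1})e(\mathbf c)$ equals $0$ if $c_{r+1}=0$, and $(1-q)X_{r+2}e(\mathbf c)$ if $c_{r+1}=1$, $c_r=c_{r+2}=0$. Put $x_r=\sum_{\mathbf c}X_{r_{\mathbf c}}e(\mathbf c)$ for $1\le r\le d$; these commute and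 are invertible, and the subalgebra they generate together with the $e(\mathbf c)$ is $P_{d,\mathbf Q}=\bigoplus_{\mathbf c}\mathbf k[x_1^{\pm1},\dots,x_d^{\pm1}]e(\mathbf c)$, containing $\mathbf k[x_1^{\pm1},\dots,x_d^{\pm1}]$ diagonally. Identifying $\mathbf k[x_1^{\pm1},\dots,x_d^{\pm1}]e(\mathbf c)$ with Laurent polynomials in the $X_j$, $c_j=0$ (via $x_r=X_{r_{\mathbf c}}$), $w\in\mathfrak S_{\ell+d}$ acts on $P_{d,\mathbf Q}$ by sending $f$ in the $\mathbf c$-summand to $w(f)$ in the $w(\mathbf c)$-summand, where $w(X_j)=X_{w(j)}$. *)

theory Defs
  imports
    "HOL-Algebra.QuotRing"
    "HOL-Combinatorics.Permutations"
    "HOL-Computational_Algebra.Polynomial"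
    "HOL-Library.FuncSet"
    "HOL-Library.Poly_Mapping"
begin

section \<open>Colour tuples\<close>

text \<open>
  A tuple in \<open>{0,1}\<close> of length \<open>l + d\<close> is an extensional function on \<open>{1..l + d}\<close>;
  the value 1 is red, the value 0 is black.
\<close>

definition colour_tuples :: "nat \<Rightarrow> nat \<Rightarrow> (nat \<Rightarrow> nat) set" where
  "colour_tuples l d =
    {c \<in> {1..l + d} \<rightarrow>\<^sub>E {0, 1}.
      card {j \<in> {1..l + d}. c j = 1} = l \<and> card {j \<in> {1..l + d}. c j = 0} = d}"

definition perm_tuple :: "(nat \<Rightarrow> nat) \<Rightarrow> (nat \<Rightarrow> nat) \<Rightarrow> nat \<Rightarrow> nat" where
  "perm_tuple w c = (\<lambda>m. c (Hilbert_Choice.inv w m))"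

abbreviation simple_transp :: "nat \<Rightarrow> nat \<Rightarrow> nat" where
  "simple_transp r \<equiv> transpose r (r + 1)"

text \<open>The position \<open>r\<^sub>c\<close> of the \<open>r\<close>-th black entry, for \<open>1 \<le> r \<le> d\<close>.\<close>

definition black_pos :: "nat \<Rightarrow> nat \<Rightarrow> (nat \<Rightarrow> nat) \<Rightarrow> nat \<Rightarrow> nat" where
  "black_pos l d c r = sorted_list_of_set {j \<in> {1..l + d}. c j = 0} ! (r - 1)"

text \<open>The inverse numbering: a black position \<open>j\<close> equals \<open>r\<^sub>c\<close> for \<open>r = black_index c j\<close>.\<close>

definition black_index :: "(nat \<Rightarrow> nat) \<Rightarrow> nat \<Rightarrow> nat" where
  "black_index c j = card {i \<in> {1..j}. c i = 0}"


section \<open>Free unital associative algebras\<close>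

text \<open>
  The free monoid, written additively so that finitely supported functions on it
  carry the convolution product of \<^theory>\<open>HOL-Library.Poly_Mapping\<close>.
\<close>

datatype 'g word = Word (letters: "'g list")

instantiation word :: (type) monoid_add
begin

definition zero_word :: "'a word" where
  "zero_word = Word []"

definition plus_word :: "'a word \<Rightarrow> 'a word \<Rightarrow> 'a word" where
  "plus_word u v = Word (letters u @ letters v)"

instance
  by standard (simp_all add: zero_word_def plus_word_def)

end

type_synonym ('g, 'k) nc_poly = "'g word \<Rightarrow>\<^sub>0 'k"

definition nc_var :: "'g \<Rightarrow> ('g, 'k::ring_1) nc_poly" where
  "nc_var g = Poly_Mapping.single (Word [g]) 1"

definition nc_const :: "'k \<Rightarrow> ('g, 'k::ring_1) nc_poly" where
  "nc_const a = Poly_Mapping.single 0 a"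

definition free_algebra :: "'g set \<Rightarrow> ('g, 'k::ring_1) nc_poly ring" where
  "free_algebra G =
    \<lparr>carrier = {f. \<forall>u \<in> Poly_Mapping.keys f. set (letters u) \<subseteq> G},
     monoid.mult = (*), one = 1, zero = 0, add = (+)\<rparr>"


section \<open>The higher level affine Hecke algebra\<close>

datatype hecke_gen =
    Gen_e "nat \<Rightarrow> nat"
  | Gen_T nat
  | Gen_X nat
  | Gen_X' nat

definition hecke_gens :: "nat \<Rightarrow> nat \<Rightarrow> hecke_gen set" where
  "hecke_gens l d =
    Gen_e ` colour_tuples l d \<union> Gen_T ` {r. 1 \<le> r \<and> r < l + d}
    \<union> Gen_X ` {1..l + d} \<union> Gen_X' ` {1..l + d}"

abbreviation ge :: "(nat \<Rightarrow> nat) \<Rightarrow> (hecke_gen, 'k::ring_1) nc_poly" where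
  "ge c \<equiv> nc_var (Gen_e c)"
abbreviation gT :: "nat \<Rightarrow> (hecke_gen, 'k::ring_1) nc_poly" where
  "gT r \<equiv> nc_var (Gen_T r)"
abbreviation gX :: "nat \<Rightarrow> (hecke_gen, 'k::ring_1) nc_poly" where
  "gX j \<equiv> nc_var (Gen_X j)"
abbreviation gX' :: "nat \<Rightarrow> (hecke_gen, 'k::ring_1) nc_poly" where
  "gX' j \<equiv> nc_var (Gen_X' j)"

text \<open>\<open>hecke_rel l d q Q a b\<close>: the equation \<open>a = b\<close> is one of the defining relations.\<close>

inductive hecke_rel ::
  "nat \<Rightarrow> nat \<Rightarrow> 'k::ring_1 \<Rightarrow> (nat \<Rightarrow> 'k) \<Rightarrow>
    (hecke_gen, 'k) nc_poly \<Rightarrow> (hecke_gen, 'k) nc_poly \<Rightarrow> bool"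
  for l d :: nat and q :: 'k and Q :: "nat \<Rightarrow> 'k" where
  e_orth: "c \<in> colour_tuples l d \<Longrightarrow> c' \<in> colour_tuples l d \<Longrightarrow>
    hecke_rel l d q Q (ge c * ge c') (if c = c' then ge c else 0)"
| e_sum: "hecke_rel l d q Q (\<Sum>c \<in> colour_tuples l d. ge c) 1"
| X_red: "c \<in> colour_tuples l d \<Longrightarrow> i \<in> {1..l + d} \<Longrightarrow> c i = 1 \<Longrightarrow>
    hecke_rel l d q Q (gX i * ge c) 0"
| X'_red: "c \<in> colour_tuples l d \<Longrightarrow> i \<in> {1..l + d} \<Longrightarrow> c i = 1 \<Longrightarrow>
    hecke_rel l d q Q (gX' i * ge c) 0"
| X_X'_black: "c \<in> colour_tuples l d \<Longrightarrow> i \<in> {1..l + d} \<Longrightarrow> c i = 0 \<Longrightarrow>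
    hecke_rel l d q Q (gX i * gX' i * ge c) (ge c)"
| X'_X_black: "c \<in> colour_tuples l d \<Longrightarrow> i \<in> {1..l + d} \<Longrightarrow> c i = 0 \<Longrightarrow>
    hecke_rel l d q Q (gX' i * gX i * ge c) (ge c)"
| X_e: "c \<in> colour_tuples l d \<Longrightarrow> i \<in> {1..l + d} \<Longrightarrow>
    hecke_rel l d q Q (gX i * ge c) (ge c * gX i)"
| X'_e: "c \<in> colour_tuples l d \<Longrightarrow> i \<in> {1..l + d} \<Longrightarrow>
    hecke_rel l d q Q (gX' i * ge c) (ge c * gX' i)"
| X_X: "i \<in> {1..l + d} \<Longrightarrow> j \<in> {1..l + d} \<Longrightarrow>
    hecke_rel l d q Q (gX i * gX j) (gX j * gX i)"
| X'_X': "i \<in> {1..l + d} \<Longrightarrow> j \<in> {1..l + d} \<Longrightarrow>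
    hecke_rel l d q Q (gX' i * gX' j) (gX' j * gX' i)"
| T_T: "1 \<le> r \<Longrightarrow> r < l + d \<Longrightarrow> 1 \<le> s \<Longrightarrow> s < l + d \<Longrightarrow> r + 1 < s \<or> s + 1 < r \<Longrightarrow>
    hecke_rel l d q Q (gT r * gT s) (gT s * gT r)"
| T_X: "1 \<le> r \<Longrightarrow> r < l + d \<Longrightarrow> i \<in> {1..l + d} \<Longrightarrow> i \<noteq> r \<Longrightarrow> i \<noteq> r + 1 \<Longrightarrow>
    hecke_rel l d q Q (gT r * gX i) (gX i * gT r)"
| T_red_red: "c \<in> colour_tuples l d \<Longrightarrow> 1 \<le> r \<Longrightarrow> r < l + d \<Longrightarrow> c r = 1 \<Longrightarrow> c (r + 1) = 1 \<Longrightarrow>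
    hecke_rel l d q Q (gT r * ge c) 0"
| T_e: "c \<in> colour_tuples l d \<Longrightarrow> 1 \<le> r \<Longrightarrow> r < l + d \<Longrightarrow>
    hecke_rel l d q Q (gT r * ge c) (ge (perm_tuple (simple_transp r) c) * gT r)"
| T_X_up: "c \<in> colour_tuples l d \<Longrightarrow> 1 \<le> r \<Longrightarrow> r < l + d \<Longrightarrow>
    hecke_rel l d q Q ((gT r * gX (r + 1) - gX r * gT r) * ge c)
      (if c r = 0 \<and> c (r + 1) = 0 then nc_const (q - 1) * gX (r + 1) * ge c else 0)"
| T_X_down: "c \<in> colour_tuples l d \<Longrightarrow> 1 \<le> r \<Longrightarrow> r < l + d \<Longrightarrow>
    hecke_rel l d q Q ((gT r * gX r - gX (r + 1) * gT r) * ge c)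
      (if c r = 0 \<and> c (r + 1) = 0 then nc_const (- (q - 1)) * gX (r + 1) * ge c else 0)"
| T_sq_black_black: "c \<in> colour_tuples l d \<Longrightarrow> 1 \<le> r \<Longrightarrow> r < l + d \<Longrightarrow> c r = 0 \<Longrightarrow> c (r + 1) = 0 \<Longrightarrow>
    hecke_rel l d q Q (gT r * gT r * ge c) (nc_const (q - 1) * gT r * ge c + nc_const q * ge c)"
| T_sq_black_red: "c \<in> colour_tuples l d \<Longrightarrow> 1 \<le> r \<Longrightarrow> r < l + d \<Longrightarrow> c r = 0 \<Longrightarrow> c (r + 1) = 1 \<Longrightarrow>
    hecke_rel l d q Q (gT r * gT r * ge c) ((gX r - nc_const (Q (\<Sum>j = 1..r + 1. c j))) * ge c)"
| T_sq_red_black: "c \<in> colour_tuples l d \<Longrightarrow> 1 \<le> r \<Longrightarrow> r < l + d \<Longrightarrow> c r = 1 \<Longrightarrow> c (r + 1) = 0 \<Longrightarrow>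
    hecke_rel l d q Q (gT r * gT r * ge c) ((gX (r + 1) - nc_const (Q (\<Sum>j = 1..r. c j))) * ge c)"
| braid_black: "c \<in> colour_tuples l d \<Longrightarrow> 1 \<le> r \<Longrightarrow> r + 1 < l + d \<Longrightarrow> c (r + 1) = 0 \<Longrightarrow>
    hecke_rel l d q Q
      ((gT r * gT (r + 1) * gT r - gT (r + 1) * gT r * gT (r + 1)) * ge c) 0"
| braid_red: "c \<in> colour_tuples l d \<Longrightarrow> 1 \<le> r \<Longrightarrow> r + 1 < l + d \<Longrightarrow>
    c (r + 1) = 1 \<Longrightarrow> c r = 0 \<Longrightarrow> c (r + 2) = 0 \<Longrightarrow>
    hecke_rel l d q Q
      ((gT r * gT (r + 1) * gT r - gT (r + 1) * gT r * gT (r + 1)) * ge c)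
      (nc_const (1 - q) * gX (r + 2) * ge c)"

abbreviation hecke_free :: "nat \<Rightarrow> nat \<Rightarrow> (hecke_gen, 'k::ring_1) nc_poly ring" where
  "hecke_free l d \<equiv> free_algebra (hecke_gens l d)"

text \<open>
  \<^const>\<open>genideal\<close> is the two-sided ideal generated by a set. It is a subspace, because the
  constants belong to the free algebra.
\<close>

definition hecke_ideal ::
  "nat \<Rightarrow> nat \<Rightarrow> 'k::ring_1 \<Rightarrow> (nat \<Rightarrow> 'k) \<Rightarrow> (hecke_gen, 'k) nc_poly set" where
  "hecke_ideal l d q Q = Idl\<^bsub>hecke_free l d\<^esub> {a - b | a b. hecke_rel l d q Q a b}"

definition hecke_algebra ::
  "nat \<Rightarrow> nat \<Rightarrow> 'k::ring_1 \<Rightarrow> (nat \<Rightarrow> 'k) \<Rightarrow> (hecke_gen, 'k) nc_poly set ring" where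
  "hecke_algebra l d q Q = hecke_free l d Quot hecke_ideal l d q Q"

definition hecke_class ::
  "nat \<Rightarrow> nat \<Rightarrow> 'k::ring_1 \<Rightarrow> (nat \<Rightarrow> 'k) \<Rightarrow>
    (hecke_gen, 'k) nc_poly \<Rightarrow> (hecke_gen, 'k) nc_poly set" where
  "hecke_class l d q Q a = hecke_ideal l d q Q +>\<^bsub>hecke_free l d\<^esub> a"

definition ring_centre :: "('a, 'b) ring_scheme \<Rightarrow> 'a set" where
  "ring_centre R = {z \<in> carrier R. \<forall>a \<in> carrier R. z \<otimes>\<^bsub>R\<^esub> a = a \<otimes>\<^bsub>R\<^esub> z}"


section \<open>Laurent polynomials\<close>

text \<open>Exponents are finitely supported; \<open>single m a\<close> is the term \<open>a\<close> times the product of the \<open>x\<^sub>r\<close> to the powers \<open>m r\<close>.\<close>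

type_synonym 'k laurent = "(nat \<Rightarrow>\<^sub>0 int) \<Rightarrow>\<^sub>0 'k"

definition laurent_polys :: "nat \<Rightarrow> 'k::comm_ring_1 laurent set" where
  "laurent_polys d = {f. \<forall>m \<in> Poly_Mapping.keys f. Poly_Mapping.keys m \<subseteq> {1..d}}"

text \<open>The substitution replacing the \<open>j\<close>-th variable by the \<open>g j\<close>-th one.\<close>

definition laurent_rename :: "(nat \<Rightarrow> nat) \<Rightarrow> 'k::comm_ring_1 laurent \<Rightarrow> 'k laurent" where
  "laurent_rename g f =
    (\<Sum>m \<in> Poly_Mapping.keys f.
      Poly_Mapping.single
        (\<Sum>j \<in> Poly_Mapping.keys m. Poly_Mapping.single (g j) (Poly_Mapping.lookup m j))
        (Poly_Mapping.lookup f m))"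

definition sym_laurent_polys :: "nat \<Rightarrow> 'k::comm_ring_1 laurent set" where
  "sym_laurent_polys d =
    {f \<in> laurent_polys d. \<forall>\<sigma>. \<sigma> permutes {1..d} \<longrightarrow> laurent_rename \<sigma> f = f}"


section \<open>The subalgebra of Laurent polynomials and the action of the symmetric group\<close>

text \<open>
  The direct sum over all \<open>c\<close>, as an abstract module: \<open>F c\<close> is the component at \<open>e(c)\<close>,
  expressed in the variables \<open>x\<^sub>1, \<dots>, x\<^sub>d\<close>. It is embedded into the Hecke
  algebra by \<open>hecke_embed\<close> below.
\<close>

definition P_alg :: "nat \<Rightarrow> nat \<Rightarrow> ((nat \<Rightarrow> nat) \<Rightarrow> 'k::comm_ring_1 laurent) set" where
  "P_alg l d =
    {F. (\<forall>c \<in> colour_tuples l d. F c \<in> laurent_polys d) \<and> (\<forall>c. c \<notin> colour_tuples l d \<longrightarrow> F c = 0)}"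

text \<open>
  The component of \<open>w F\<close> at \<open>c\<close> comes from the component of \<open>F\<close> at \<open>w\<^sup>-\<^sup>1(c)\<close>: the latter is
  rewritten in the variables \<open>X\<^sub>j\<close>, \<open>w\<close> sends \<open>X\<^sub>j\<close> to the variable of index \<open>w j\<close>,
  and the result is rewritten in the variables \<open>x\<^sub>r\<close> for the tuple \<open>c\<close>.
\<close>

definition P_action ::
  "nat \<Rightarrow> nat \<Rightarrow> (nat \<Rightarrow> nat) \<Rightarrow> ((nat \<Rightarrow> nat) \<Rightarrow> 'k::comm_ring_1 laurent)
    \<Rightarrow> (nat \<Rightarrow> nat) \<Rightarrow> 'k laurent" where
  "P_action l d w F = (\<lambda>c.
    let c' = perm_tuple (Hilbert_Choice.inv w) c
    in laurent_rename (black_index c) (laurent_rename w (laurent_rename (black_pos l d c') (F c'))))"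

definition P_invariants :: "nat \<Rightarrow> nat \<Rightarrow> ((nat \<Rightarrow> nat) \<Rightarrow> 'k::comm_ring_1 laurent) set" where
  "P_invariants l d = {F \<in> P_alg l d. \<forall>w. w permutes {1..l + d} \<longrightarrow> P_action l d w F = F}"

definition hecke_x ::
  "nat \<Rightarrow> nat \<Rightarrow> 'k::comm_ring_1 \<Rightarrow> (nat \<Rightarrow> 'k) \<Rightarrow> nat \<Rightarrow> (hecke_gen, 'k) nc_poly set" where
  "hecke_x l d q Q r =
    (\<Oplus>\<^bsub>hecke_algebra l d q Q\<^esub> c \<in> colour_tuples l d.
      hecke_class l d q Q (gX (black_pos l d c r) * ge c))"

text \<open>
  Evaluation of a Laurent polynomial at the commuting units \<open>x\<^sub>1, \<dots>, x\<^sub>d\<close>. Negative powers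
  use the inverse in the Hecke algebra; the product is taken in the order \<open>1, \<dots>, d\<close>, since
  \<^const>\<open>finprod\<close> is only available for commutative monoids.
\<close>

definition hecke_eval ::
  "nat \<Rightarrow> nat \<Rightarrow> 'k::comm_ring_1 \<Rightarrow> (nat \<Rightarrow> 'k) \<Rightarrow> 'k laurent \<Rightarrow> (hecke_gen, 'k) nc_poly set" where
  "hecke_eval l d q Q f =
    (let H = hecke_algebra l d q Q in
      \<Oplus>\<^bsub>H\<^esub> m \<in> Poly_Mapping.keys f.
        hecke_class l d q Q (nc_const (Poly_Mapping.lookup f m)) \<otimes>\<^bsub>H\<^esub>
        foldr (\<lambda>r y. (hecke_x l d q Q r [^]\<^bsub>H\<^esub> Poly_Mapping.lookup m r) \<otimes>\<^bsub>H\<^esub> y) [1..<d + 1] \<one>\<^bsub>H\<^esub>)"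

definition hecke_embed ::
  "nat \<Rightarrow> nat \<Rightarrow> 'k::comm_ring_1 \<Rightarrow> (nat \<Rightarrow> 'k) \<Rightarrow> ((nat \<Rightarrow> nat) \<Rightarrow> 'k laurent)
    \<Rightarrow> (hecke_gen, 'k) nc_poly set" where
  "hecke_embed l d q Q F =
    (let H = hecke_algebra l d q Q in
      \<Oplus>\<^bsub>H\<^esub> c \<in> colour_tuples l d. hecke_eval l d q Q (F c) \<otimes>\<^bsub>H\<^esub> hecke_class l d q Q (ge c))"

end

theory Submission
  imports Defs
begin

text \<open>
  The Hecke algebra acts on functions of a point \<open>u = (u\<^sub>1, \<dots>, u\<^bsub>l + d\<^esub>)\<close> with exactly \<open>l\<close> zero
  coordinates, the others being generic: a zero coordinate stands for a red strand and a nonzero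
  one for a black strand, \<open>X\<^sub>j\<close> multiplies by \<open>u\<^sub>j\<close>, \<open>e(c)\<close> restricts to the points of colour \<open>c\<close>, and
  \<open>T\<^sub>r\<close> acts by a Demazure--Lusztig operator, or by exchanging \<open>u\<^sub>r\<close> and \<open>u\<^bsub>r + 1\<^esub>\<close> up to a scalar factor
  when the colours differ. Evaluating at points in place of working with polynomials makes every
  relation an identity in the ground field.

  The representation is faithful. Let \<open>R\<^sub>m\<close> be the subalgebra generated by the Laurent part and
  \<open>T\<^sub>1, \<dots>, T\<^sub>m\<close>. Modulo the relations \<open>R\<^bsub>m + 1\<^esub>\<close> is the sum of the \<open>R\<^sub>m T\<^bsub>m + 1\<^esub> T\<^sub>m \<cdots> T\<^sub>k\<close>; testing an
  operator on functions supported where the value of the last coordinate sits at position \<open>k\<close>, and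
  nowhere to the right of it, isolates one summand, and induction on \<open>m\<close> reduces the claim to the
  independence of Laurent monomials on generic points.

  A central element commutes with the multiplications by coordinates, hence is the multiplication
  by its value on the constant function 1, which is a Laurent polynomial on each colour. Commuting
  with the \<open>T\<^sub>r\<close>, which have nonzero exchange coefficients, forces this function to be invariant under
  permutation of the coordinates.
\<close>

section \<open>Laurent polynomials at generic points\<close>

text \<open>No basis of the algebra is presupposed, so faithfulness has to supply the membership
  criterion for the ideal of relations: an element of the free algebra lies in \<open>I\<close> iff
  it is \<open>vanishing\<close>. Identities in the quotient then become pointwise identities.
  Working with all functions on points has a second gain: test functions with prescribed support
  exist, which polynomials would not provide. The price is that the relations hold only at states.
  It is paid by locality: an operator at \<open>u\<close> reads its argument only at permutations of
  \<open>u\<close>, and these are states when \<open>u\<close> is one. The obstacle is a pair of red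
  strands. There \<open>T_r\<close> acts by zero, the exchange coefficient vanishes, and no test
  function detects a summand in which two red strands cross. Such summands are shown to lie in the
  ideal by rewriting; all others are detected, because genericity makes the remaining coefficients
  nonzero: distinct coordinates for the denominators, \<open>p i \<noteq> q * p j\<close> for the
  numerators of two black strands, and avoidance of the parameters for mixed pairs.\<close>

abbreviation "keys \<equiv> Poly_Mapping.keys"
abbreviation "lookup \<equiv> Poly_Mapping.lookup"
abbreviation "single \<equiv> Poly_Mapping.single"

text \<open>Over a finite field, 1 plus the product of all \<open>X - a\<close> would have positive
  degree and take the value 1 everywhere.\<close>

lemma infinite_UNIV_alg_closed: "infinite (UNIV :: 'k::alg_closed_field set)"
proof
  assume fin: "finite (UNIV :: 'k set)"
  define p :: "'k poly" where "p = (\<Prod>a\<in>UNIV. [:- a, 1:])"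
  have "degree p = card (UNIV :: 'k set)"
    unfolding p_def by (subst degree_prod_eq_sum_degree) auto
  then have "degree (p + 1) > 0"
    using fin by (simp add: degree_add_eq_left card_gt_0_iff)
  then obtain x where "poly (p + 1) x = 0"
    using alg_closed_imp_poly_has_root by blast
  moreover have "poly p x = 0"
    unfolding p_def poly_prod using fin by (subst prod_zero_iff) auto
  ultimately show False by simp
qed

lemma powi_sum_zero_imp_coeff_zero:
  fixes \<beta> :: "int \<Rightarrow> 'k::field"
  assumes "finite E" "infinite X" "0 \<notin> X"
    and zero: "\<And>x. x \<in> X \<Longrightarrow> (\<Sum>e\<in>E. \<beta> e * x powi e) = 0"
    and "e \<in> E"
  shows "\<beta> e = 0"
proof -
  \<comment> \<open>\<open>N\<close> bounds the absolute value of every exponent, so multiplication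
    by \<open>x ^ N\<close> clears the negative powers and leaves an ordinary polynomial with
    infinitely many roots.\<close>
  define N where "N = (\<Sum>e\<in>E. nat \<bar>e\<bar>)"
  have N: "0 \<le> e + int N" if "e \<in> E" for e
  proof -
    have "nat \<bar>e\<bar> \<le> N"
      unfolding N_def using assms(1) that by (intro member_le_sum) auto
    then show ?thesis by linarith
  qed
  define p where "p = (\<Sum>e\<in>E. monom (\<beta> e) (nat (e + int N)))"
  have "poly p x = 0" if "x \<in> X" for x
  proof -
    have "x \<noteq> 0" using that assms(3) by blast
    have "poly p x = (\<Sum>e\<in>E. \<beta> e * x powi e * x ^ N)"
      unfolding p_def poly_sum
    proof (rule sum.cong[OF refl])
      fix e assume e: "e \<in> E"
      have "x ^ nat (e + int N) = x powi (e + int N)"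
        using N[OF e] by (metis int_nat_eq power_int_of_nat)
      also have "\<dots> = x powi e * x ^ N"
        using \<open>x \<noteq> 0\<close> by (simp add: power_int_add)
      finally show "poly (monom (\<beta> e) (nat (e + int N))) x = \<beta> e * x powi e * x ^ N"
        by (simp add: poly_monom mult.assoc)
    qed
    also have "\<dots> = 0" using zero[OF that] by (simp flip: sum_distrib_right)
    finally show ?thesis .
  qed
  then have "infinite {x. poly p x = 0}"
    using assms(2) by (metis (mono_tags, lifting) finite_subset mem_Collect_eq subsetI)
  then have "p = 0" using poly_roots_finite by blast
  have "coeff p (nat (e + int N)) = (\<Sum>i\<in>E. if i = e then \<beta> e else 0)"
    unfolding p_def coeff_sum
    by (rule sum.cong) (use N assms(5) in \<open>auto simp: nat_eq_iff\<close>)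
  also have "\<dots> = \<beta> e" using assms(1,5) by simp
  finally show ?thesis using \<open>p = 0\<close> by simp
qed

text \<open>Generic points avoid the zeros and poles of the exchange coefficients \<open>T_swap\<close> below.\<close>

definition generic :: "nat \<Rightarrow> 'k::field \<Rightarrow> (nat \<Rightarrow> 'k) \<Rightarrow> nat set \<Rightarrow> (nat \<Rightarrow> 'k) \<Rightarrow> bool" where
  "generic l q Q A p \<longleftrightarrow>
    (\<forall>i\<in>A. p i \<noteq> 0 \<and> p i \<notin> Q ` {1..l}) \<and> (\<forall>i\<in>A. \<forall>j\<in>A. i \<noteq> j \<longrightarrow> p i \<noteq> p j \<and> p i \<noteq> q * p j)"

text \<open>Each condition on the new coordinate excludes finitely many values, collected in
  \<open>B\<close>, and the field is infinite.\<close>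

lemma generic_extend:
  fixes q :: "'k::alg_closed_field"
  assumes "generic l q Q A p" "finite A" "a \<notin> A"
  shows "infinite {x. x \<noteq> 0 \<and> generic l q Q (insert a A) (p(a := x))}"
proof -
  define B where "B = {0} \<union> Q ` {1..l} \<union> p ` A \<union> (\<lambda>i. q * p i) ` A \<union> (\<lambda>i. p i / q) ` A"
  have "finite B" unfolding B_def using assms by auto
  then have "infinite (- B)"
    using infinite_UNIV_alg_closed[where 'k='k] by (simp add: finite_compl)
  moreover have "- B \<subseteq> {x. x \<noteq> 0 \<and> generic l q Q (insert a A) (p(a := x))}"
  proof
    fix x assume x: "x \<in> - B"
    have "p i \<noteq> q * x" if "i \<in> A" for i
    proof
      assume *: "p i = q * x"
      \<comment> \<open>With \<open>q = 0\<close> the equation would give \<open>p i = 0\<close>,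
        against genericity.\<close>
      then have "q \<noteq> 0" using assms(1) that by (auto simp: generic_def)
      then have "x = p i / q" using * by simp
      then show False using x that by (auto simp: B_def)
    qed
    then show "x \<in> {x. x \<noteq> 0 \<and> generic l q Q (insert a A) (p(a := x))}"
      using x assms by (auto simp: generic_def B_def)
  qed
  ultimately show ?thesis using finite_subset by blast
qed

definition mono_eval :: "(nat \<Rightarrow>\<^sub>0 int) \<Rightarrow> (nat \<Rightarrow> 'k::field) \<Rightarrow> 'k" where
  "mono_eval m p = (\<Prod>r\<in>keys m. p r powi lookup m r)"

definition laurent_eval :: "'k::field laurent \<Rightarrow> (nat \<Rightarrow> 'k) \<Rightarrow> 'k" where
  "laurent_eval f p =
    (\<Sum>m\<in>keys f. lookup f m * mono_eval m p)"

lemma mono_eval_superset: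
  "keys m \<subseteq> A \<Longrightarrow> finite A \<Longrightarrow>
    mono_eval m p = (\<Prod>r\<in>A. p r powi lookup m r)"
  unfolding mono_eval_def by (rule prod.mono_neutral_left) (auto simp: in_keys_iff)

lemma mono_eval_0 [simp]: "mono_eval 0 p = 1"
  by (simp add: mono_eval_def)

lemma mono_eval_single [simp]: "mono_eval (single r e) p = p r powi e"
  by (cases "e = 0") (simp_all add: mono_eval_def)

lemma mono_eval_add:
  assumes "\<And>r. r \<in> keys m \<union> keys m' \<Longrightarrow> p r \<noteq> 0"
  shows "mono_eval (m + m') p = mono_eval m p * mono_eval m' p"
proof -
  let ?A = "keys m \<union> keys m'"
  have "mono_eval (m + m') p = (\<Prod>r\<in>?A. p r powi lookup (m + m') r)"
    by (rule mono_eval_superset) (use keys_add[of m m'] in auto)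
  also have "\<dots> = (\<Prod>r\<in>?A. p r powi lookup m r * p r powi lookup m' r)"
    by (rule prod.cong[OF refl]) (use assms in \<open>simp add: lookup_add power_int_add\<close>)
  also have "\<dots> = mono_eval m p * mono_eval m' p"
    by (simp add: prod.distrib mono_eval_superset[of _ ?A])
  finally show ?thesis .
qed

lemma mono_eval_cong:
  "(\<And>r. r \<in> keys m \<Longrightarrow> p r = p' r) \<Longrightarrow> mono_eval m p = mono_eval m p'"
  unfolding mono_eval_def by (rule prod.cong) auto

text \<open>Induction on the variables. Grouped by the exponent of the new variable
  \<open>a\<close>, the sum is a Laurent polynomial in one unknown \<open>x\<close> that vanishes at
  the infinitely many \<open>x\<close> of \<open>generic_extend\<close>. Its coefficients are
  combinations of monomials in the other variables, so these vanish at every generic point.\<close>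

lemma mono_eval_independent:
  fixes q :: "'k::alg_closed_field"
  assumes "finite A" "finite M" "\<And>m. m \<in> M \<Longrightarrow> keys m \<subseteq> A"
    and "\<And>p. generic l q Q A p \<Longrightarrow> (\<Sum>m\<in>M. \<alpha> m * mono_eval m p) = 0"
    and "m \<in> M"
  shows "\<alpha> m = 0"
  using assms
proof (induction A arbitrary: M \<alpha> m rule: finite_induct)
  case empty
  then have "M = {0}"
    by (metis (full_types) empty_iff insertI1 insert_absorb is_singletonI' is_singleton_the_elem keys_eq_empty singletonD subset_empty)
  then show ?case using empty.prems(3)[of "\<lambda>_. 0"] empty.prems(4) by (simp add: generic_def)
next
  case (insert a A)
  define E where "E = (\<lambda>m. lookup m a) ` M"
  define Me where "Me e = {m \<in> M. lookup m a = e}" for e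
  define del where "del e m = m - single a e" for e and m :: "nat \<Rightarrow>\<^sub>0 int"
  let ?e = "lookup m a"
  have inj: "inj_on (del e) X" for e X by (auto simp: inj_on_def del_def)
  have keys_del: "keys (del e m) \<subseteq> A" if "m \<in> Me e" for m e
  proof
    fix i assume i: "i \<in> keys (del e m)"
    then have "i \<noteq> a" using that by (auto simp: del_def Me_def in_keys_iff lookup_minus)
    then have "i \<in> keys m"
      using i by (auto simp: del_def in_keys_iff lookup_minus lookup_single)
    then show "i \<in> A" using insert.prems(2)[of m] that \<open>i \<noteq> a\<close> by (auto simp: Me_def)
  qed
  \<comment> \<open>Only the monomials with the same \<open>a\<close>-exponent as \<open>m\<close>
    enter, stripped of \<open>a\<close>; adding \<open>single a ?e\<close> back recovers their
    coefficients.\<close>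
  have "\<alpha> (del ?e m + single a ?e) = 0"
  proof (rule insert.IH[where M = "del ?e ` Me ?e" and \<alpha> = "\<lambda>m'. \<alpha> (m' + single a ?e)"])
    show "finite (del ?e ` Me ?e)" using insert.prems(1) by (simp add: Me_def)
    show "del ?e m \<in> del ?e ` Me ?e" using insert.prems(4) by (simp add: Me_def)
    show "keys m' \<subseteq> A" if "m' \<in> del ?e ` Me ?e" for m'
      using that keys_del by blast
    fix p assume p: "generic l q Q A p"
    define \<beta> where "\<beta> e = (\<Sum>m\<in>Me e. \<alpha> m * mono_eval (del e m) p)" for e
    have "\<beta> ?e = 0"
    proof (rule powi_sum_zero_imp_coeff_zero[OF _ generic_extend[OF p]])
      show "finite E" using insert.prems(1) by (simp add: E_def)
      show "?e \<in> E" using insert.prems(4) by (simp add: E_def)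
      fix x assume x: "x \<in> {x. x \<noteq> 0 \<and> generic l q Q (insert a A) (p(a := x))}"
      have ev: "mono_eval m (p(a := x)) = x powi e * mono_eval (del e m) p" if "m \<in> Me e" for m e
      proof -
        have "m = single a e + del e m" by (simp add: del_def)
        then have "mono_eval m (p(a := x)) = mono_eval (single a e + del e m) (p(a := x))"
          by simp
        also have "\<dots> = mono_eval (single a e) (p(a := x)) * mono_eval (del e m) (p(a := x))"
          by (rule mono_eval_add) (use x keys_del[OF that] in \<open>auto simp: generic_def split: if_splits\<close>)
        also have "mono_eval (del e m) (p(a := x)) = mono_eval (del e m) p"
          by (rule mono_eval_cong) (use keys_del[OF that] insert.hyps in auto)
        finally show ?thesis by (simp del: fun_upd_apply) (simp add: fun_upd_same)
      qed
      have "0 = (\<Sum>m\<in>M. \<alpha> m * mono_eval m (p(a := x)))"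
        by (rule insert.prems(3)[symmetric]) (use x in blast)
      also have "\<dots> = (\<Sum>e\<in>E. \<Sum>m\<in>Me e. \<alpha> m * mono_eval m (p(a := x)))"
        unfolding E_def Me_def by (rule sum.image_gen[OF insert.prems(1)])
      also have "\<dots> = (\<Sum>e\<in>E. \<beta> e * x powi e)"
        by (rule sum.cong[OF refl]) (simp add: \<beta>_def ev sum_distrib_left mult_ac)
      finally show "(\<Sum>e\<in>E. \<beta> e * x powi e) = 0" by simp
    qed (use insert.hyps in auto)
    then show "(\<Sum>m'\<in>del ?e ` Me ?e. \<alpha> (m' + single a ?e) * mono_eval m' p) = 0"
      unfolding \<beta>_def sum.reindex[OF inj] o_apply by (simp add: del_def)
  qed
  then show ?case by (simp add: del_def)
qed

lemma laurent_eval_add: "laurent_eval (f + g) p = laurent_eval f p + laurent_eval g p"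
  unfolding laurent_eval_def
  by (rule setsum_keys_plus_distrib) (simp_all add: ring_distribs)

lemma laurent_eval_single [simp]:
  "laurent_eval (single m a) p = a * mono_eval m p"
  by (simp add: laurent_eval_def)

lemma laurent_eval_0 [simp]: "laurent_eval 0 p = 0"
  by (simp add: laurent_eval_def)

lemma laurent_eval_sum: "laurent_eval (\<Sum>i\<in>I. f i) p = (\<Sum>i\<in>I. laurent_eval (f i) p)"
  by (induction I rule: infinite_finite_induct) (simp_all add: laurent_eval_add)

lemma laurent_polysD:
  "f \<in> laurent_polys d \<Longrightarrow> m \<in> keys f \<Longrightarrow> r \<in> keys m \<Longrightarrow> r \<in> {1..d}"
  unfolding laurent_polys_def by blast

lemma laurent_eval_cong:
  assumes "f \<in> laurent_polys d" "\<And>r. r \<in> {1..d} \<Longrightarrow> p r = p' r"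
  shows "laurent_eval f p = laurent_eval f p'"
  unfolding laurent_eval_def using assms
  by (intro sum.cong refl arg_cong2[of _ _ _ _ "(*)"] mono_eval_cong) (auto dest: laurent_polysD)

lemma laurent_polys_add: "f \<in> laurent_polys d \<Longrightarrow> g \<in> laurent_polys d \<Longrightarrow> f + g \<in> laurent_polys d"
  using keys_add[of f g] by (auto simp: laurent_polys_def)

lemma laurent_polys_uminus: "f \<in> laurent_polys d \<Longrightarrow> - f \<in> laurent_polys d"
  by (auto simp: laurent_polys_def in_keys_iff)

lemma laurent_polys_sum: "(\<And>i. i \<in> I \<Longrightarrow> f i \<in> laurent_polys d) \<Longrightarrow> (\<Sum>i\<in>I. f i) \<in> laurent_polys d"
proof (induction I rule: infinite_finite_induct)
  case (insert i I) then show ?case by (simp add: laurent_polys_add)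
qed (simp_all add: laurent_polys_def)

lemma laurent_eval_inject:
  fixes q :: "'k::alg_closed_field"
  assumes f: "f \<in> laurent_polys d" and g: "g \<in> laurent_polys d"
    and eq: "\<And>p. generic l q Q {1..d} p \<Longrightarrow> laurent_eval f p = laurent_eval g p"
  shows "f = g"
proof -
  let ?h = "f + - g"
  have h: "?h \<in> laurent_polys d" using f g by (intro laurent_polys_add laurent_polys_uminus)
  have neg: "laurent_eval (- g) p = - laurent_eval g p" for p
    using laurent_eval_add[of g "- g" p] by (simp add: add_eq_0_iff)
  have "lookup ?h m = 0" if "m \<in> keys ?h" for m
  proof (rule mono_eval_independent[where A = "{1..d}" and M = "keys ?h"])
    show "keys m \<subseteq> {1..d}" if "m \<in> keys ?h" for m
      using h that by (auto simp: laurent_polys_def)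
    show "(\<Sum>m\<in>keys ?h. lookup ?h m * mono_eval m p) = 0"
      if "generic l q Q {1..d} p" for p
      using eq[OF that] laurent_eval_add[of f "- g" p] unfolding neg laurent_eval_def[of ?h] by simp
  qed (use that in auto)
  then have "lookup ?h m = 0" for m
    by (cases "m \<in> keys ?h") (auto simp: in_keys_iff)
  then have "?h = 0" by (intro poly_mapping_eqI) (metis lookup_zero)
  then show ?thesis by simp
qed

lemma keys_laurent_rename:
  assumes "\<And>m. m \<in> keys f \<Longrightarrow> keys m \<subseteq> A" "g ` A \<subseteq> B"
    and "m \<in> keys (laurent_rename g f)"
  shows "keys m \<subseteq> B"
proof -
  obtain m' where m': "m' \<in> keys f"
    "m = (\<Sum>j\<in>keys m'. single (g j) (lookup m' j))"
    using assms(3) Poly_Mapping.keys_sum[of _ "keys f"]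
    unfolding laurent_rename_def by (fastforce split: if_splits)
  have "keys m \<subseteq> (\<Union>j\<in>keys m'. {g j})"
    unfolding m'(2) by (rule order_trans[OF Poly_Mapping.keys_sum]) (auto split: if_splits)
  then show ?thesis using assms(1)[OF m'(1)] assms(2) by blast
qed

lemma mono_eval_sum:
  assumes "finite I" "\<And>i r. i \<in> I \<Longrightarrow> r \<in> keys (m i) \<Longrightarrow> p r \<noteq> 0"
  shows "mono_eval (\<Sum>i\<in>I. m i) p = (\<Prod>i\<in>I. mono_eval (m i) p)"
  using assms
proof (induction I rule: finite_induct)
  case (insert i I)
  have "mono_eval (m i + (\<Sum>i\<in>I. m i)) p = mono_eval (m i) p * mono_eval (\<Sum>i\<in>I. m i) p"
    by (rule mono_eval_add) (use Poly_Mapping.keys_sum[of m I] insert.prems in auto)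
  also have "mono_eval (\<Sum>i\<in>I. m i) p = (\<Prod>i\<in>I. mono_eval (m i) p)"
    using insert.prems by (intro insert.IH) blast
  finally show ?case using insert.hyps by simp
qed simp

text \<open>The map \<open>g\<close> need not be injective, so exponents may add up or even cancel;
  the power laws for that require the coordinates \<open>p (g r)\<close> to be nonzero.\<close>

lemma laurent_eval_rename:
  assumes "\<And>m. m \<in> keys f \<Longrightarrow> keys m \<subseteq> A" "\<And>r. r \<in> A \<Longrightarrow> p (g r) \<noteq> 0"
  shows "laurent_eval (laurent_rename g f) p = laurent_eval f (\<lambda>r. p (g r))"
  unfolding laurent_rename_def laurent_eval_sum laurent_eval_single laurent_eval_def[of f]
proof (rule sum.cong[OF refl])
  fix m assume m: "m \<in> keys f"
  have "mono_eval (\<Sum>j\<in>keys m. single (g j) (lookup m j)) p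
      = (\<Prod>j\<in>keys m. mono_eval (single (g j) (lookup m j)) p)"
    by (rule mono_eval_sum) (use assms(1)[OF m] assms(2) in \<open>auto split: if_splits\<close>)
  then show "lookup f m * mono_eval (\<Sum>j\<in>keys m. single (g j) (lookup m j)) p =
      lookup f m * mono_eval m (\<lambda>r. p (g r))"
    by (simp add: mono_eval_def[of m])
qed

section \<open>A representation on functions\<close>

lemma poly_mapping_add_induct [case_names zero single add]:
  assumes "P 0" "\<And>k a. P (single k a)" "\<And>f g. P f \<Longrightarrow> P g \<Longrightarrow> P (f + g)"
  shows "P (f :: 'a \<Rightarrow>\<^sub>0 'b::ab_group_add)"
proof (induction f rule: update_induct)
  case const then show ?case by (rule assms(1))
next
  case (update f a b)
  have "Poly_Mapping.update a b f = f + single a b"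
    by (rule poly_mapping_eqI)
      (use update(1) in \<open>auto simp: lookup_update lookup_add lookup_single in_keys_iff\<close>)
  then show ?case using update assms by simp
qed

section \<open>Colour tuples under permutation of positions\<close>

lemma finite_colour_tuples: "finite (colour_tuples l d)"
  unfolding colour_tuples_def
  by (rule finite_subset[OF _ finite_PiE[of "{1..l + d}" "\<lambda>_. {0, 1}"]]) auto

lemma colour_cases: "c \<in> colour_tuples l d \<Longrightarrow> i \<in> {1..l + d} \<Longrightarrow> c i = 0 \<or> c i = 1"
  unfolding colour_tuples_def by (auto simp: PiE_iff)

lemma card_Collect_permute:
  assumes "w permutes A"
  shows "card {j \<in> A. P (f (w j))} = card {j \<in> A. P (f j)}"
proof -
  have "w ` {j \<in> A. P (f (w j))} = {j \<in> A. P (f j)}"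
  proof (intro equalityI subsetI)
    fix j assume j: "j \<in> {j \<in> A. P (f j)}"
    then obtain i where "j = w i" "i \<in> A" using permutes_image[OF assms] by blast
    then show "j \<in> w ` {j \<in> A. P (f (w j))}" using j by blast
  qed (use permutes_in_image[OF assms] in auto)
  moreover have "inj_on w {j \<in> A. P (f (w j))}" using permutes_inj_on[OF assms] .
  ultimately show ?thesis using card_image[of w "{j \<in> A. P (f (w j))}"] by simp
qed

lemma colour_tuples_comp:
  assumes "c \<in> colour_tuples l d" "w permutes {1..l + d}"
  shows "c \<circ> w \<in> colour_tuples l d"
proof -
  have "c \<circ> w \<in> {1..l + d} \<rightarrow>\<^sub>E {0, 1}"
  proof (rule PiE_I)
    fix j show "j \<in> {1..l + d} \<Longrightarrow> (c \<circ> w) j \<in> {0, 1}"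
      using assms(1) permutes_in_image[OF assms(2), of j] by (auto simp: colour_tuples_def PiE_iff)
    show "j \<notin> {1..l + d} \<Longrightarrow> (c \<circ> w) j = undefined"
      using assms permutes_not_in[OF assms(2), of j] by (auto simp: colour_tuples_def)
  qed
  then show ?thesis using assms(1)
    unfolding colour_tuples_def mem_Collect_eq o_apply
    by (simp only: card_Collect_permute[OF assms(2), of "\<lambda>x. x = _"])
qed

lemma perm_tuple_transpose: "perm_tuple (transpose a b) c = c \<circ> transpose a b"
  by (auto simp: perm_tuple_def)

lemma transpose_Suc_permutes: "1 \<le> r \<Longrightarrow> r < n \<Longrightarrow> transpose r (Suc r) permutes {1..n}"
  by (rule permutes_swap_id) auto

lemma perm_tuple_colour_tuples:
  "c \<in> colour_tuples l d \<Longrightarrow> 1 \<le> r \<Longrightarrow> r < l + d \<Longrightarrow>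
    perm_tuple (transpose r (Suc r)) c \<in> colour_tuples l d"
  unfolding perm_tuple_transpose by (intro colour_tuples_comp transpose_Suc_permutes)

lemma transpose_braid:
  "transpose r (Suc r) (transpose (Suc r) (Suc (Suc r)) (transpose r (Suc r) x)) =
   transpose (Suc r) (Suc (Suc r)) (transpose r (Suc r) (transpose (Suc r) (Suc (Suc r)) x))"
  by (simp add: transpose_def)

section \<open>Counting red strands, and the coefficients of the Demazure-Lusztig operator\<close>

definition zeros_upto :: "(nat \<Rightarrow> 'k::zero) \<Rightarrow> nat \<Rightarrow> nat" where
  "zeros_upto u r = card {j \<in> {1..r}. u j = 0}"

lemma zeros_upto_Suc: "zeros_upto u (Suc r) = zeros_upto u r + (if u (Suc r) = 0 then 1 else 0)"
proof -
  have "{j \<in> {1..Suc r}. u j = 0} = {j \<in> {1..r}. u j = 0} \<union> (if u (Suc r) = 0 then {Suc r} else {})"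
    by (auto simp: le_Suc_eq)
  then show ?thesis by (simp add: zeros_upto_def card_insert_if)
qed

text \<open>Exchanging positions \<open>r\<close> and \<open>r + 1\<close> can alter only the count
  that stops between them.\<close>

lemma zeros_upto_transpose:
  assumes "1 \<le> r" "i \<noteq> r"
  shows "zeros_upto (u \<circ> transpose r (Suc r)) i = zeros_upto u i"
proof (cases "i < r")
  case True
  then have "{j \<in> {1..i}. (u \<circ> transpose r (Suc r)) j = 0} = {j \<in> {1..i}. u j = 0}"
    by (auto simp: transpose_def)
  then show ?thesis by (simp add: zeros_upto_def)
next
  case False
  then show ?thesis
    using card_Collect_permute[OF transpose_Suc_permutes[of r i], of "\<lambda>x. x = 0" u] assms
    by (simp add: zeros_upto_def)
qed

text \<open>The Demazure--Lusztig operator is \<open>f \<mapsto> dl_fix q x y * f + dl_swap q x y * s(f)\<close>.\<close>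

definition dl_fix :: "'k::field \<Rightarrow> 'k \<Rightarrow> 'k \<Rightarrow> 'k" where
  "dl_fix q x y = (q - 1) * y / (y - x)"

definition dl_swap :: "'k::field \<Rightarrow> 'k \<Rightarrow> 'k \<Rightarrow> 'k" where
  "dl_swap q x y = (y - q * x) / (y - x)"

lemma dl_fix_diff: "x \<noteq> y \<Longrightarrow> dl_fix q x y * (y - x) = (q - 1) * y"
  by (simp add: dl_fix_def)

text \<open>On the two values of a function at a point and at its exchange, the operator is a 2 by 2
  matrix with diagonal \<open>dl_fix\<close> and off-diagonal \<open>dl_swap\<close>. This is its
  trace; \<open>dl_swap_mult\<close> says that its determinant is \<open>- q\<close>. The quadratic
  relation is therefore Cayley-Hamilton.\<close>

lemma dl_fix_sum:
  assumes "x \<noteq> y" shows "dl_fix q x y + dl_fix q y x = q - 1"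
proof -
  have "dl_fix q y x = - ((q - 1) * x / (y - x))"
    unfolding dl_fix_def by (metis minus_diff_eq minus_divide_right)
  then have "dl_fix q x y + dl_fix q y x = ((q - 1) * y - (q - 1) * x) / (y - x)"
    unfolding dl_fix_def by (simp add: diff_divide_distrib)
  also have "\<dots> = q - 1" using assms by (simp flip: right_diff_distrib)
  finally show ?thesis .
qed

lemma dl_swap_mult:
  assumes "x \<noteq> y" shows "dl_swap q x y * dl_swap q y x = dl_fix q x y * dl_fix q y x + q"
proof -
  define D where "D = y - x"
  then have y: "y = x + D" "y - x = D" "x - y = - D" by simp_all
  have D: "D \<noteq> 0" using assms D_def by simp
  have "(y - q * x) * (x - q * y) = (q - 1) * y * ((q - 1) * x) - q * D * D"
    unfolding y(1) by (simp add: algebra_simps)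
  then show ?thesis unfolding dl_swap_def dl_fix_def y(2,3) using D
    by (simp add: divide_simps)
qed

text \<open>In the difference of the two sides of the braid relation this is, up to a factor, the
  coefficient at the point with the first two coordinates exchanged; \<open>dl_fix_braid2\<close> is
  the one for the last two. In the differences \<open>a\<close> and \<open>b\<close> the
  denominators are just \<open>a\<close>, \<open>b\<close> and \<open>a + b\<close>.\<close>

lemma dl_fix_braid1:
  assumes "x \<noteq> y" "y \<noteq> z" "x \<noteq> z"
  shows "dl_fix q x y * dl_fix q y z + dl_fix q x z * dl_fix q y x = dl_fix q y z * dl_fix q x z"
proof -
  define a b where "a = y - x" "b = z - y"
  then have ab: "y - x = a" "z - y = b" "z - x = a + b" "x - y = - a" "y = x + a" "z = x + a + b" by simp_all
  have "a \<noteq> 0" "b \<noteq> 0" "a + b \<noteq> 0" using assms a_b_def by auto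
  then show ?thesis unfolding dl_fix_def ab(1-4) unfolding ab(5,6)
    by (simp add: divide_simps) (simp add: algebra_simps)
qed

text \<open>After elimination of the reversed coefficients by \<open>dl_fix_sum\<close>, this and
  \<open>dl_fix_braid1\<close> are the same identity.\<close>

lemma dl_fix_braid2:
  assumes "x \<noteq> y" "y \<noteq> z" "x \<noteq> z"
  shows "dl_fix q y z * dl_fix q x y + dl_fix q x z * dl_fix q z y = dl_fix q x y * dl_fix q x z"
proof -
  have eqs: "dl_fix q z y = q - 1 - dl_fix q y z" "dl_fix q y x = q - 1 - dl_fix q x y"
    using dl_fix_sum[OF assms(1), of q] dl_fix_sum[OF assms(2), of q]
    by (simp_all only: eq_diff_eq add.commute)
  show ?thesis using dl_fix_braid1[OF assms, of q] unfolding eqs by (simp add: algebra_simps)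
qed

type_synonym 'k hecke_poly = "(hecke_gen, 'k) nc_poly"

locale hecke_parameters =
  fixes l d :: nat and q :: "'k::alg_closed_field" and Q :: "nat \<Rightarrow> 'k"
begin

abbreviation J :: "(nat \<Rightarrow> nat) set" where "J \<equiv> colour_tuples l d"

definition colour :: "(nat \<Rightarrow> 'k) \<Rightarrow> nat \<Rightarrow> nat" where
  "colour u = (\<lambda>j\<in>{1..l + d}. if u j = 0 then 1 else 0)"

text \<open>Genericity is imposed on the nonzero coordinates only, since the value 0 is repeated for
  the red strands.\<close>

definition state :: "(nat \<Rightarrow> 'k) \<Rightarrow> bool" where
  "state u \<longleftrightarrow> card {j \<in> {1..l + d}. u j = 0} = l \<and> generic l q Q {j \<in> {1..l + d}. u j \<noteq> 0} u"

lemma colour_in_J: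
  assumes "state u" shows "colour u \<in> J"
proof -
  have "card {j \<in> {1..l + d}. u j = 0} + card {j \<in> {1..l + d}. u j \<noteq> 0} =
      card ({j \<in> {1..l + d}. u j = 0} \<union> {j \<in> {1..l + d}. u j \<noteq> 0})"
    by (subst card_Un_disjoint) auto
  also have "{j \<in> {1..l + d}. u j = 0} \<union> {j \<in> {1..l + d}. u j \<noteq> 0} = {1..l + d}" by auto
  finally have "card {j \<in> {1..l + d}. u j \<noteq> 0} = d" using assms by (simp add: state_def)
  moreover have "{j \<in> {1..l + d}. colour u j = 1} = {j \<in> {1..l + d}. u j = 0}"
    "{j \<in> {1..l + d}. colour u j = 0} = {j \<in> {1..l + d}. u j \<noteq> 0}"
    by (auto simp: colour_def)
  moreover have "colour u \<in> {1..l + d} \<rightarrow>\<^sub>E {0, 1}" by (auto simp: colour_def)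
  ultimately show ?thesis using assms unfolding colour_tuples_def state_def by simp
qed

lemma colour_apply: "i \<in> {1..l + d} \<Longrightarrow> colour u i = (if u i = 0 then 1 else 0)"
  by (simp add: colour_def)

lemma colour_comp:
  assumes "w permutes {1..l + d}" shows "colour (u \<circ> w) = colour u \<circ> w"
proof
  fix j show "colour (u \<circ> w) j = (colour u \<circ> w) j"
    using permutes_in_image[OF assms, of j] by (simp add: colour_def restrict_def)
qed

lemma state_comp:
  assumes "state u" "w permutes {1..l + d}" shows "state (u \<circ> w)"
  unfolding state_def generic_def
proof (intro conjI ballI impI)
  show "card {j \<in> {1..l + d}. (u \<circ> w) j = 0} = l"
    using card_Collect_permute[OF assms(2), of "\<lambda>x. x = 0" u] assms(1) by (simp add: state_def)
  have in_iff: "w j \<in> {1..l + d} \<longleftrightarrow> j \<in> {1..l + d}" for j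
    by (rule permutes_in_image[OF assms(2)])
  have inj: "i \<noteq> j \<Longrightarrow> w i \<noteq> w j" for i j
    using permutes_inj[OF assms(2)] by (auto dest: injD)
  fix i assume i: "i \<in> {j \<in> {1..l + d}. (u \<circ> w) j \<noteq> 0}"
  then have wi: "w i \<in> {j \<in> {1..l + d}. u j \<noteq> 0}" using in_iff by auto
  have gen: "generic l q Q {j \<in> {1..l + d}. u j \<noteq> 0} u" using assms(1) by (simp add: state_def)
  show "(u \<circ> w) i \<noteq> 0" "(u \<circ> w) i \<notin> Q ` {1..l}"
    using gen wi unfolding generic_def o_apply by blast+
  fix j assume j: "j \<in> {j \<in> {1..l + d}. (u \<circ> w) j \<noteq> 0}" "i \<noteq> j"
  then have wj: "w j \<in> {j \<in> {1..l + d}. u j \<noteq> 0}" using in_iff by auto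
  show "(u \<circ> w) i \<noteq> (u \<circ> w) j" "(u \<circ> w) i \<noteq> q * (u \<circ> w) j"
    using gen wi wj inj[OF j(2)] unfolding generic_def o_apply by blast+
qed

lemma state_distinct:
  assumes "state u" "i \<in> {1..l + d}" "j \<in> {1..l + d}" "i \<noteq> j" "u i \<noteq> 0"
  shows "u i \<noteq> u j" "u j \<noteq> 0 \<Longrightarrow> u i \<noteq> q * u j"
proof -
  have gen: "generic l q Q {j \<in> {1..l + d}. u j \<noteq> 0} u" using assms(1) by (simp add: state_def)
  show "u i \<noteq> q * u j" if "u j \<noteq> 0"
    using gen assms(2-5) that unfolding generic_def by blast
  show "u i \<noteq> u j"
  proof (cases "u j = 0")
    case True then show ?thesis using assms(5) by simp
  next
    case False then show ?thesis using gen assms(2-5) unfolding generic_def by blast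
  qed
qed

text \<open>The count includes the zero at \<open>r + 1\<close> and is at most \<open>l\<close>, so
  the parameter is one of those that a generic point avoids.\<close>

lemma state_not_Q:
  assumes "state u" "i \<in> {1..l + d}" "u i \<noteq> 0" "r < l + d" "u (Suc r) = 0"
  shows "u i \<noteq> Q (zeros_upto u (Suc r))"
proof -
  have gen: "generic l q Q {j \<in> {1..l + d}. u j \<noteq> 0} u" using assms(1) by (simp add: state_def)
  have "zeros_upto u (Suc r) \<le> card {j \<in> {1..l + d}. u j = 0}"
    unfolding zeros_upto_def using assms(4) by (intro card_mono) auto
  then have "zeros_upto u (Suc r) \<in> {1..l}"
    using assms by (auto simp: zeros_upto_Suc state_def)
  then show ?thesis using gen assms(2,3) unfolding generic_def by blast
qed

text \<open>Translates the index of the parameter in the quadratic relations into a count of zero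
  coordinates.\<close>

lemma sum_colour: "r \<le> l + d \<Longrightarrow> (\<Sum>j = Suc 0..r. colour u j) = zeros_upto u r"
proof (induction r)
  case 0 then show ?case by (simp add: zeros_upto_def)
next
  case (Suc r)
  then show ?case by (simp add: zeros_upto_Suc colour_apply)
qed

definition proj :: "(nat \<Rightarrow> nat) \<Rightarrow> ((nat \<Rightarrow> 'k) \<Rightarrow> 'k) \<Rightarrow> (nat \<Rightarrow> 'k) \<Rightarrow> 'k" where
  "proj c F u = (if colour u = c then F u else 0)"

definition T_fix :: "nat \<Rightarrow> (nat \<Rightarrow> 'k) \<Rightarrow> 'k" where
  "T_fix r u = (if u r \<noteq> 0 \<and> u (Suc r) \<noteq> 0 then dl_fix q (u r) (u (Suc r)) else 0)"

text \<open>For a mixed pair the quadratic relation prescribes only the product of the factors of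
  the two crossings. Here the black-red crossing carries all of it and the red-black crossing
  carries 1.\<close>

definition T_swap :: "nat \<Rightarrow> (nat \<Rightarrow> 'k) \<Rightarrow> 'k" where
  "T_swap r u =
    (if u r \<noteq> 0 then
      (if u (Suc r) \<noteq> 0 then dl_swap q (u r) (u (Suc r)) else u r - Q (zeros_upto u (Suc r)))
     else (if u (Suc r) \<noteq> 0 then 1 else 0))"

definition op_T :: "nat \<Rightarrow> ((nat \<Rightarrow> 'k) \<Rightarrow> 'k) \<Rightarrow> (nat \<Rightarrow> 'k) \<Rightarrow> 'k" where
  "op_T r F u = T_fix r u * F u + T_swap r u * F (u \<circ> transpose r (Suc r))"

lemma op_T_black_black:
  "u r \<noteq> 0 \<Longrightarrow> u (Suc r) \<noteq> 0 \<Longrightarrow> op_T r F u =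
    dl_fix q (u r) (u (Suc r)) * F u + dl_swap q (u r) (u (Suc r)) * F (u \<circ> transpose r (Suc r))"
  by (simp add: op_T_def T_fix_def T_swap_def)

lemma op_T_black_red:
  "u r \<noteq> 0 \<Longrightarrow> u (Suc r) = 0 \<Longrightarrow>
    op_T r F u = (u r - Q (zeros_upto u (Suc r))) * F (u \<circ> transpose r (Suc r))"
  by (simp add: op_T_def T_fix_def T_swap_def)

lemma op_T_red_black:
  "u r = 0 \<Longrightarrow> u (Suc r) \<noteq> 0 \<Longrightarrow> op_T r F u = F (u \<circ> transpose r (Suc r))"
  by (simp add: op_T_def T_fix_def T_swap_def)

lemma op_T_red_red: "u r = 0 \<Longrightarrow> u (Suc r) = 0 \<Longrightarrow> op_T r F u = 0"
  by (simp add: op_T_def T_fix_def T_swap_def)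

text \<open>The convention \<open>inverse 0 = 0\<close> makes \<open>Gen_X'\<close> vanish at red
  positions, as its relation demands.\<close>

fun gen_act :: "hecke_gen \<Rightarrow> ((nat \<Rightarrow> 'k) \<Rightarrow> 'k) \<Rightarrow> (nat \<Rightarrow> 'k) \<Rightarrow> 'k" where
  "gen_act (Gen_e c) F = proj c F"
| "gen_act (Gen_T r) F = op_T r F"
| "gen_act (Gen_X j) F = (\<lambda>u. u j * F u)"
| "gen_act (Gen_X' j) F = (\<lambda>u. inverse (u j) * F u)"

definition act :: "'k hecke_poly \<Rightarrow> ((nat \<Rightarrow> 'k) \<Rightarrow> 'k) \<Rightarrow> (nat \<Rightarrow> 'k) \<Rightarrow> 'k" where
  "act a F u = (\<Sum>w\<in>keys a. lookup a w * foldr gen_act (letters w) F u)"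

lemma gen_act_linear: "gen_act g (\<lambda>u. F u + a * G u) = (\<lambda>u. gen_act g F u + a * gen_act g G u)"
proof (cases g)
  case (Gen_T r)
  then show ?thesis by (simp add: op_T_def algebra_simps fun_eq_iff)
qed (auto simp: proj_def algebra_simps fun_eq_iff)

lemma word_act_linear:
  "foldr gen_act ws (\<lambda>u. F u + a * G u) = (\<lambda>u. foldr gen_act ws F u + a * foldr gen_act ws G u)"
  by (induction ws) (simp_all add: gen_act_linear)

lemma act_0 [simp]: "act 0 F u = 0"
  by (simp add: act_def)

lemma act_single: "act (single w a) F u = a * foldr gen_act (letters w) F u"
  by (simp add: act_def)

lemma act_add [simp]: "act (a + b) F u = act a F u + act b F u"
  unfolding act_def by (rule setsum_keys_plus_distrib) (simp_all add: ring_distribs)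

lemma act_minus [simp]: "act (- a) F u = - act a F u"
  using act_add[of a "- a" F u] by (simp add: add_eq_0_iff)

lemma act_diff [simp]: "act (a - b) F u = act a F u - act b F u"
  using act_add[of a "- b" F u] by simp

lemma act_sum: "act (\<Sum>i\<in>I. a i) F u = (\<Sum>i\<in>I. act (a i) F u)"
  by (induction I rule: infinite_finite_induct) simp_all

lemma act_linear: "act a (\<lambda>u. F u + b * G u) u = act a F u + b * act a G u"
  by (simp add: act_def word_act_linear sum.distrib sum_distrib_left algebra_simps)

lemma act_fun_zero [simp]: "act a (\<lambda>u. 0) u = 0"
  using act_linear[of a "\<lambda>_. 0" "-1" "\<lambda>_. 0" u] by simp

lemma act_fun_add: "act a (\<lambda>u. F u + G u) u = act a F u + act a G u"
  using act_linear[of a F 1 G u] by simp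

lemma act_fun_scale: "act a (\<lambda>u. b * G u) u = b * act a G u"
  using act_linear[of a "\<lambda>_. 0" b G u] by simp

lemma act_mult: "act (a * b) F = act a (act b F)"
proof
  fix u
  show "act (a * b) F u = act a (act b F) u"
  proof (induction a rule: poly_mapping_add_induct)
    case (single w x)
    show ?case
    proof (induction b rule: poly_mapping_add_induct)
      case zero
      have "act 0 F = (\<lambda>u. 0)" by (simp add: fun_eq_iff)
      then show ?case by simp
    next
      case (single v y)
      have "act (single v y) F = (\<lambda>u. y * foldr gen_act (letters v) F u)"
        by (simp add: act_single fun_eq_iff)
      then show ?case
        by (simp add: mult_single act_fun_scale) (simp add: act_single plus_word_def)
    next
      case (add f g)
      have "act (f + g) F = (\<lambda>u. act f F u + act g F u)" by (simp add: fun_eq_iff)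
      then show ?case using add by (simp add: distrib_left act_fun_add)
    qed
  qed (simp_all add: distrib_right)
qed

lemma act_one [simp]: "act 1 F = F"
  by (simp add: fun_eq_iff act_single zero_word_def flip: single_one)

lemma act_const [simp]: "act (nc_const x) F = (\<lambda>u. x * F u)"
  by (simp add: fun_eq_iff nc_const_def act_single zero_word_def)

lemma act_var [simp]: "act (nc_var g) F = gen_act g F"
  by (simp add: fun_eq_iff nc_var_def act_single)

lemma act_diff_fun: "act (a - b) F = (\<lambda>u. act a F u - act b F u)" by (simp add: fun_eq_iff)

lemma gen_act_local:
  assumes "\<And>r. g = Gen_T r \<Longrightarrow> r \<in> A \<and> Suc r \<in> A"
    and "\<And>w. w permutes A \<Longrightarrow> F (u \<circ> w) = G (u \<circ> w)"
  shows "gen_act g F u = gen_act g G u"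
proof -
  have 0: "F u = G u" using assms(2)[OF permutes_id] by (simp add: comp_def)
  show ?thesis
  proof (cases g)
    case (Gen_T r)
    have "transpose r (Suc r) permutes A"
      using assms(1)[OF Gen_T] by (intro permutes_swap_id) auto
    then show ?thesis using Gen_T 0 assms(2) by (simp add: op_T_def)
  qed (use 0 in \<open>auto simp: proj_def\<close>)
qed

lemma word_act_local:
  assumes "\<And>r. Gen_T r \<in> set ws \<Longrightarrow> r \<in> A \<and> Suc r \<in> A"
    and "\<And>w. w permutes A \<Longrightarrow> F (u \<circ> w) = G (u \<circ> w)"
  shows "foldr gen_act ws F u = foldr gen_act ws G u"
  using assms
proof (induction ws arbitrary: u)
  case Nil then show ?case using Nil(2)[OF permutes_id] by (simp add: comp_def)
next
  case (Cons g ws)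
  have "gen_act g (foldr gen_act ws F) u = gen_act g (foldr gen_act ws G) u"
  proof (rule gen_act_local[where A = A])
    show "r \<in> A \<and> Suc r \<in> A" if "g = Gen_T r" for r using Cons.prems(1) that by simp
    fix w assume w: "w permutes A"
    show "foldr gen_act ws F (u \<circ> w) = foldr gen_act ws G (u \<circ> w)"
    proof (rule Cons.IH)
      show "r \<in> A \<and> Suc r \<in> A" if "Gen_T r \<in> set ws" for r using Cons.prems(1) that by simp
      fix w' assume "w' permutes A"
      then show "F (u \<circ> w \<circ> w') = G (u \<circ> w \<circ> w')"
        unfolding comp_assoc by (intro Cons.prems(2) permutes_compose[OF _ w])
    qed
  qed
  then show ?case by simp
qed

text \<open>Among the generators only \<open>Gen_T r\<close> reads its argument at another point,
  namely with coordinates \<open>r\<close> and \<open>r + 1\<close> exchanged. With \<open>A\<close>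
  containing all these positions, only the orbit of \<open>u\<close> under permutations of
  \<open>A\<close> matters.\<close>

lemma act_local:
  assumes "\<And>v r. v \<in> keys a \<Longrightarrow> Gen_T r \<in> set (letters v) \<Longrightarrow> r \<in> A \<and> Suc r \<in> A"
    and "\<And>w. w permutes A \<Longrightarrow> F (u \<circ> w) = G (u \<circ> w)"
  shows "act a F u = act a G u"
  unfolding act_def
  by (intro sum.cong refl arg_cong2[of _ _ _ _ "(*)"] word_act_local[where A = A])
    (use assms in blast)+

section \<open>The defining relations hold for the operators at states\<close>

lemma op_T_proj:
  assumes "1 \<le> r" "r < l + d"
  shows "op_T r (proj c F) = proj (perm_tuple (transpose r (Suc r)) c) (op_T r F)"
proof
  fix u
  let ?s = "transpose r (Suc r)"
  have cs: "colour (u \<circ> ?s) = colour u \<circ> ?s"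
    by (rule colour_comp[OF transpose_Suc_permutes[OF assms]])
  have ss: "v \<circ> ?s \<circ> ?s = v" for v :: "nat \<Rightarrow> nat" by (simp add: comp_assoc)
  have 1: "colour (u \<circ> ?s) = c \<longleftrightarrow> colour u = c \<circ> ?s"
  proof
    assume "colour (u \<circ> ?s) = c"
    then have "c \<circ> ?s = colour u \<circ> ?s \<circ> ?s" using cs by simp
    then show "colour u = c \<circ> ?s" by (simp only: ss)
  next
    assume "colour u = c \<circ> ?s"
    then show "colour (u \<circ> ?s) = c" by (simp only: cs ss)
  qed
  \<comment> \<open>For two black strands the term without exchange is present too, and it has to
    satisfy the same colour condition as the exchanged one.\<close>
  have 2: "colour u = c \<longleftrightarrow> colour u = c \<circ> ?s" if "u r \<noteq> 0" "u (Suc r) \<noteq> 0"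
  proof -
    have "colour u \<circ> ?s = colour u"
      using that assms by (auto simp: fun_eq_iff transpose_def colour_apply)
    then show ?thesis unfolding 1[symmetric] cs by simp
  qed
  show "op_T r (proj c F) u = proj (perm_tuple ?s c) (op_T r F) u"
    by (cases "u r = 0"; cases "u (Suc r) = 0")
      (simp_all only: op_T_black_black op_T_black_red op_T_red_black op_T_red_red not_False_eq_True
        proj_def perm_tuple_transpose 1 2, simp_all)
qed

lemma perm_tuple_twice: "perm_tuple (transpose a b) (perm_tuple (transpose a b) c) = c"
  by (simp add: perm_tuple_transpose comp_assoc)

lemma transpose_twice_comp: "u \<circ> transpose a b \<circ> transpose a b = u"
  by (simp add: comp_assoc)

lemma op_T_square:
  assumes "state u" "1 \<le> r" "r < l + d"
  shows "op_T r (op_T r F) u =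
    (if u r \<noteq> 0 then
      (if u (Suc r) \<noteq> 0 then (q - 1) * op_T r F u + q * F u
       else (u r - Q (zeros_upto u (Suc r))) * F u)
     else (if u (Suc r) \<noteq> 0 then (u (Suc r) - Q (zeros_upto u r)) * F u else 0))"
proof -
  have ne: "u r \<noteq> u (Suc r)" if "u r \<noteq> 0"
    using state_distinct(1)[OF assms(1), of r "Suc r"] assms that by simp
  have z: "zeros_upto (u \<circ> transpose r (Suc r)) (Suc r) = zeros_upto u (Suc r)"
    using assms by (simp add: zeros_upto_transpose)
  have t: "(u \<circ> transpose r (Suc r)) r = u (Suc r)" "(u \<circ> transpose r (Suc r)) (Suc r) = u r"
    by simp_all
  consider "u r \<noteq> 0" "u (Suc r) \<noteq> 0" | "u r \<noteq> 0" "u (Suc r) = 0" | "u r = 0" "u (Suc r) \<noteq> 0"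
    | "u r = 0" "u (Suc r) = 0" by blast
  then show ?thesis
  proof cases
    case 1
    let ?f = "F u" and ?g = "F (u \<circ> transpose r (Suc r))"
    let ?a = "dl_fix q (u r) (u (Suc r))" and ?a' = "dl_fix q (u (Suc r)) (u r)"
    let ?b = "dl_swap q (u r) (u (Suc r))" and ?b' = "dl_swap q (u (Suc r)) (u r)"
    have "op_T r (op_T r F) u = ?a * (?a * ?f + ?b * ?g) + ?b * (?a' * ?g + ?b' * ?f)"
      using 1 by (simp only: op_T_black_black t transpose_twice_comp not_False_eq_True)
    also have "\<dots> = ?a * ?a * ?f + (?b * ?b') * ?f + (?a + ?a') * ?b * ?g"
      by (simp add: algebra_simps)
    also have "\<dots> = ?a * (?a + ?a') * ?f + q * ?f + (?a + ?a') * ?b * ?g"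
      unfolding dl_swap_mult[OF ne[OF 1(1)]] by (simp add: algebra_simps)
    also have "\<dots> = (q - 1) * op_T r F u + q * F u"
      unfolding dl_fix_sum[OF ne[OF 1(1)]] op_T_black_black[OF 1] by (simp add: algebra_simps)
    finally show ?thesis using 1 by simp
  next
    case 2
    then show ?thesis by (simp only: op_T_black_red op_T_red_black t transpose_twice_comp if_True if_False simp_thms)
  next
    case 3
    then show ?thesis
      by (simp only: op_T_black_red op_T_red_black t transpose_twice_comp z if_True if_False simp_thms)
        (simp add: zeros_upto_Suc)
  next
    case 4
    then show ?thesis by (simp add: op_T_red_red)
  qed
qed


text \<open>The exchanged terms cancel, because the exchange turns the coordinate at
  \<open>Suc r\<close> into the one at \<open>r\<close>. What remains is \<open>dl_fix\<close> times
  the difference of the two coordinates.\<close>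

lemma op_T_X_up:
  assumes "state u" "1 \<le> r" "r < l + d"
  shows "op_T r (\<lambda>u. u (Suc r) * F u) u - u r * op_T r F u =
    (if u r \<noteq> 0 \<and> u (Suc r) \<noteq> 0 then (q - 1) * u (Suc r) * F u else 0)"
proof (cases "u r \<noteq> 0 \<and> u (Suc r) \<noteq> 0")
  case True
  then have "op_T r (\<lambda>u. u (Suc r) * F u) u - u r * op_T r F u =
      dl_fix q (u r) (u (Suc r)) * (u (Suc r) - u r) * F u"
    by (simp add: op_T_black_black algebra_simps)
  then show ?thesis
    using True dl_fix_diff[OF state_distinct(1)[OF assms(1), of r "Suc r"], of q] assms by simp
next
  case False
  then show ?thesis by (auto simp: op_T_def T_fix_def)
qed

lemma op_T_X_down:
  assumes "state u" "1 \<le> r" "r < l + d"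
  shows "op_T r (\<lambda>u. u r * F u) u - u (Suc r) * op_T r F u =
    (if u r \<noteq> 0 \<and> u (Suc r) \<noteq> 0 then - (q - 1) * u (Suc r) * F u else 0)"
proof (cases "u r \<noteq> 0 \<and> u (Suc r) \<noteq> 0")
  case True
  then have "op_T r (\<lambda>u. u r * F u) u - u (Suc r) * op_T r F u =
      - (dl_fix q (u r) (u (Suc r)) * (u (Suc r) - u r)) * F u"
    by (simp add: op_T_black_black algebra_simps)
  also have "dl_fix q (u r) (u (Suc r)) * (u (Suc r) - u r) = (q - 1) * u (Suc r)"
    by (rule dl_fix_diff, rule state_distinct(1)[OF assms(1)]) (use True assms in simp_all)
  finally show ?thesis using True by (simp add: algebra_simps)
next
  case False
  then show ?thesis by (auto simp: op_T_def T_fix_def)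
qed

lemma op_T_commute:
  assumes "1 \<le> r" "r + 1 < s"
  shows "op_T r (op_T s F) u = op_T s (op_T r F) u"
proof -
  have tr: "transpose s (Suc s) r = r" "transpose s (Suc s) (Suc r) = Suc r"
    "transpose r (Suc r) s = s" "transpose r (Suc r) (Suc s) = Suc s"
    using assms by (simp_all add: transpose_def)
  have "T_fix r (u \<circ> transpose s (Suc s)) = T_fix r u" "T_fix s (u \<circ> transpose r (Suc r)) = T_fix s u"
    by (simp_all add: T_fix_def tr)
  moreover have "T_swap r (u \<circ> transpose s (Suc s)) = T_swap r u" "T_swap s (u \<circ> transpose r (Suc r)) = T_swap s u"
    using assms by (simp_all add: T_swap_def tr zeros_upto_transpose)
  moreover have "u \<circ> transpose r (Suc r) \<circ> transpose s (Suc s) = u \<circ> transpose s (Suc s) \<circ> transpose r (Suc r)"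
    using assms by (auto simp: fun_eq_iff transpose_def)
  ultimately show ?thesis by (simp add: op_T_def algebra_simps)
qed

lemma comp_transpose_braid:
  "u \<circ> transpose r (Suc r) \<circ> transpose (Suc r) (Suc (Suc r)) \<circ> transpose r (Suc r) =
   u \<circ> transpose (Suc r) (Suc (Suc r)) \<circ> transpose r (Suc r) \<circ> transpose (Suc r) (Suc (Suc r))"
  by (simp add: fun_eq_iff transpose_braid)

text \<open>For three black strands the terms with two or three exchanges agree on both sides. The
  coefficients of the terms with one exchange are the identities \<open>dl_fix_braid1\<close> and
  \<open>dl_fix_braid2\<close>; the term at \<open>u\<close> itself reduces to them through
  \<open>dl_swap_mult\<close>.\<close>

lemma op_T_braid_black_middle:
  assumes u: "state u" "1 \<le> r" "Suc r < l + d" "u (Suc r) \<noteq> 0"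
  shows "op_T r (op_T (Suc r) (op_T r F)) u = op_T (Suc r) (op_T r (op_T (Suc r) F)) u"
proof -
  let ?s = "transpose r (Suc r)" and ?t = "transpose (Suc r) (Suc (Suc r))"
  let ?x = "u r" and ?y = "u (Suc r)" and ?z = "u (Suc (Suc r))"
  have tr: "?s (Suc (Suc r)) = Suc (Suc r)" "?t r = r" by (simp_all add: transpose_def)
  note simps = op_T_black_black op_T_black_red op_T_red_black op_T_red_red tr
    transpose_twice_comp comp_transpose_braid zeros_upto_Suc zeros_upto_transpose
  consider "?x \<noteq> 0" "?z \<noteq> 0" | "?x \<noteq> 0" "?z = 0" | "?x = 0" "?z \<noteq> 0" | "?x = 0" "?z = 0" by blast
  then show ?thesis
  proof cases
    case 1
    have ne: "?x \<noteq> ?y" "?y \<noteq> ?z" "?x \<noteq> ?z"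
      by (rule state_distinct(1)[OF u(1)]; use u 1 in simp)+
    let ?a = "dl_fix q" and ?b = "dl_swap q"
    let ?f = "F u" and ?f1 = "F (u \<circ> ?s)" and ?f2 = "F (u \<circ> ?t)" and ?f12 = "F (u \<circ> ?s \<circ> ?t)"
      and ?f21 = "F (u \<circ> ?t \<circ> ?s)" and ?f212 = "F (u \<circ> ?t \<circ> ?s \<circ> ?t)"
    have L: "op_T r (op_T (Suc r) (op_T r F)) u =
      ?a ?x ?y * (?a ?y ?z * (?a ?x ?y * ?f + ?b ?x ?y * ?f1) + ?b ?y ?z * (?a ?x ?z * ?f2 + ?b ?x ?z * ?f21))
      + ?b ?x ?y * (?a ?x ?z * (?a ?y ?x * ?f1 + ?b ?y ?x * ?f) + ?b ?x ?z * (?a ?y ?z * ?f12 + ?b ?y ?z * ?f212))"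
      using u 1 by (simp add: op_T_black_black tr transpose_twice_comp comp_transpose_braid)
    have R: "op_T (Suc r) (op_T r (op_T (Suc r) F)) u =
      ?a ?y ?z * (?a ?x ?y * (?a ?y ?z * ?f + ?b ?y ?z * ?f2) + ?b ?x ?y * (?a ?x ?z * ?f1 + ?b ?x ?z * ?f12))
      + ?b ?y ?z * (?a ?x ?z * (?a ?z ?y * ?f2 + ?b ?z ?y * ?f) + ?b ?x ?z * (?a ?x ?y * ?f21 + ?b ?x ?y * ?f212))"
      using u 1 by (simp add: op_T_black_black tr transpose_twice_comp comp_transpose_braid)
    have "op_T r (op_T (Suc r) (op_T r F)) u - op_T (Suc r) (op_T r (op_T (Suc r) F)) u =
      ?f * (?a ?x ?y * ?a ?x ?y * ?a ?y ?z + (?b ?x ?y * ?b ?y ?x) * ?a ?x ?z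
          - ?a ?y ?z * ?a ?y ?z * ?a ?x ?y - (?b ?y ?z * ?b ?z ?y) * ?a ?x ?z)
      + ?f1 * ?b ?x ?y * (?a ?x ?y * ?a ?y ?z + ?a ?x ?z * ?a ?y ?x - ?a ?y ?z * ?a ?x ?z)
      - ?f2 * ?b ?y ?z * (?a ?y ?z * ?a ?x ?y + ?a ?x ?z * ?a ?z ?y - ?a ?x ?y * ?a ?x ?z)"
      unfolding L R by (simp add: algebra_simps)
    also have "\<dots> = ?f * (?a ?x ?y * (?a ?x ?y * ?a ?y ?z + ?a ?x ?z * ?a ?y ?x)
          - ?a ?y ?z * (?a ?y ?z * ?a ?x ?y + ?a ?x ?z * ?a ?z ?y))
      + ?f1 * ?b ?x ?y * (?a ?x ?y * ?a ?y ?z + ?a ?x ?z * ?a ?y ?x - ?a ?y ?z * ?a ?x ?z)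
      - ?f2 * ?b ?y ?z * (?a ?y ?z * ?a ?x ?y + ?a ?x ?z * ?a ?z ?y - ?a ?x ?y * ?a ?x ?z)"
      unfolding dl_swap_mult[OF ne(1)] dl_swap_mult[OF ne(2)] by (simp add: algebra_simps)
    also have "\<dots> = 0"
      unfolding dl_fix_braid1[OF ne] dl_fix_braid2[OF ne] by (simp add: algebra_simps)
    finally show ?thesis by simp
  next
    case 2
    \<comment> \<open>Both exchanged coordinates are nonzero here, so even the count that stops
      between them is unchanged.\<close>
    then have "zeros_upto (u \<circ> ?s) r = zeros_upto u r"
      using zeros_upto_transpose[of r "Suc r" u] u by (simp add: zeros_upto_Suc)
    then show ?thesis using u 2 by (simp add: simps algebra_simps)
  next
    case 3 then show ?thesis using u by (simp add: simps algebra_simps)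
  next
    case 4 then show ?thesis using u by (simp add: simps algebra_simps)
  qed
qed

text \<open>Each side lets the two black strands meet once, on different sides of the red one. The
  terms exchanging them agree; the others carry the factors \<open>u r - Q\<close> and
  \<open>u (Suc (Suc r)) - Q\<close> with the same parameter, which cancels and leaves
  \<open>dl_fix\<close> times a difference of coordinates.\<close>

lemma op_T_braid_red_middle:
  assumes u: "state u" "1 \<le> r" "Suc r < l + d" "u r \<noteq> 0" "u (Suc r) = 0" "u (Suc (Suc r)) \<noteq> 0"
  shows "op_T r (op_T (Suc r) (op_T r F)) u - op_T (Suc r) (op_T r (op_T (Suc r) F)) u =
    (1 - q) * u (Suc (Suc r)) * F u"
proof -
  let ?s = "transpose r (Suc r)" and ?t = "transpose (Suc r) (Suc (Suc r))"
  let ?x = "u r" and ?z = "u (Suc (Suc r))"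
  have tr: "?s (Suc (Suc r)) = Suc (Suc r)" "?t r = r" by (simp_all add: transpose_def)
  have zz: "zeros_upto u (Suc (Suc r)) = zeros_upto u (Suc r)"
    using u(6) by (simp add: zeros_upto_Suc[of u "Suc r"])
  have ne: "?x \<noteq> ?z" by (rule state_distinct(1)[OF u(1)]; use u in simp)
  have "op_T r (op_T (Suc r) (op_T r F)) u - op_T (Suc r) (op_T r (op_T (Suc r) F)) u =
    - (dl_fix q ?x ?z * (?z - ?x)) * F u"
    using u by (simp add: op_T_black_black op_T_black_red op_T_red_black op_T_red_red tr
      transpose_twice_comp comp_transpose_braid zz zeros_upto_transpose algebra_simps)
  then show ?thesis unfolding dl_fix_diff[OF ne] by (simp add: algebra_simps)
qed

end

section \<open>The ideal of relations\<close>

lemma nc_single_eq: "single (Word ws) a = nc_const a * prod_list (map nc_var ws)"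
proof (induction ws arbitrary: a)
  case Nil then show ?case by (simp add: nc_const_def zero_word_def)
next
  case (Cons g ws)
  have "single (Word (g # ws)) a =
      nc_const a * (nc_var g * single (Word ws) 1)"
    by (simp add: nc_const_def nc_var_def mult_single plus_word_def zero_word_def)
  then show ?case using Cons[of 1] by (simp add: nc_const_def single_one)
qed

lemma nc_const_simps [simp]: "nc_const 0 = 0" "nc_const 1 = 1"
  by (simp_all add: nc_const_def single_one)

lemma nc_const_add: "nc_const (a + b) = nc_const a + nc_const b"
  by (simp add: nc_const_def single_add)

lemma nc_const_mult: "nc_const (a * b) = nc_const a * nc_const b"
  by (simp add: nc_const_def mult_single)

lemma nc_const_uminus: "nc_const (- a) = - nc_const a"
  by (simp add: nc_const_def single_uminus)

lemma nc_const_commute: "nc_const (a::'k::comm_ring_1) * x = x * nc_const a"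
proof (induction x rule: poly_mapping_add_induct)
  case (single k b) then show ?case by (simp add: nc_const_def mult_single mult.commute)
qed (simp_all add: distrib_left distrib_right)

lemma free_algebra_simps [simp]:
  "zero (free_algebra G) = 0" "one (free_algebra G) = 1"
  "add (free_algebra G) = (+)" "monoid.mult (free_algebra G) = (*)"
  by (simp_all add: free_algebra_def)

lemma free_algebra_closed:
  fixes a b :: "('g, 'k::ring_1) nc_poly"
  shows "0 \<in> carrier (free_algebra G)" "1 \<in> carrier (free_algebra G)"
    "a \<in> carrier (free_algebra G) \<Longrightarrow> b \<in> carrier (free_algebra G) \<Longrightarrow> a + b \<in> carrier (free_algebra G)"
    "a \<in> carrier (free_algebra G) \<Longrightarrow> - a \<in> carrier (free_algebra G)"
    "a \<in> carrier (free_algebra G) \<Longrightarrow> b \<in> carrier (free_algebra G) \<Longrightarrow> a - b \<in> carrier (free_algebra G)"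
    "a \<in> carrier (free_algebra G) \<Longrightarrow> b \<in> carrier (free_algebra G) \<Longrightarrow> a * b \<in> carrier (free_algebra G)"
    "nc_const x \<in> carrier (free_algebra G)"
    "g \<in> G \<Longrightarrow> nc_var g \<in> carrier (free_algebra G)"
proof -
  show add: "a + b \<in> carrier (free_algebra G)"
    if "a \<in> carrier (free_algebra G)" "b \<in> carrier (free_algebra G)" for a b :: "('g, 'k) nc_poly"
    using that keys_add[of a b] by (auto simp: free_algebra_def)
  show neg: "- a \<in> carrier (free_algebra G)"
    if "a \<in> carrier (free_algebra G)" for a :: "('g, 'k) nc_poly"
    using that by (auto simp: free_algebra_def in_keys_iff)
  show "a - b \<in> carrier (free_algebra G)"
    if "a \<in> carrier (free_algebra G)" "b \<in> carrier (free_algebra G)"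
    using add[OF that(1) neg[OF that(2)]] by simp
  show "a * b \<in> carrier (free_algebra G)"
    if "a \<in> carrier (free_algebra G)" "b \<in> carrier (free_algebra G)"
    using that keys_mult[of a b] unfolding free_algebra_def by (fastforce simp: plus_word_def)
qed (auto simp: free_algebra_def zero_word_def nc_const_def nc_var_def single_one[symmetric]
  simp del: single_one)

lemma ring_free_algebra: "ring (free_algebra G :: ('g, 'k::ring_1) nc_poly ring)"
proof (rule ringI)
  show "abelian_group (free_algebra G :: ('g, 'k) nc_poly ring)"
  proof (rule abelian_groupI)
    fix x :: "('g, 'k) nc_poly" assume "x \<in> carrier (free_algebra G)"
    then show "\<exists>y\<in>carrier (free_algebra G). y \<oplus>\<^bsub>free_algebra G\<^esub> x = \<zero>\<^bsub>free_algebra G\<^esub>"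
      by (intro bexI[of _ "- x"]) (simp_all add: free_algebra_closed)
  qed (simp_all add: free_algebra_closed algebra_simps)
  show "Group.monoid (free_algebra G :: ('g, 'k) nc_poly ring)"
    by (rule monoidI) (simp_all add: free_algebra_closed mult.assoc)
qed (simp_all add: free_algebra_closed algebra_simps)

lemma free_algebra_a_inv:
  fixes x :: "('g, 'k::ring_1) nc_poly"
  assumes "x \<in> carrier (free_algebra G)"
  shows "a_inv (free_algebra G) x = - x"
proof -
  interpret ring "free_algebra G :: ('g, 'k) nc_poly ring" by (rule ring_free_algebra)
  show ?thesis
    by (rule minus_equality) (use assms in \<open>simp_all add: free_algebra_closed\<close>)
qed

lemma hecke_gens_iff:
  "Gen_e c \<in> hecke_gens l d \<longleftrightarrow> c \<in> colour_tuples l d"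
  "Gen_T r \<in> hecke_gens l d \<longleftrightarrow> 1 \<le> r \<and> r < l + d"
  "Gen_X i \<in> hecke_gens l d \<longleftrightarrow> i \<in> {1..l + d}"
  "Gen_X' i \<in> hecke_gens l d \<longleftrightarrow> i \<in> {1..l + d}"
  by (auto simp: hecke_gens_def)

context hecke_parameters
begin

abbreviation C :: "'k hecke_poly set" where "C \<equiv> carrier (hecke_free l d)"
abbreviation I :: "'k hecke_poly set" where "I \<equiv> hecke_ideal l d q Q"

lemmas C_closed = free_algebra_closed[where G = "hecke_gens l d"]

lemma gens_closed:
  "c \<in> J \<Longrightarrow> ge c \<in> C" "1 \<le> r \<Longrightarrow> r < l + d \<Longrightarrow> gT r \<in> C"
  "i \<in> {1..l + d} \<Longrightarrow> gX i \<in> C" "i \<in> {1..l + d} \<Longrightarrow> gX' i \<in> C"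
  by (intro C_closed; simp add: hecke_gens_iff)+

lemma C_sum: "(\<And>i. i \<in> S \<Longrightarrow> f i \<in> C) \<Longrightarrow> (\<Sum>i\<in>S. f i) \<in> C"
  by (induction S rule: infinite_finite_induct) (simp_all add: C_closed)

lemma colour_eq_iff:
  "i \<in> {1..l + d} \<Longrightarrow> colour u i = 0 \<longleftrightarrow> u i \<noteq> 0"
  "i \<in> {1..l + d} \<Longrightarrow> colour u i = 1 \<longleftrightarrow> u i = 0"
  by (simp_all add: colour_apply)

lemma hecke_rel_act:
  assumes "hecke_rel l d q Q a b" "state u"
  shows "act a F u = act b F u"
  using assms(1)
proof cases
  case (e_orth c c')
  then show ?thesis by (simp add: act_mult proj_def)
next
  case e_sum
  have "act a F u = (\<Sum>c\<in>J. proj c F u)" using e_sum by (simp add: act_sum)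
  also have "\<dots> = (\<Sum>c\<in>J. if c = colour u then F u else 0)" by (rule sum.cong) (auto simp: proj_def)
  also have "\<dots> = F u" using colour_in_J[OF assms(2)] finite_colour_tuples by simp
  finally show ?thesis using e_sum by simp
next
  case (X_red c i)
  have "u i = 0" if "colour u = c"
    using X_red(5) colour_eq_iff[OF X_red(4), of u] that by simp
  then show ?thesis using X_red by (simp add: act_mult proj_def)
next
  case (X'_red c i)
  have "u i = 0" if "colour u = c"
    using X'_red(5) colour_eq_iff[OF X'_red(4), of u] that by simp
  then show ?thesis using X'_red by (simp add: act_mult proj_def)
next
  case (X_X'_black c i)
  have "u i \<noteq> 0" if "colour u = c"
    using X_X'_black(5) colour_eq_iff[OF X_X'_black(4), of u] that by simp
  then show ?thesis using X_X'_black by (simp add: act_mult proj_def)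
next
  case (X'_X_black c i)
  have "u i \<noteq> 0" if "colour u = c"
    using X'_X_black(5) colour_eq_iff[OF X'_X_black(4), of u] that by simp
  then show ?thesis using X'_X_black by (simp add: act_mult proj_def)
next
  case (T_T r s)
  then show ?thesis using op_T_commute[of r s] op_T_commute[of s r] by (auto simp: act_mult)
next
  case (T_X r i)
  then have "transpose r (Suc r) i = i" by (simp add: transpose_def)
  then show ?thesis using T_X by (simp add: act_mult op_T_def algebra_simps)
next
  case (T_red_red c r)
  then have "perm_tuple (transpose r (Suc r)) c = c"
    by (auto simp: perm_tuple_transpose fun_eq_iff transpose_def)
  moreover have "u r = 0" "u (Suc r) = 0" if "colour u = c"
    using T_red_red colour_eq_iff[of r u] colour_eq_iff[of "Suc r" u] that by auto
  ultimately show ?thesis using T_red_red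
    by (simp add: act_mult op_T_proj proj_def op_T_red_red)
next
  case (T_e c r)
  then show ?thesis by (simp add: act_mult op_T_proj)
next
  case (T_X_up c r)
  have "c r = 0 \<longleftrightarrow> u r \<noteq> 0" "c (Suc r) = 0 \<longleftrightarrow> u (Suc r) \<noteq> 0" if "colour u = c"
    using T_X_up colour_eq_iff[of r u] colour_eq_iff[of "Suc r" u] that by auto
  then show ?thesis
    using op_T_X_up[OF assms(2), of r "proj c F"] T_X_up
    by (cases "colour u = c") (simp_all add: act_mult act_diff_fun proj_def)
next
  case (T_X_down c r)
  have "c r = 0 \<longleftrightarrow> u r \<noteq> 0" "c (Suc r) = 0 \<longleftrightarrow> u (Suc r) \<noteq> 0" if "colour u = c"
    using T_X_down colour_eq_iff[of r u] colour_eq_iff[of "Suc r" u] that by auto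
  then show ?thesis
    using op_T_X_down[OF assms(2), of r "proj c F"] T_X_down
    by (cases "colour u = c") (simp_all add: act_mult act_diff_fun proj_def)
next
  case (T_sq_black_black c r)
  then have s: "perm_tuple (transpose r (Suc r)) c = c"
    by (auto simp: perm_tuple_transpose fun_eq_iff transpose_def)
  have "u r \<noteq> 0" "u (Suc r) \<noteq> 0" if "colour u = c"
    using T_sq_black_black colour_eq_iff[of r u] colour_eq_iff[of "Suc r" u] that by auto
  then show ?thesis using T_sq_black_black s op_T_square[OF assms(2), of r F]
    by (simp add: act_mult op_T_proj proj_def)
next
  case (T_sq_black_red c r)
  have s: "(\<Sum>j = 1..r + 1. c j) = zeros_upto u (Suc r)" if "colour u = c"
    using T_sq_black_red sum_colour[of "Suc r" u] that by simp
  have "u r \<noteq> 0" "u (Suc r) = 0" if "colour u = c"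
    using T_sq_black_red colour_eq_iff[of r u] colour_eq_iff[of "Suc r" u] that by auto
  moreover have "op_T r (op_T r (proj c F)) u = proj c (op_T r (op_T r F)) u"
    using T_sq_black_red by (simp add: op_T_proj perm_tuple_twice)
  ultimately show ?thesis
    unfolding T_sq_black_red(1,2)
    using T_sq_black_red(4,5) op_T_square[OF assms(2), of r F] s
    by (cases "colour u = c") (simp_all add: act_mult proj_def left_diff_distrib del: sum.cl_ivl_Suc)
next
  case (T_sq_red_black c r)
  have s: "(\<Sum>j = 1..r. c j) = zeros_upto u r" if "colour u = c"
    using T_sq_red_black sum_colour[of r u] that by simp
  have "u r = 0" "u (Suc r) \<noteq> 0" if "colour u = c"
    using T_sq_red_black colour_eq_iff[of r u] colour_eq_iff[of "Suc r" u] that by auto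
  moreover have "op_T r (op_T r (proj c F)) u = proj c (op_T r (op_T r F)) u"
    using T_sq_red_black by (simp add: op_T_proj perm_tuple_twice)
  ultimately show ?thesis
    unfolding T_sq_red_black(1,2)
    using T_sq_red_black(4,5) op_T_square[OF assms(2), of r F] s
    by (cases "colour u = c") (simp_all add: act_mult proj_def left_diff_distrib)
next
  case (braid_black c r)
  \<comment> \<open>Projecting to \<open>c\<close> before the three crossings amounts to projecting
    to \<open>c'\<close> after them. The reversal of three positions fixes the middle one, so
    \<open>c'\<close> is black there as well.\<close>
  define c' where "c' = c \<circ> transpose r (Suc r) \<circ> transpose (Suc r) (Suc (Suc r)) \<circ> transpose r (Suc r)"
  have "c' (Suc r) = 0" using braid_black by (simp add: c'_def transpose_def)
  then have "op_T r (op_T (Suc r) (op_T r F)) u = op_T (Suc r) (op_T r (op_T (Suc r) F)) u"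
    if "colour u = c'"
    using that braid_black assms(2)
    by (intro op_T_braid_black_middle) (use colour_eq_iff(1)[of "Suc r" u] in auto)
  then have "proj c' (op_T r (op_T (Suc r) (op_T r F))) u = proj c' (op_T (Suc r) (op_T r (op_T (Suc r) F))) u"
    by (simp add: proj_def)
  then show ?thesis using braid_black
    by (simp add: act_mult act_diff_fun op_T_proj perm_tuple_transpose c'_def comp_transpose_braid)
next
  case (braid_red c r)
  \<comment> \<open>The two outer strands are black, so reversing the three positions does not
    change the colour.\<close>
  have c': "c \<circ> transpose (Suc r) (Suc (Suc r)) \<circ> transpose r (Suc r) \<circ> transpose (Suc r) (Suc (Suc r)) = c"
    using braid_red by (auto simp: fun_eq_iff transpose_def)
  have "op_T r (op_T (Suc r) (op_T r F)) u - op_T (Suc r) (op_T r (op_T (Suc r) F)) u =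
      (1 - q) * u (Suc (Suc r)) * F u" if "colour u = c"
    using that braid_red assms(2)
    by (intro op_T_braid_red_middle)
      (use colour_eq_iff[of r u] colour_eq_iff[of "Suc r" u] colour_eq_iff[of "Suc (Suc r)" u] in auto)
  then have "proj c (op_T r (op_T (Suc r) (op_T r F))) u - proj c (op_T (Suc r) (op_T r (op_T (Suc r) F))) u
      = (1 - q) * u (Suc (Suc r)) * proj c F u"
    by (simp add: proj_def)
  then show ?thesis using braid_red
    by (simp add: act_mult act_diff_fun op_T_proj perm_tuple_transpose c' comp_transpose_braid)
qed (auto simp: act_mult proj_def)

lemma hecke_rel_closed:
  assumes "hecke_rel l d q Q a b" shows "a \<in> C" "b \<in> C"
  using assms
  by (induction rule: hecke_rel.induct)
    (auto intro!: C_closed gens_closed C_sum perm_tuple_colour_tuples simp: hecke_gens_iff)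

lemma ideal_I: "ideal I (hecke_free l d)"
  unfolding hecke_ideal_def
  by (rule ring.genideal_ideal[OF ring_free_algebra]) (use hecke_rel_closed C_closed in blast)

lemma I_closed:
  "0 \<in> I" "a \<in> I \<Longrightarrow> b \<in> I \<Longrightarrow> a + b \<in> I" "a \<in> I \<Longrightarrow> - a \<in> I" "a \<in> I \<Longrightarrow> b \<in> I \<Longrightarrow> a - b \<in> I"
  "a \<in> I \<Longrightarrow> x \<in> C \<Longrightarrow> a * x \<in> I" "a \<in> I \<Longrightarrow> x \<in> C \<Longrightarrow> x * a \<in> I"
proof -
  interpret ideal I "hecke_free l d" by (rule ideal_I)
  show "0 \<in> I" using additive_subgroup.zero_closed[OF additive_subgroup_axioms] by simp
  show add: "a + b \<in> I" if "a \<in> I" "b \<in> I" for a b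
    using additive_subgroup.a_closed[OF additive_subgroup_axioms that] by simp
  show neg: "- a \<in> I" if "a \<in> I" for a
    using I_l_closed[OF that, of "nc_const (- 1)"] by (simp add: C_closed nc_const_uminus)
  show "a - b \<in> I" if "a \<in> I" "b \<in> I"
    using add[OF that(1) neg[OF that(2)]] by simp
  show "a * x \<in> I" if "a \<in> I" "x \<in> C" using I_r_closed[OF that] by simp
  show "x * a \<in> I" if "a \<in> I" "x \<in> C" using I_l_closed[OF that] by simp
qed

lemma I_sum: "(\<And>i. i \<in> S \<Longrightarrow> f i \<in> I) \<Longrightarrow> (\<Sum>i\<in>S. f i) \<in> I"
  by (induction S rule: infinite_finite_induct) (simp_all add: I_closed)

lemma hecke_rel_I: "hecke_rel l d q Q a b \<Longrightarrow> a - b \<in> I"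
  unfolding hecke_ideal_def
  using ring.genideal_self[OF ring_free_algebra, of "{a - b |a b. hecke_rel l d q Q a b}"]
    hecke_rel_closed C_closed(5) by blast

lemma T_letters:
  assumes "a \<in> C" "v \<in> keys a" "Gen_T r \<in> set (letters v)"
  shows "r \<in> {1..l + d} \<and> Suc r \<in> {1..l + d}"
  using assms by (force simp: free_algebra_def hecke_gens_def)

lemma act_cong_state:
  assumes "a \<in> C" "state u" "\<And>u. state u \<Longrightarrow> F u = G u"
  shows "act a F u = act a G u"
  by (rule act_local[where A = "{1..l + d}"])
    (use assms T_letters state_comp in blast)+

definition vanishing :: "'k hecke_poly \<Rightarrow> bool" where
  "vanishing a \<longleftrightarrow> (\<forall>F u. state u \<longrightarrow> act a F u = 0)"

lemma vanishingD: "vanishing a \<Longrightarrow> state u \<Longrightarrow> act a F u = 0"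
  by (simp add: vanishing_def)

text \<open>\<open>act b F\<close> is known to be zero at states only; locality lets
  \<open>a\<close> see no other points.\<close>

lemma vanishing_mult_left:
  assumes "a \<in> C" "vanishing b" shows "vanishing (a * b)"
  unfolding vanishing_def act_mult
proof (intro allI impI)
  fix F u assume u: "state u"
  have "act a (act b F) u = act a (\<lambda>_. 0) u"
    by (rule act_cong_state[OF assms(1) u]) (use assms(2) in \<open>simp add: vanishing_def\<close>)
  then show "act a (act b F) u = 0" by simp
qed

lemma vanishing_mult_right: "vanishing a \<Longrightarrow> vanishing (a * b)"
  by (simp add: vanishing_def act_mult)

text \<open>The vanishing elements form a two-sided ideal that contains the difference of the two
  sides of each relation.\<close>

lemma I_vanishing:
  assumes "a \<in> I" shows "vanishing a"
proof -
  interpret R: ring "hecke_free l d :: 'k hecke_poly ring" by (rule ring_free_algebra)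
  let ?K = "{a \<in> C. vanishing a}"
  have "ideal ?K (hecke_free l d)"
  proof (rule idealI[OF ring_free_algebra])
    show "subgroup ?K (add_monoid (hecke_free l d))"
    proof (rule R.add.subgroupI)
      show "?K \<noteq> {}" using C_closed(1) by (auto simp: vanishing_def)
      show "a_inv (hecke_free l d) a \<in> ?K" if "a \<in> ?K" for a
        using that by (auto simp: free_algebra_a_inv C_closed vanishing_def)
    qed (auto simp: C_closed vanishing_def)
  qed (auto simp: C_closed vanishing_mult_left vanishing_mult_right)
  moreover have "{a - b |a b. hecke_rel l d q Q a b} \<subseteq> ?K"
  proof
    fix x assume "x \<in> {a - b |a b. hecke_rel l d q Q a b}"
    then obtain a b where "x = a - b" "hecke_rel l d q Q a b" by blast
    then show "x \<in> ?K"
      using hecke_rel_closed[of a b] hecke_rel_act[of a b] C_closed(5)[of a b]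
      by (simp add: vanishing_def)
  qed
  ultimately have "I \<subseteq> ?K"
    unfolding hecke_ideal_def by (rule R.genideal_minimal)
  then show ?thesis using assms by blast
qed

end

section \<open>Reduction modulo the ideal\<close>

context hecke_parameters
begin

section \<open>Congruence modulo the ideal, and the filtration by subalgebras\<close>

definition cg :: "'k hecke_poly \<Rightarrow> 'k hecke_poly \<Rightarrow> bool" (infix "\<approx>" 50) where
  "a \<approx> b \<longleftrightarrow> a - b \<in> I"

lemma cg_refl [simp, intro]: "a \<approx> a" by (simp add: cg_def I_closed)

lemma cg_sym: "a \<approx> b \<Longrightarrow> b \<approx> a"
  unfolding cg_def using I_closed(3)[of "a - b"] by simp

lemma cg_trans [trans]: "a \<approx> b \<Longrightarrow> b \<approx> c \<Longrightarrow> a \<approx> c"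
  unfolding cg_def using I_closed(2)[of "a - b" "b - c"] by simp

lemma cg_add: "a \<approx> b \<Longrightarrow> a' \<approx> b' \<Longrightarrow> a + a' \<approx> b + b'"
  unfolding cg_def using I_closed(2)[of "a - b" "a' - b'"] by (simp add: algebra_simps)

lemma cg_diff: "a \<approx> b \<Longrightarrow> a' \<approx> b' \<Longrightarrow> a - a' \<approx> b - b'"
  unfolding cg_def using I_closed(4)[of "a - b" "a' - b'"] by (simp add: algebra_simps)

lemma cg_left: "a \<approx> b \<Longrightarrow> x \<in> C \<Longrightarrow> x * a \<approx> x * b"
  unfolding cg_def using I_closed(6)[of "a - b" x] by (simp add: algebra_simps)

lemma cg_right: "a \<approx> b \<Longrightarrow> x \<in> C \<Longrightarrow> a * x \<approx> b * x"
  unfolding cg_def using I_closed(5)[of "a - b" x] by (simp add: algebra_simps)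

lemma cg_sum: "(\<And>i. i \<in> S \<Longrightarrow> f i \<approx> g i) \<Longrightarrow> (\<Sum>i\<in>S. f i) \<approx> (\<Sum>i\<in>S. g i)"
  by (induction S rule: infinite_finite_induct) (simp_all add: cg_add)

lemma cg_zero_iff: "a \<approx> 0 \<longleftrightarrow> a \<in> I" by (simp add: cg_def)

lemma cg_rel: "hecke_rel l d q Q a b \<Longrightarrow> a \<approx> b"
  by (simp add: cg_def hecke_rel_I)

lemma cg_sum_e: "x \<in> C \<Longrightarrow> (\<Sum>c\<in>J. x * ge c) \<approx> x"
  using cg_left[OF cg_rel[OF e_sum], of x] by (simp add: sum_distrib_left)

lemma C_prod_list: "(\<And>x. x \<in> set xs \<Longrightarrow> x \<in> C) \<Longrightarrow> prod_list xs \<in> C"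
  by (induction xs) (simp_all add: C_closed)

lemmas C_intros = C_closed(1-7) gens_closed C_sum C_prod_list perm_tuple_colour_tuples

text \<open>These are representatives in the free algebra rather than classes, so structural
  statements about them hold up to \<open>\<approx>\<close>. \<open>R 0\<close> represents the
  Laurent part.\<close>

inductive_set R :: "nat \<Rightarrow> 'k hecke_poly set" for m where
  R_const: "nc_const x \<in> R m"
| R_e: "c \<in> J \<Longrightarrow> ge c \<in> R m"
| R_X: "i \<in> {1..l + d} \<Longrightarrow> gX i \<in> R m"
| R_X': "i \<in> {1..l + d} \<Longrightarrow> gX' i \<in> R m"
| R_T: "1 \<le> r \<Longrightarrow> r \<le> m \<Longrightarrow> r < l + d \<Longrightarrow> gT r \<in> R m"
| R_add: "a \<in> R m \<Longrightarrow> b \<in> R m \<Longrightarrow> a + b \<in> R m"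
| R_mult: "a \<in> R m \<Longrightarrow> b \<in> R m \<Longrightarrow> a * b \<in> R m"

lemma R_0: "0 \<in> R m" using R_const[of 0] by simp
lemma R_1: "1 \<in> R m" using R_const[of 1] by simp
lemma R_minus: "a \<in> R m \<Longrightarrow> - a \<in> R m"
  using R_mult[OF R_const[of "- 1"], of a] by (simp add: nc_const_uminus)
lemma R_diff: "a \<in> R m \<Longrightarrow> b \<in> R m \<Longrightarrow> a - b \<in> R m"
  using R_add[OF _ R_minus, of a m b] by simp
lemma R_sum: "(\<And>i. i \<in> S \<Longrightarrow> f i \<in> R m) \<Longrightarrow> (\<Sum>i\<in>S. f i) \<in> R m"
  by (induction S rule: infinite_finite_induct) (simp_all add: R_0 R_add)

lemmas R_closed = R_const R_e R_X R_X' R_T R_add R_mult R_0 R_1 R_minus R_diff R_sum perm_tuple_colour_tuples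

lemma R_in_C: "a \<in> R m \<Longrightarrow> a \<in> C"
  by (induction rule: R.induct) (auto intro: C_intros)

lemma R_mono: "a \<in> R m \<Longrightarrow> m \<le> m' \<Longrightarrow> a \<in> R m'"
  by (induction rule: R.induct) (auto intro: R_closed)

lemma C_in_R:
  assumes "a \<in> C" shows "a \<in> R (l + d - 1)"
proof -
  let ?m = "l + d - 1"
  have var: "nc_var g \<in> R ?m" if "g \<in> hecke_gens l d" for g
    using that by (cases g) (auto simp: hecke_gens_iff intro!: R_closed)
  have prod: "prod_list (map nc_var ws) \<in> R ?m" if "set ws \<subseteq> hecke_gens l d" for ws
    using that by (induction ws) (simp_all add: R_1 R_mult var del: One_nat_def)
  have "a = (\<Sum>w\<in>keys a. single w (lookup a w))"
    by (rule poly_mapping_eqI) (auto simp: lookup_sum lookup_single when_def in_keys_iff)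
  also have "\<dots> = (\<Sum>w\<in>keys a. nc_const (lookup a w) * prod_list (map nc_var (letters w)))"
    by (rule sum.cong) (simp_all flip: nc_single_eq)
  also have "\<dots> \<in> R ?m"
    using assms by (intro R_sum R_mult R_const prod) (auto simp: free_algebra_def)
  finally show ?thesis .
qed

text \<open>The normal form with Laurent coefficients to the left of at most one crossing. Commuting
  a Laurent element to the left of \<open>gT r\<close> and squaring \<open>gT r\<close> both lead to
  it.\<close>

definition TP :: "nat \<Rightarrow> 'k hecke_poly set" where
  "TP r = {x \<in> C. \<exists>p\<in>R 0. \<exists>p'\<in>R 0. x \<approx> p * gT r + p'}"

lemma TP_I: "x \<in> C \<Longrightarrow> p \<in> R 0 \<Longrightarrow> p' \<in> R 0 \<Longrightarrow> x \<approx> p * gT r + p' \<Longrightarrow> x \<in> TP r"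
  by (auto simp: TP_def)

lemma TP_cg: "x \<in> TP r \<Longrightarrow> y \<in> C \<Longrightarrow> y \<approx> x \<Longrightarrow> y \<in> TP r"
  unfolding TP_def using cg_trans by blast

lemma TP_R: "p \<in> R 0 \<Longrightarrow> p \<in> TP r"
  by (rule TP_I[of p 0 p]) (simp_all add: R_in_C R_0)

lemma TP_add:
  assumes "x \<in> TP r" "y \<in> TP r" shows "x + y \<in> TP r"
proof -
  obtain p p' where x: "p \<in> R 0" "p' \<in> R 0" "x \<approx> p * gT r + p'" using assms(1) by (auto simp: TP_def)
  obtain s s' where y: "s \<in> R 0" "s' \<in> R 0" "y \<approx> s * gT r + s'" using assms(2) by (auto simp: TP_def)
  have "x + y \<approx> (p + s) * gT r + (p' + s')"
    using cg_add[OF x(3) y(3)] by (simp add: algebra_simps)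
  then show ?thesis
    using assms x y by (intro TP_I[of "x + y" "p + s" "p' + s'"]) (simp_all add: TP_def R_add C_closed)
qed

lemma TP_left:
  assumes "x \<in> TP r" "p \<in> R 0" shows "p * x \<in> TP r"
proof -
  obtain s s' where x: "s \<in> R 0" "s' \<in> R 0" "x \<approx> s * gT r + s'" using assms(1) by (auto simp: TP_def)
  have "p * x \<approx> (p * s) * gT r + p * s'"
    using cg_left[OF x(3) R_in_C[OF assms(2)]] by (simp add: algebra_simps)
  then show ?thesis
    using assms x by (intro TP_I[of "p * x" "p * s" "p * s'"]) (simp_all add: TP_def R_mult C_closed R_in_C[OF assms(2)])
qed

lemma TP_sum: "(\<And>i. i \<in> S \<Longrightarrow> f i \<in> TP r) \<Longrightarrow> (\<Sum>i\<in>S. f i) \<in> TP r"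
  by (induction S rule: infinite_finite_induct) (simp_all add: TP_R R_0 TP_add)

lemma TP_sum_e:
  assumes "x \<in> C" "\<And>c. c \<in> J \<Longrightarrow> x * ge c \<in> TP r" shows "x \<in> TP r"
proof -
  have "(\<Sum>c\<in>J. x * ge c) \<in> TP r"
    by (rule TP_sum[OF assms(2)])
  then show ?thesis using TP_cg[OF _ assms(1) cg_sym[OF cg_sum_e[OF assms(1)]]] by blast
qed

section \<open>Moving a crossing past the Laurent part; quadratic and braid relations up to lower
  terms\<close>

lemma T_e_commute:
  "c \<in> J \<Longrightarrow> 1 \<le> r \<Longrightarrow> r < l + d \<Longrightarrow> gT r * ge c \<approx> ge (perm_tuple (transpose r (Suc r)) c) * gT r"
  using cg_rel[OF T_e] by simp

lemma T_X_exchange: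
  assumes "c \<in> J" "1 \<le> r" "r < l + d" "i \<in> {1..l + d}"
  shows "\<exists>\<delta>\<in>R 0. gT r * gX i * ge c \<approx> gX (transpose r (Suc r) i) * gT r * ge c + \<delta>"
proof -
  consider "i = Suc r" | "i = r" | "i \<noteq> r" "i \<noteq> Suc r" by blast
  then show ?thesis
  proof cases
    case 1
    define \<delta> where "\<delta> = (if c r = 0 \<and> c (r + 1) = 0 then nc_const (q - 1) * gX (r + 1) * ge c else 0)"
    have "\<delta> \<in> R 0" using assms by (auto simp: \<delta>_def intro!: R_closed)
    moreover have "(gT r * gX (r + 1) - gX r * gT r) * ge c \<approx> \<delta>"
      unfolding \<delta>_def by (rule cg_rel, rule T_X_up) (use assms in auto)
    ultimately show ?thesis using 1 by (auto simp: cg_def algebra_simps intro!: bexI[of _ \<delta>])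
  next
    case 2
    define \<delta> where "\<delta> = (if c r = 0 \<and> c (r + 1) = 0 then nc_const (- (q - 1)) * gX (r + 1) * ge c else 0)"
    have "\<delta> \<in> R 0" using assms by (auto simp: \<delta>_def intro!: R_closed)
    moreover have "(gT r * gX r - gX (r + 1) * gT r) * ge c \<approx> \<delta>"
      unfolding \<delta>_def by (rule cg_rel, rule T_X_down) (use assms in auto)
    ultimately show ?thesis using 2 by (auto simp: cg_def algebra_simps intro!: bexI[of _ \<delta>])
  next
    case 3
    have "gT r * gX i \<approx> gX i * gT r" by (rule cg_rel, rule T_X) (use assms 3 in auto)
    then have "gT r * gX i * ge c \<approx> gX i * gT r * ge c"
      by (rule cg_right) (use assms in \<open>auto intro: C_intros\<close>)
    then show ?thesis using 3 by (intro bexI[of _ 0]) (simp_all add: R_0 transpose_def)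
  qed
qed

text \<open>The generators \<open>e(c)\<close> and \<open>X_i\<close> are covered by the relations.
  No relation links \<open>T_r\<close> with \<open>X_i'\<close>: on a red position both products
  vanish, and on a black one the exchange rule for \<open>X_i\<close> is multiplied by inverses on
  both sides.\<close>

lemma T_R0:
  assumes r: "1 \<le> r" "r < l + d" and "p \<in> R 0"
  shows "gT r * p \<in> TP r"
  using assms(3)
proof (induction rule: R.induct)
  case (R_const x)
  have "gT r * nc_const x = nc_const x * gT r + 0" by (simp add: nc_const_commute)
  then show ?case using r by (intro TP_I[of _ "nc_const x" 0]) (simp_all add: R_closed C_closed gens_closed)
next
  case (R_e c)
  then show ?case using r T_e_commute[OF R_e r]
    by (intro TP_I[of _ "ge (perm_tuple (transpose r (Suc r)) c)" 0])
      (simp_all add: R_closed C_closed gens_closed)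
next
  case (R_X i)
  show ?case
  proof (rule TP_sum_e)
    show "gT r * gX i \<in> C" using r R_X by (intro C_intros) auto
    fix c assume c: "c \<in> J"
    let ?i = "transpose r (Suc r) i" and ?c = "perm_tuple (transpose r (Suc r)) c"
    have i: "?i \<in> {1..l + d}" using r R_X by (auto simp: transpose_def)
    obtain \<delta> where \<delta>: "\<delta> \<in> R 0" "gT r * gX i * ge c \<approx> gX ?i * gT r * ge c + \<delta>"
      using T_X_exchange[OF c r R_X] by blast
    have "gX ?i * (gT r * ge c) \<approx> gX ?i * (ge ?c * gT r)"
      by (rule cg_left[OF T_e_commute[OF c r]]) (use i gens_closed in blast)
    then have "gX ?i * gT r * ge c + \<delta> \<approx> gX ?i * ge ?c * gT r + \<delta>"
      by (intro cg_add) (simp_all add: mult.assoc)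
    from cg_trans[OF \<delta>(2) this] show "gT r * gX i * ge c \<in> TP r"
      by (rule TP_I[rotated 3])
        (use r R_X c i \<delta>(1) in \<open>simp_all add: R_closed C_closed gens_closed del: atLeastAtMost_iff\<close>)
  qed
next
  case (R_X' i)
  show ?case
  proof (rule TP_sum_e)
    show "gT r * gX' i \<in> C" using r R_X' by (intro C_intros) auto
    fix c assume c: "c \<in> J"
    let ?i = "transpose r (Suc r) i" and ?c = "perm_tuple (transpose r (Suc r)) c"
    have i: "?i \<in> {1..l + d}" using r R_X' by (auto simp: transpose_def)
    have c': "?c \<in> J" using c r by (intro C_intros)
    have cl: "gT r \<in> C" "gX i \<in> C" "gX' i \<in> C" "ge c \<in> C" "gX ?i \<in> C" "gX' ?i \<in> C" "ge ?c \<in> C"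
      using r R_X' i c c' by (simp_all add: gens_closed del: atLeastAtMost_iff)
    show "gT r * gX' i * ge c \<in> TP r"
    proof (cases "c i = 1")
      case True
      have "gT r * (gX' i * ge c) \<approx> gT r * 0"
        by (rule cg_left[OF cg_rel[OF X'_red]]) (use c R_X' True cl in auto)
      then show ?thesis using cl
        by (intro TP_I[of _ 0 0]) (simp_all add: mult.assoc R_closed C_closed)
    next
      case False
      then have ci: "c i = 0" using colour_cases[OF c R_X'] by simp
      then have c'i: "?c ?i = 0" by (simp add: perm_tuple_transpose)
      obtain \<delta> where \<delta>: "\<delta> \<in> R 0" "gT r * gX i * ge c \<approx> gX ?i * gT r * ge c + \<delta>"
        using T_X_exchange[OF c r R_X'] by blast
      have \<delta>C: "\<delta> \<in> C" using \<delta>(1) by (rule R_in_C)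
      have e': "gX' i * ge c \<approx> ge c * gX' i" by (rule cg_rel, rule X'_e[OF c R_X'])
      have inv: "gX i * gX' i * ge c \<approx> ge c" by (rule cg_rel, rule X_X'_black[OF c R_X' ci])
      have inv': "gX' ?i * gX ?i * ge ?c \<approx> ge ?c" by (rule cg_rel, rule X'_X_black[OF c' i c'i])
      \<comment> \<open>Insert \<open>X_i X_i'\<close> to the right of \<open>T_r\<close>, exchange
        \<open>T_r\<close> with \<open>X_i\<close>, and cancel the resulting \<open>X\<close>
        against the \<open>X'\<close> on the left. The error \<open>\<delta>\<close> survives
        between two factors \<open>X'\<close> and is still a Laurent element.\<close>
      have "gX' ?i * gT r * ge c \<approx> gX' ?i * gT r * (gX i * gX' i * ge c)"
        by (rule cg_left[OF cg_sym[OF inv]]) (use cl in \<open>simp_all add: C_closed\<close>)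
      also have "\<dots> = gX' ?i * gT r * gX i * (gX' i * ge c)" by (simp add: mult.assoc)
      also have "\<dots> \<approx> gX' ?i * gT r * gX i * (ge c * gX' i)"
        by (rule cg_left[OF e']) (use cl in \<open>simp_all add: C_closed\<close>)
      also have "\<dots> = gX' ?i * (gT r * gX i * ge c) * gX' i" by (simp add: mult.assoc)
      also have "\<dots> \<approx> gX' ?i * (gX ?i * gT r * ge c + \<delta>) * gX' i"
        by (intro cg_right cg_left \<delta>) (use cl in \<open>simp_all add: C_closed\<close>)
      also have "\<dots> = gX' ?i * gX ?i * (gT r * ge c) * gX' i + gX' ?i * \<delta> * gX' i"
        by (simp add: algebra_simps)
      also have "\<dots> \<approx> gX' ?i * gX ?i * (ge ?c * gT r) * gX' i + gX' ?i * \<delta> * gX' i"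
        by (intro cg_add cg_refl cg_right cg_left T_e_commute c r) (use cl in \<open>simp_all add: C_closed\<close>)
      also have "\<dots> = (gX' ?i * gX ?i * ge ?c) * (gT r * gX' i) + gX' ?i * \<delta> * gX' i"
        by (simp add: mult.assoc)
      also have "\<dots> \<approx> ge ?c * (gT r * gX' i) + gX' ?i * \<delta> * gX' i"
        by (intro cg_add cg_refl cg_right inv') (use cl in \<open>simp_all add: C_closed\<close>)
      also have "\<dots> = (ge ?c * gT r) * gX' i + gX' ?i * \<delta> * gX' i"
        by (simp add: mult.assoc)
      also have "\<dots> \<approx> (gT r * ge c) * gX' i + gX' ?i * \<delta> * gX' i"
        by (intro cg_add cg_refl cg_right cg_sym[OF T_e_commute] c r) (use cl in \<open>simp_all add: C_closed\<close>)
      also have "\<dots> = gT r * (ge c * gX' i) + gX' ?i * \<delta> * gX' i"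
        by (simp add: mult.assoc)
      also have "\<dots> \<approx> gT r * (gX' i * ge c) + gX' ?i * \<delta> * gX' i"
        by (intro cg_add cg_refl cg_left cg_sym[OF e']) (use cl in \<open>simp_all add: C_closed\<close>)
      finally have 1: "gX' ?i * gT r * ge c - gX' ?i * \<delta> * gX' i \<approx> gT r * gX' i * ge c"
        by (simp add: cg_def algebra_simps)
      have "gX' ?i * (gT r * ge c) - gX' ?i * \<delta> * gX' i \<approx> gX' ?i * (ge ?c * gT r) - gX' ?i * \<delta> * gX' i"
        by (intro cg_diff cg_refl cg_left T_e_commute c r) (use cl in \<open>simp_all add: C_closed\<close>)
      then have 2: "gX' ?i * gT r * ge c - gX' ?i * \<delta> * gX' i \<approx> (gX' ?i * ge ?c) * gT r + - (gX' ?i * \<delta> * gX' i)"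
        by (simp add: mult.assoc)
      show ?thesis
        by (rule TP_I[OF _ _ _ cg_trans[OF cg_sym[OF 1] 2]])
          (use cl i R_X' c' \<delta>(1) in \<open>simp_all add: R_closed C_closed del: atLeastAtMost_iff\<close>)
    qed
  qed
next
  case (R_T r')
  then show ?case by simp
next
  case (R_add a b)
  then show ?case by (simp add: distrib_left TP_add)
next
  case (R_mult a b)
  obtain p p' where p: "p \<in> R 0" "p' \<in> R 0" "gT r * a \<approx> p * gT r + p'"
    using R_mult.IH(1) by (auto simp: TP_def)
  have "gT r * a * b \<approx> (p * gT r + p') * b"
    by (rule cg_right[OF p(3) R_in_C[OF R_mult.hyps(2)]])
  moreover have "(p * gT r + p') * b = p * (gT r * b) + p' * b" by (simp add: algebra_simps)
  moreover have "p * (gT r * b) + p' * b \<in> TP r"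
    by (rule TP_add[OF TP_left[OF R_mult.IH(2) p(1)] TP_R[OF R.R_mult[OF p(2) R_mult.hyps(2)]]])
  ultimately show ?case
    using R_in_C[OF R_mult.hyps(1)] R_in_C[OF R_mult.hyps(2)] r
    by - (rule TP_cg[of "p * (gT r * b) + p' * b"], simp_all add: mult.assoc C_closed gens_closed)
qed

lemma T_square:
  assumes r: "1 \<le> r" "r < l + d"
  shows "gT r * gT r \<in> TP r"
proof (rule TP_sum_e)
  show "gT r * gT r \<in> C" using r by (intro C_intros)
  fix c assume c: "c \<in> J"
  have cl: "gT r * gT r * ge c \<in> C" using r c by (intro C_intros)
  have cases: "c r = 0 \<or> c r = 1" "c (r + 1) = 0 \<or> c (r + 1) = 1"
    using colour_cases[OF c, of r] colour_cases[OF c, of "r + 1"] r by auto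
  consider "c r = 0" "c (r + 1) = 0" | "c r = 0" "c (r + 1) = 1" | "c r = 1" "c (r + 1) = 0"
    | "c r = 1" "c (r + 1) = 1" using cases by metis
  then show "gT r * gT r * ge c \<in> TP r"
  proof cases
    case 1
    have "nc_const (q - 1) * (gT r * ge c) + nc_const q * ge c \<in> TP r"
      by (intro TP_add TP_left T_R0 R_closed TP_R r c)
    moreover have "gT r * gT r * ge c \<approx> nc_const (q - 1) * gT r * ge c + nc_const q * ge c"
      by (rule cg_rel, rule T_sq_black_black[OF c r 1])
    ultimately show ?thesis by (intro TP_cg[OF _ cl]) (auto simp: mult.assoc)
  next
    case 2
    have "gT r * gT r * ge c \<approx> (gX r - nc_const (Q (\<Sum>j = 1..r + 1. c j))) * ge c"
      by (rule cg_rel, rule T_sq_black_red[OF c r 2])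
    then show ?thesis using r c by (intro TP_cg[OF _ cl] TP_R) (auto intro!: R_closed)
  next
    case 3
    have "gT r * gT r * ge c \<approx> (gX (r + 1) - nc_const (Q (\<Sum>j = 1..r. c j))) * ge c"
      by (rule cg_rel, rule T_sq_red_black[OF c r 3])
    then show ?thesis using r c by (intro TP_cg[OF _ cl] TP_R) (auto intro!: R_closed)
  next
    case 4
    have "gT r * (gT r * ge c) \<approx> gT r * 0"
      by (rule cg_left[OF cg_rel[OF T_red_red]]) (use 4 r c in \<open>auto intro: C_intros\<close>)
    then show ?thesis by (intro TP_cg[OF TP_R[OF R_0] cl]) (simp add: mult.assoc)
  qed
qed

text \<open>The presentation is silent when the middle strand is red and a neighbour is red too.
  Both triple products vanish then, since the two red strands become adjacent at a crossing.\<close>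

lemma T_braid:
  assumes r: "1 \<le> r" "Suc r < l + d"
  shows "\<exists>p\<in>R 0. gT (Suc r) * gT r * gT (Suc r) \<approx> gT r * gT (Suc r) * gT r + p"
proof -
  let ?x = "gT r * gT (Suc r) * gT r - gT (Suc r) * gT r * gT (Suc r) :: 'k hecke_poly"
  have rr: "r < l + d" "1 \<le> Suc r" using r by simp_all
  have xC: "gT r \<in> C" "gT (Suc r) \<in> C" using r by (auto intro: C_intros)
  have "\<exists>p\<in>R 0. ?x * ge c \<approx> p" if c: "c \<in> J" for c
  proof -
    let ?s = "perm_tuple (transpose r (Suc r))" and ?t = "perm_tuple (transpose (Suc r) (Suc (Suc r)))"
    have sJ: "c \<in> J \<Longrightarrow> ?s c \<in> J" "c \<in> J \<Longrightarrow> ?t c \<in> J" for c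
      using r by (auto intro: perm_tuple_colour_tuples)
    have cases: "c r = 0 \<or> c r = 1" "c (Suc r) = 0 \<or> c (Suc r) = 1" "c (Suc (Suc r)) = 0 \<or> c (Suc (Suc r)) = 1"
      using colour_cases[OF c, of r] colour_cases[OF c, of "Suc r"] colour_cases[OF c, of "Suc (Suc r)"] r by auto
    have zero_s: "gT r * ge c \<approx> 0" if "c \<in> J" "c r = 1" "c (Suc r) = 1" for c
      by (rule cg_rel, rule T_red_red) (use that r in auto)
    have zero_t: "gT (Suc r) * ge c \<approx> 0" if "c \<in> J" "c (Suc r) = 1" "c (Suc (Suc r)) = 1" for c
      by (rule cg_rel, rule T_red_red) (use that r in auto)
    have push_s: "gT r * ge c \<approx> ge (?s c) * gT r" if "c \<in> J" for c
      by (rule T_e_commute[OF that r(1) rr(1)])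
    have push_t: "gT (Suc r) * ge c \<approx> ge (?t c) * gT (Suc r)" if "c \<in> J" for c
      by (rule T_e_commute[OF that rr(2) r(2)])
    have sts: "gT r * gT (Suc r) * gT r * ge c \<approx> gT r * ge (?t (?s c)) * gT (Suc r) * gT r"
    proof -
      have "gT r * gT (Suc r) * (gT r * ge c) \<approx> gT r * gT (Suc r) * (ge (?s c) * gT r)"
        by (intro cg_left push_s c C_intros xC)
      also have "\<dots> = gT r * (gT (Suc r) * ge (?s c)) * gT r" by (simp add: mult.assoc)
      also have "\<dots> \<approx> gT r * (ge (?t (?s c)) * gT (Suc r)) * gT r"
        by (intro cg_left cg_right push_t sJ c xC)
      finally show ?thesis by (simp add: mult.assoc)
    qed
    have tst: "gT (Suc r) * gT r * gT (Suc r) * ge c \<approx> gT (Suc r) * ge (?s (?t c)) * gT r * gT (Suc r)"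
    proof -
      have "gT (Suc r) * gT r * (gT (Suc r) * ge c) \<approx> gT (Suc r) * gT r * (ge (?t c) * gT (Suc r))"
        by (intro cg_left push_t c C_intros xC)
      also have "\<dots> = gT (Suc r) * (gT r * ge (?t c)) * gT (Suc r)" by (simp add: mult.assoc)
      also have "\<dots> \<approx> gT (Suc r) * (ge (?s (?t c)) * gT r) * gT (Suc r)"
        by (intro cg_left cg_right push_s sJ c xC)
      finally show ?thesis by (simp add: mult.assoc)
    qed
    \<comment> \<open>If the first two strands are red, the rightmost factor already kills
      \<open>e(c)\<close>. If the last two are red, two crossings bring them to positions
      \<open>r\<close> and \<open>Suc r\<close>, where the leftmost factor kills them.\<close>
    have sts0: "gT r * gT (Suc r) * gT r * ge c \<approx> 0"
      if "c (Suc r) = 1" "c r = 1 \<or> c (Suc (Suc r)) = 1"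
    proof (cases "c r = 1")
      case True
      then have "gT r * gT (Suc r) * (gT r * ge c) \<approx> gT r * gT (Suc r) * 0"
        using that by (intro cg_left zero_s c C_intros xC) auto
      then show ?thesis by (simp add: mult.assoc)
    next
      case False
      have "gT r * ge (?t (?s c)) * (gT (Suc r) * gT r) \<approx> 0 * (gT (Suc r) * gT r)"
        using that False cases
        by (intro cg_right zero_s sJ c C_intros xC) (auto simp: perm_tuple_transpose transpose_def)
      then show ?thesis using cg_trans[OF sts] by (simp add: mult.assoc)
    qed
    have tst0: "gT (Suc r) * gT r * gT (Suc r) * ge c \<approx> 0"
      if "c (Suc r) = 1" "c r = 1 \<or> c (Suc (Suc r)) = 1"
    proof (cases "c (Suc (Suc r)) = 1")
      case True
      then have "gT (Suc r) * gT r * (gT (Suc r) * ge c) \<approx> gT (Suc r) * gT r * 0"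
        using that by (intro cg_left zero_t c C_intros xC) auto
      then show ?thesis by (simp add: mult.assoc)
    next
      case False
      have "gT (Suc r) * ge (?s (?t c)) * (gT r * gT (Suc r)) \<approx> 0 * (gT r * gT (Suc r))"
        using that False cases
        by (intro cg_right zero_t sJ c C_intros xC) (auto simp: perm_tuple_transpose transpose_def)
      then show ?thesis using cg_trans[OF tst] by (simp add: mult.assoc)
    qed
    consider "c (Suc r) = 0" | "c (Suc r) = 1" "c r = 0" "c (Suc (Suc r)) = 0"
      | "c (Suc r) = 1" "c r = 1 \<or> c (Suc (Suc r)) = 1" using cases by metis
    then show ?thesis
    proof cases
      case 1
      then have "?x * ge c \<approx> 0"
        using cg_rel[OF braid_black[OF c r(1)]] r by simp
      then show ?thesis using R_0 by blast
    next
      case 2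
      then have "?x * ge c \<approx> nc_const (1 - q) * gX (r + 2) * ge c"
        using cg_rel[OF braid_red[OF c r(1)]] r by simp
      moreover have "nc_const (1 - q) * gX (r + 2) * ge c \<in> R 0"
        using r c by (intro R_closed) auto
      ultimately show ?thesis by blast
    next
      case 3
      have "?x * ge c \<approx> 0"
        using cg_diff[OF sts0[OF 3] tst0[OF 3]] by (simp add: left_diff_distrib)
      then show ?thesis using R_0 by blast
    qed
  qed
  then have "\<forall>c\<in>J. \<exists>p. p \<in> R 0 \<and> ?x * ge c \<approx> p" by (intro ballI) (simp only: Bex_def)
  from bchoice[OF this] obtain f
    where "\<forall>c\<in>J. f c \<in> R 0 \<and> ?x * ge c \<approx> f c" by (elim exE)
  then have f: "\<And>c. c \<in> J \<Longrightarrow> f c \<in> R 0" "\<And>c. c \<in> J \<Longrightarrow> ?x * ge c \<approx> f c" by simp_all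
  have "?x \<approx> (\<Sum>c\<in>J. ?x * ge c)" by (rule cg_sym[OF cg_sum_e]) (intro C_intros xC)
  also have "\<dots> \<approx> (\<Sum>c\<in>J. f c)" by (rule cg_sum[OF f(2)])
  finally have "- (?x - (\<Sum>c\<in>J. f c)) \<in> I"
    unfolding cg_def by (rule I_closed(3))
  then have "gT (Suc r) * gT r * gT (Suc r) \<approx> gT r * gT (Suc r) * gT r + - (\<Sum>c\<in>J. f c)"
    unfolding cg_def by (simp add: algebra_simps)
  then show ?thesis by (rule bexI) (intro R_minus R_sum f(1))
qed

text \<open>The product \<open>T_{m+1} T_m ... T_k\<close>, empty for \<open>k = m + 2\<close>. With
  \<open>k\<close> from 1 to \<open>m + 2\<close> these lift the minimal coset representatives of
  the symmetric group on \<open>m + 1\<close> letters in the one on \<open>m + 2\<close>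
  letters.\<close>

definition chain :: "nat \<Rightarrow> nat \<Rightarrow> 'k hecke_poly" where
  "chain m k = prod_list (map gT (rev [k..<m + 2]))"

lemma chain_top [simp]: "chain m (m + 2) = 1" "chain m (Suc (Suc m)) = 1"
  by (simp_all add: chain_def)

lemma chain_step: "k \<le> Suc m \<Longrightarrow> chain m k = chain m (Suc k) * gT k"
  unfolding chain_def by (subst upt_conv_Cons) simp_all

lemma T_prod_C: "(\<And>r. r \<in> set rs \<Longrightarrow> 1 \<le> r \<and> r < l + d) \<Longrightarrow> prod_list (map gT rs) \<in> C"
  by (induction rs) (simp_all add: C_closed gens_closed)

lemma chain_C: "1 \<le> k \<Longrightarrow> Suc m < l + d \<Longrightarrow> chain m k \<in> C"
  unfolding chain_def by (rule T_prod_C) auto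

lemma T_commute_prod:
  assumes "1 \<le> i" "i < l + d"
    and "\<And>r. r \<in> set rs \<Longrightarrow> 1 \<le> r \<and> r < l + d \<and> (i + 1 < r \<or> r + 1 < i)"
  shows "prod_list (map gT rs) * gT i \<approx> gT i * prod_list (map gT rs)"
  using assms(3)
proof (induction rs)
  case Nil then show ?case by simp
next
  case (Cons r rs)
  have C: "gT r \<in> C" "gT i \<in> C" "prod_list (map gT rs) \<in> C"
    using Cons.prems assms by (auto intro!: gens_closed T_prod_C)
  have "gT r * (prod_list (map gT rs) * gT i) \<approx> gT r * (gT i * prod_list (map gT rs))"
    using Cons C by (intro cg_left) auto
  also have "\<dots> = gT r * gT i * prod_list (map gT rs)" by (simp add: mult.assoc)
  also have "\<dots> \<approx> gT i * gT r * prod_list (map gT rs)"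
    by (intro cg_right cg_rel T_T C) (use Cons.prems[of r] assms in auto)
  finally show ?case by (simp add: mult.assoc)
qed

text \<open>The left span over \<open>R m\<close> of the chains that stop at \<open>K\<close> or
  above. The bound is recorded because a chain commutes with \<open>gT i\<close> only if it stops
  above \<open>i + 1\<close>.\<close>

definition N :: "nat \<Rightarrow> nat \<Rightarrow> 'k hecke_poly set" where
  "N m K = {b \<in> C. \<exists>a. (\<forall>k. a k \<in> R m) \<and> b \<approx> (\<Sum>k = K..m + 2. a k * chain m k)}"

lemma N_C: "b \<in> N m K \<Longrightarrow> b \<in> C" by (simp add: N_def)

lemma N_cg: "x \<in> N m K \<Longrightarrow> y \<in> C \<Longrightarrow> y \<approx> x \<Longrightarrow> y \<in> N m K"
  unfolding N_def using cg_trans by blast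

lemma N_add:
  assumes "x \<in> N m K" "y \<in> N m K" shows "x + y \<in> N m K"
proof -
  obtain a where a: "\<forall>k. a k \<in> R m" "x \<approx> (\<Sum>k = K..m + 2. a k * chain m k)" using assms(1) by (auto simp: N_def)
  obtain b where b: "\<forall>k. b k \<in> R m" "y \<approx> (\<Sum>k = K..m + 2. b k * chain m k)" using assms(2) by (auto simp: N_def)
  have "x + y \<approx> (\<Sum>k = K..m + 2. (a k + b k) * chain m k)"
    using cg_add[OF a(2) b(2)] unfolding distrib_right sum.distrib .
  moreover have "\<forall>k. a k + b k \<in> R m" using a(1) b(1) by (simp add: R_add)
  ultimately show ?thesis using assms
    unfolding N_def mem_Collect_eq
    by (intro conjI exI[of _ "\<lambda>k. a k + b k"]) (simp_all add: C_closed)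
qed

lemma N_term:
  assumes "a \<in> R m" "1 \<le> K" "K \<le> k" "k \<le> m + 2" "Suc m < l + d"
  shows "a * chain m k \<in> N m K"
proof -
  have "(\<Sum>i = K..m + 2. (if i = k then a else 0) * chain m i) = (\<Sum>i = K..m + 2. if i = k then a * chain m k else 0)"
    by (rule sum.cong) auto
  also have "\<dots> = a * chain m k" using assms by simp
  finally have "a * chain m k \<approx> (\<Sum>i = K..m + 2. (if i = k then a else 0) * chain m i)" by simp
  moreover have "a * chain m k \<in> C" using assms by (intro C_closed R_in_C chain_C) auto
  ultimately show ?thesis
    unfolding N_def mem_Collect_eq using assms(1)
    by (intro conjI exI[of _ "\<lambda>i. if i = k then a else 0"]) (simp_all add: R_0)
qed

lemma N_0: "0 \<in> N m K"
  unfolding N_def mem_Collect_eq by (intro conjI exI[of _ "\<lambda>_. 0"]) (simp_all add: C_closed R_0)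

lemma N_sum: "(\<And>i. i \<in> S \<Longrightarrow> f i \<in> N m K) \<Longrightarrow> (\<Sum>i\<in>S. f i) \<in> N m K"
  by (induction S rule: infinite_finite_induct) (simp_all add: N_0 N_add)

lemma N_right:
  assumes "b \<in> N m K" "x \<in> C"
    and "\<And>a k. a \<in> R m \<Longrightarrow> K \<le> k \<Longrightarrow> k \<le> m + 2 \<Longrightarrow> a * chain m k * x \<in> N m K'"
  shows "b * x \<in> N m K'"
proof -
  obtain a where a: "\<forall>k. a k \<in> R m" "b \<approx> (\<Sum>k = K..m + 2. a k * chain m k)" using assms(1) by (auto simp: N_def)
  have "b * x \<approx> (\<Sum>k = K..m + 2. a k * chain m k * x)"
    using cg_right[OF a(2) assms(2)] unfolding sum_distrib_right .
  moreover have "(\<Sum>k = K..m + 2. a k * chain m k * x) \<in> N m K'"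
    by (rule N_sum) (use assms(3) a(1) in auto)
  ultimately show ?thesis using N_cg[OF _ C_closed(6)[OF N_C[OF assms(1)] assms(2)]] by simp
qed

lemma N_mono:
  assumes "b \<in> N m K" "1 \<le> K'" "K' \<le> K" "Suc m < l + d" shows "b \<in> N m K'"
proof -
  have "b * 1 \<in> N m K'"
    by (rule N_right[OF assms(1) C_closed(2)]) (use assms in \<open>simp add: N_term\<close>)
  then show ?thesis by simp
qed

lemma chain_T_commute:
  assumes "Suc m < l + d" "1 \<le> i" "Suc i < k" "k \<le> m + 2" "a \<in> R m"
  shows "a * chain m k * gT i \<approx> a * gT i * chain m k"
proof -
  have "chain m k * gT i \<approx> gT i * chain m k"
    unfolding chain_def by (rule T_commute_prod) (use assms in auto)
  then have "a * (chain m k * gT i) \<approx> a * (gT i * chain m k)"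
    by (rule cg_left[OF _ R_in_C[OF assms(5)]])
  then show ?thesis by (simp add: mult.assoc)
qed

lemma N_T_below:
  assumes "b \<in> N m K" "Suc m < l + d" "1 \<le> i" "Suc i < K" "K \<le> m + 2"
  shows "b * gT i \<in> N m K"
proof -
  have iC: "gT i \<in> C" using assms by (intro gens_closed) auto
  show ?thesis
  proof (rule N_right[OF assms(1) iC])
    fix a k assume k: "a \<in> R m" "K \<le> k" "k \<le> m + 2"
    have "a * gT i * chain m k \<in> N m K"
      by (rule N_term) (use k assms in \<open>auto intro!: R_mult R_T\<close>)
    moreover have "a * chain m k * gT i \<in> C"
      by (rule C_closed(6)[OF C_closed(6)[OF R_in_C[OF k(1)] chain_C] iC]) (use k assms in auto)
    moreover have "a * chain m k * gT i \<approx> a * gT i * chain m k"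
      using k assms by (intro chain_T_commute) auto
    ultimately show "a * chain m k * gT i \<in> N m K" by (rule N_cg)
  qed
qed

lemma N_T_step:
  assumes "b \<in> N m (Suc k)" "Suc m < l + d" "1 \<le> k" "k \<le> Suc m"
  shows "b * gT k \<in> N m k"
proof -
  have kC: "gT k \<in> C" using assms by (intro gens_closed) auto
  show ?thesis
  proof (rule N_right[OF assms(1) kC])
    fix a k' assume k': "a \<in> R m" "Suc k \<le> k'" "k' \<le> m + 2"
    show "a * chain m k' * gT k \<in> N m k"
    proof (cases "k' = Suc k")
      case True
      have "a * chain m k \<in> N m k" using k' assms by (intro N_term) auto
      then show ?thesis using True assms by (simp add: chain_step[of k] mult.assoc)
    next
      case False
      have "a * chain m k' \<in> N m k'" using k' assms by (intro N_term) auto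
      then have "a * chain m k' * gT k \<in> N m k'" using k' False assms by (intro N_T_below) auto
      then show ?thesis by (rule N_mono) (use k' assms in auto)
    qed
  qed
qed

text \<open>Downward induction on the end of the chain: by \<open>T_R0\<close> a Laurent element
  passes the last factor at the cost of a term in which this factor is missing, and shorter chains
  stay in the span.\<close>

lemma N_R0:
  assumes "b \<in> N m K" "Suc m < l + d" "1 \<le> K" "p \<in> R 0"
  shows "b * p \<in> N m K"
proof -
  have main: "a * chain m k * p \<in> N m k" if "k \<le> m + 2" "1 \<le> k" "a \<in> R m" "p \<in> R 0" for a k p
    using that
  proof (induction k arbitrary: a p rule: inc_induct)
    case base
    have "a * p * chain m (m + 2) \<in> N m (m + 2)"
      by (rule N_term) (use base R_mono[of p 0 m] assms in \<open>auto intro!: R_mult\<close>)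
    then show ?case by simp
  next
    case (step k)
    have k: "1 \<le> k" "k < l + d" "k \<le> Suc m" using step assms by auto
    have aC: "a \<in> C" "p \<in> C" using step R_in_C by blast+
    have ch: "a * chain m (Suc k) \<in> C" using step assms aC by (intro C_closed chain_C) auto
    obtain p' p'' where p': "p' \<in> R 0" "p'' \<in> R 0" "gT k * p \<approx> p' * gT k + p''"
      using T_R0[OF k(1,2) step.prems(3)] by (auto simp: TP_def)
    have IH: "a * chain m (Suc k) * p \<in> N m (Suc k)" if "p \<in> R 0" for p
      using step.IH step.prems that by auto
    have "a * chain m (Suc k) * p' * gT k \<in> N m k"
      by (rule N_T_step[OF IH[OF p'(1)]]) (use k assms in auto)
    moreover have "a * chain m (Suc k) * p'' \<in> N m k"
      by (rule N_mono[OF IH[OF p'(2)]]) (use k assms in auto)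
    ultimately have "a * chain m (Suc k) * p' * gT k + a * chain m (Suc k) * p'' \<in> N m k"
      by (rule N_add)
    moreover have "a * chain m (Suc k) * (gT k * p) \<approx> a * chain m (Suc k) * (p' * gT k + p'')"
      by (rule cg_left[OF p'(3) ch])
    then have "a * chain m k * p \<approx> a * chain m (Suc k) * p' * gT k + a * chain m (Suc k) * p''"
      using k by (simp add: chain_step[of k] algebra_simps)
    moreover have "a * chain m k * p \<in> C" using k assms aC by (intro C_closed chain_C) auto
    ultimately show ?case by (metis N_cg)
  qed
  show ?thesis
  proof (rule N_right[OF assms(1) R_in_C[OF assms(4)]])
    fix a k assume k: "a \<in> R m" "K \<le> k" "k \<le> m + 2"
    show "a * chain m k * p \<in> N m K"
      by (rule N_mono[OF main]) (use k assms in auto)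
  qed
qed

lemma N_T_prod_below:
  assumes "b \<in> N m K" "Suc m < l + d" "K \<le> m + 2"
    and "\<And>r. r \<in> set rs \<Longrightarrow> 1 \<le> r \<and> Suc r < K"
  shows "b * prod_list (map gT rs) \<in> N m K"
  using assms(1,4)
proof (induction rs arbitrary: b)
  case (Cons r rs)
  have "b * gT r * prod_list (map gT rs) \<in> N m K"
    using Cons assms by (intro Cons.IH N_T_below) auto
  then show ?case by (simp add: mult.assoc)
qed simp

text \<open>In the group, the chain times \<open>T_{i+1}\<close> equals \<open>T_i\<close> times the
  chain. Here \<open>T_{i+1}\<close> passes the tail \<open>E\<close>, the braid relation turns it
  into \<open>T_i\<close>, and \<open>T_i\<close> passes the head. The Laurent error of the braid
  relation leaves the shorter chain ending at \<open>i + 2\<close>, followed by the factors of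
  \<open>E\<close>, which commute with it.\<close>

lemma N_T_above:
  assumes "Suc m < l + d" "1 \<le> k" "k \<le> i" "i \<le> m" "a \<in> R m"
  shows "a * chain m k * gT (Suc i) \<in> N m 1"
proof -
  define E where "E = prod_list (map gT (rev [k..<i]) :: 'k hecke_poly list)"
  let ?h = "a * chain m (Suc (Suc i))"
  have split: "chain m k = chain m (Suc (Suc i)) * gT (Suc i) * gT i * E"
  proof -
    have "[k..<m + 2] = [k..<i] @ i # Suc i # [Suc (Suc i)..<m + 2]"
      using assms upt_add_eq_append[of k i "m + 2 - i"] by (simp add: upt_conv_Cons)
    then show ?thesis by (simp add: chain_def E_def mult.assoc)
  qed
  have T: "gT i \<in> C" "gT (Suc i) \<in> C" using assms by (auto intro!: gens_closed)
  have EC: "E \<in> C" unfolding E_def using assms by (intro T_prod_C) auto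
  have aC: "a \<in> C" using assms(5) by (rule R_in_C)
  have hC: "?h \<in> C" using assms by (intro C_closed aC chain_C) auto
  have hN: "?h \<in> N m (Suc (Suc i))" using assms by (intro N_term) auto
  obtain p where p: "p \<in> R 0" "gT (Suc i) * gT i * gT (Suc i) \<approx> gT i * gT (Suc i) * gT i + p"
    using T_braid[of i] assms by auto
  have "E * gT (Suc i) \<approx> gT (Suc i) * E"
    unfolding E_def by (rule T_commute_prod) (use assms in auto)
  then have "?h * gT (Suc i) * gT i * (E * gT (Suc i)) \<approx> ?h * gT (Suc i) * gT i * (gT (Suc i) * E)"
    by (rule cg_left) (intro C_closed hC T)
  also have "\<dots> = ?h * (gT (Suc i) * gT i * gT (Suc i)) * E" by (simp add: mult.assoc)
  also have "\<dots> \<approx> ?h * (gT i * gT (Suc i) * gT i + p) * E"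
    by (intro cg_right cg_left p hC EC)
  also have "\<dots> = ?h * gT i * (gT (Suc i) * gT i * E) + ?h * p * E" by (simp add: algebra_simps)
  also have "\<dots> \<approx> a * gT i * chain m (Suc (Suc i)) * (gT (Suc i) * gT i * E) + ?h * p * E"
    by (intro cg_add cg_refl cg_right chain_T_commute C_closed T EC) (use assms in auto)
  also have "\<dots> = a * gT i * chain m k + ?h * p * E" by (simp add: split mult.assoc)
  finally have eq: "a * chain m k * gT (Suc i) \<approx> a * gT i * chain m k + ?h * p * E"
    by (simp add: split mult.assoc)
  have "?h * p * E \<in> N m (Suc (Suc i))"
    unfolding E_def
    by (rule N_T_prod_below[OF N_R0[OF hN assms(1) _ p(1)]]) (use assms in auto)
  then have "?h * p * E \<in> N m 1" by (rule N_mono) (use assms in auto)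
  moreover have "a * gT i * chain m k \<in> N m 1"
    using assms by (intro N_term R_mult R_T) auto
  ultimately have "a * gT i * chain m k + ?h * p * E \<in> N m 1" by (intro N_add)
  then show ?thesis
    by (rule N_cg[OF _ _ eq]) (use assms aC T chain_C[of k m] in \<open>simp add: C_closed\<close>)
qed

text \<open>Four positions of \<open>j\<close> relative to the end \<open>k\<close> of a chain: far
  below it commutes, just below it prolongs the chain, at the end the quadratic relation applies,
  and above the end the braid relation does.\<close>

lemma N_T:
  assumes "b \<in> N m 1" "Suc m < l + d" "1 \<le> j" "j \<le> Suc m"
  shows "b * gT j \<in> N m 1"
proof -
  have jC: "gT j \<in> C" using assms by (intro gens_closed) auto
  show ?thesis
  proof (rule N_right[OF assms(1) jC])
    fix a k assume k: "a \<in> R m" "1 \<le> k" "k \<le> m + 2"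
    have ak: "a * chain m k \<in> N m k" using k assms by (intro N_term) auto
    consider "Suc j < k" | "k = Suc j" | "k = j" | "k < j" by linarith
    then show "a * chain m k * gT j \<in> N m 1"
    proof cases
      case 1
      then have "a * chain m k * gT j \<in> N m k" using k assms ak by (intro N_T_below) auto
      then show ?thesis by (rule N_mono) (use k assms in auto)
    next
      case 2
      then have "a * chain m k * gT j \<in> N m j" using k assms ak by (intro N_T_step) auto
      then show ?thesis by (rule N_mono) (use k assms in auto)
    next
      case 3
      let ?h = "a * chain m (Suc j)"
      have hN: "?h \<in> N m (Suc j)" using k assms by (intro N_term) auto
      have jr: "1 \<le> j" "j < l + d" using assms by auto
      obtain p p' where p: "p \<in> R 0" "p' \<in> R 0" "gT j * gT j \<approx> p * gT j + p'"
        using T_square[OF jr] by (auto simp: TP_def)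
      have "?h * (gT j * gT j) \<approx> ?h * (p * gT j + p')" by (rule cg_left[OF p(3) N_C[OF hN]])
      then have "a * chain m k * gT j \<approx> ?h * p * gT j + ?h * p'"
        using 3 assms by (simp add: chain_step[of j] algebra_simps)
      moreover have "?h * p * gT j \<in> N m j"
        using assms by (intro N_T_step N_R0[OF hN _ _ p(1)]) auto
      then have "?h * p * gT j \<in> N m 1" by (rule N_mono) (use assms in auto)
      moreover have "?h * p' \<in> N m (Suc j)" using assms by (intro N_R0[OF hN _ _ p(2)]) auto
      then have "?h * p' \<in> N m 1" by (rule N_mono) (use assms in auto)
      ultimately show ?thesis
        by (metis N_cg[OF N_add C_closed(6)[OF N_C[OF ak] jC]])
    next
      case 4
      then obtain i where "j = Suc i" "k \<le> i" by (cases j) auto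
      then show ?thesis using N_T_above[of m k i a] k assms by simp
    qed
  qed
qed

text \<open>The span \<open>N m 1\<close> contains the empty chain and is stable under right
  multiplication by every generator of \<open>R (Suc m)\<close>.\<close>

lemma R_Suc_decompose:
  assumes "x \<in> R (Suc m)" "Suc m < l + d"
  shows "x \<in> N m 1"
proof -
  have "b * x \<in> N m 1" if "b \<in> N m 1" for b
    using assms(1) that
  proof (induction arbitrary: b rule: R.induct)
    case (R_T r)
    then show ?case using N_T assms(2) by blast
  next
    case (R_mult a b')
    have "b * a * b' \<in> N m 1" by (rule R_mult.IH(2)[OF R_mult.IH(1)[OF R_mult.prems]])
    then show ?case by (simp add: mult.assoc)
  next
    case (R_add a b')
    then show ?case by (simp add: distrib_left N_add)
  next
    case (R_const x) then show ?case by (intro N_R0 R.R_const assms(2)) simp_all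
  next
    case (R_e c) then show ?case by (intro N_R0 R.R_e assms(2)) simp_all
  next
    case (R_X i) then show ?case by (intro N_R0 R.R_X assms(2)) simp_all
  next
    case (R_X' i) then show ?case by (intro N_R0 R.R_X' assms(2)) simp_all
  qed
  moreover have "1 * chain m (m + 2) \<in> N m 1"
    by (rule N_term[OF R_1]) (use assms in auto)
  ultimately have "1 * chain m (m + 2) * x \<in> N m 1" by blast
  then show ?thesis by simp
qed

end

section \<open>Faithfulness\<close>

lemma black_pos_facts:
  assumes "c \<in> colour_tuples l d"
  shows bij_betw_black_pos: "bij_betw (black_pos l d c) {1..d} {j \<in> {1..l + d}. c j = 0}"
    and black_pos_mono: "1 \<le> r \<Longrightarrow> r < s \<Longrightarrow> s \<le> d \<Longrightarrow> black_pos l d c r < black_pos l d c s"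
proof -
  let ?S = "{j \<in> {1..l + d}. c j = 0}"
  let ?L = "sorted_list_of_set ?S"
  have len: "length ?L = d" using assms by (simp add: colour_tuples_def)
  have "bij_betw ((!) ?L) {..<d} ?S"
    using bij_betw_nth[of ?L "{..<d}" ?S] len by simp
  moreover have "bij_betw (\<lambda>r. r - 1) {1..d} {..<d}"
    by (rule bij_betw_byWitness[where f' = Suc]) auto
  ultimately have "bij_betw ((!) ?L \<circ> (\<lambda>r. r - 1)) {1..d} ?S"
    by (rule bij_betw_trans[rotated])
  then show "bij_betw (black_pos l d c) {1..d} ?S"
    unfolding black_pos_def[abs_def] by (simp add: comp_def)
  show "1 \<le> r \<Longrightarrow> r < s \<Longrightarrow> s \<le> d \<Longrightarrow> black_pos l d c r < black_pos l d c s"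
    unfolding black_pos_def
    by (rule sorted_wrt_nth_less[OF strict_sorted_list_of_set]) (use len in auto)
qed

lemma black_pos_mem:
  assumes "c \<in> colour_tuples l d" "r \<in> {1..d}"
  shows "black_pos l d c r \<in> {1..l + d}" "c (black_pos l d c r) = 0"
  using bij_betw_apply[OF bij_betw_black_pos[OF assms(1)] assms(2)] by auto

lemma black_pos_ex:
  assumes "c \<in> colour_tuples l d" "j \<in> {1..l + d}" "c j = 0"
  obtains r where "r \<in> {1..d}" "j = black_pos l d c r"
  using bij_betw_imp_surj_on[OF bij_betw_black_pos[OF assms(1)]] assms by blast

lemma black_index_black_pos:
  assumes "c \<in> colour_tuples l d" "r \<in> {1..d}"
  shows "black_index c (black_pos l d c r) = r"
proof -
  let ?p = "black_pos l d c"
  have "{i \<in> {1..?p r}. c i = 0} = ?p ` {1..r}"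
  proof (intro equalityI subsetI)
    fix i assume i: "i \<in> {i \<in> {1..?p r}. c i = 0}"
    then obtain s where s: "s \<in> {1..d}" "i = ?p s"
      using black_pos_ex[OF assms(1), of i] black_pos_mem(1)[OF assms] by auto
    then have "s \<le> r" using black_pos_mono[OF assms(1), of r s] assms(2) i by (cases "r < s") auto
    then show "i \<in> ?p ` {1..r}" using s by auto
  next
    fix i assume "i \<in> ?p ` {1..r}"
    then obtain s where s: "s \<in> {1..r}" "i = ?p s" by blast
    then have "?p s \<le> ?p r" using black_pos_mono[OF assms(1), of s r] assms(2) by (cases "s = r") auto
    then show "i \<in> {i \<in> {1..?p r}. c i = 0}"
      using s black_pos_mem[OF assms(1), of s] assms(2) by auto
  qed
  moreover have "inj_on ?p {1..r}"
    by (rule inj_on_subset[OF bij_betw_imp_inj_on[OF bij_betw_black_pos[OF assms(1)]]]) (use assms(2) in auto)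
  ultimately show ?thesis by (simp add: black_index_def card_image)
qed

context hecke_parameters
begin

abbreviation bp :: "(nat \<Rightarrow> nat) \<Rightarrow> nat \<Rightarrow> nat" where "bp \<equiv> black_pos l d"

definition blacks :: "(nat \<Rightarrow> 'k) \<Rightarrow> nat \<Rightarrow> 'k" where
  "blacks u r = u (bp (colour u) r)"

lemma blacks_generic:
  assumes "state u" shows "generic l q Q {1..d} (blacks u)"
proof -
  have J: "colour u \<in> J" by (rule colour_in_J[OF assms])
  have mem: "bp (colour u) r \<in> {j \<in> {1..l + d}. u j \<noteq> 0}" if "r \<in> {1..d}" for r
    using black_pos_mem[OF J that] colour_eq_iff(1)[of "bp (colour u) r" u] by simp
  have inj: "bp (colour u) r \<noteq> bp (colour u) s" if "r \<in> {1..d}" "s \<in> {1..d}" "r \<noteq> s" for r s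
    using bij_betw_imp_inj_on[OF bij_betw_black_pos[OF J]] that by (meson inj_onD)
  have "generic l q Q {j \<in> {1..l + d}. u j \<noteq> 0} u" using assms by (simp add: state_def)
  then show ?thesis
    unfolding generic_def blacks_def using mem inj by blast
qed

lemma blacks_nonzero: "state u \<Longrightarrow> r \<in> {1..d} \<Longrightarrow> blacks u r \<noteq> 0"
  using blacks_generic unfolding generic_def by blast

text \<open>Spread the coordinates of \<open>p\<close> over the black positions of \<open>c\<close>
  and put 0 elsewhere. Each colour thus sees all generic points, so independence of monomials
  applies colour by colour.\<close>

lemma state_ex:
  assumes c: "c \<in> J" and p: "generic l q Q {1..d} p"
  obtains u where "state u" "colour u = c" "\<And>r. r \<in> {1..d} \<Longrightarrow> blacks u r = p r"
proof -
  let ?B = "{j \<in> {1..l + d}. c j = 0}"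
  define u where "u j = (if j \<in> ?B then p (black_index c j) else 0)" for j
  have ub: "u (bp c r) = p r" if "r \<in> {1..d}" for r
    using black_pos_mem[OF c that] black_index_black_pos[OF c that] by (simp add: u_def)
  have nz: "u j \<noteq> 0 \<longleftrightarrow> c j = 0" if j: "j \<in> {1..l + d}" for j
  proof
    assume "c j = 0"
    then obtain r where r: "r \<in> {1..d}" "j = bp c r" using black_pos_ex[OF c j] by blast
    then have "u j = p r" using ub by simp
    then show "u j \<noteq> 0" using p r(1) unfolding generic_def by simp
  qed (auto simp: u_def split: if_splits)
  have col: "colour u = c"
  proof
    fix j show "colour u j = c j"
    proof (cases "j \<in> {1..l + d}")
      case True
      then show ?thesis using nz[OF True] colour_cases[OF c True] by (auto simp: colour_apply)
    next
      case False
      then show ?thesis using c by (auto simp: colour_def colour_tuples_def restrict_def PiE_iff extensional_def)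
    qed
  qed
  have Beq: "{j \<in> {1..l + d}. u j \<noteq> 0} = ?B" using nz by blast
  have "{j \<in> {1..l + d}. u j = 0} = {j \<in> {1..l + d}. c j = 1}"
    using nz colour_cases[OF c] by (metis (mono_tags, lifting) zero_neq_one)
  then have "card {j \<in> {1..l + d}. u j = 0} = l" using c by (simp add: colour_tuples_def)
  moreover have "generic l q Q ?B u"
  proof -
    have ex: "\<exists>r. r \<in> {1..d} \<and> j = bp c r" if "j \<in> ?B" for j using black_pos_ex[OF c] that by blast
    show ?thesis
      unfolding generic_def
    proof (intro conjI ballI impI)
      fix i assume i: "i \<in> ?B"
      then obtain r where r: "r \<in> {1..d}" "i = bp c r" using ex by blast
      then show "u i \<noteq> 0" "u i \<notin> Q ` {1..l}" using ub p unfolding generic_def by simp_all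
      fix j assume j: "j \<in> ?B" "i \<noteq> j"
      then obtain s where s: "s \<in> {1..d}" "j = bp c s" using ex by blast
      then have "r \<noteq> s" using r j(2) by blast
      then have "p r \<noteq> p s" "p r \<noteq> q * p s" using p r(1) s(1) unfolding generic_def by blast+
      then show "u i \<noteq> u j" "u i \<noteq> q * u j" using r s ub by simp_all
    qed
  qed
  ultimately have "state u" unfolding state_def Beq by simp
  then show ?thesis using that[of u] col ub by (simp add: blacks_def)
qed

section \<open>Words in the invertible generators on a fixed colour\<close>

definition letter :: "(nat \<Rightarrow> nat) \<Rightarrow> nat \<times> bool \<Rightarrow> 'k hecke_poly" where
  "letter c x = (if snd x then gX (bp c (fst x)) else gX' (bp c (fst x)))"

text \<open>Words stand in for monomials because in the free algebra letters commute and cancel only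
  modulo the ideal, and only next to \<open>e(c)\<close>.\<close>

definition wd :: "(nat \<Rightarrow> nat) \<Rightarrow> (nat \<times> bool) list \<Rightarrow> 'k hecke_poly" where
  "wd c ws = prod_list (map (letter c) ws)"

definition expo :: "(nat \<times> bool) list \<Rightarrow> nat \<Rightarrow>\<^sub>0 int" where
  "expo ws = (\<Sum>x\<leftarrow>ws. single (fst x) (if snd x then 1 else - 1))"

abbreviation valid :: "(nat \<times> bool) list \<Rightarrow> bool" where
  "valid ws \<equiv> fst ` set ws \<subseteq> {1..d}"

lemma wd_simps [simp]: "wd c [] = 1" "wd c (x # ws) = letter c x * wd c ws" "wd c (ws @ vs) = wd c ws * wd c vs"
  by (simp_all add: wd_def)

lemma expo_simps [simp]: "expo [] = 0"
  "expo (x # ws) = single (fst x) (if snd x then 1 else - 1) + expo ws"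
  "expo (ws @ vs) = expo ws + expo vs"
  by (simp_all add: expo_def)

lemma letter_R: "c \<in> J \<Longrightarrow> fst x \<in> {1..d} \<Longrightarrow> letter c x \<in> R m"
  using black_pos_mem(1)[of c l d "fst x"] by (simp add: letter_def R_X R_X' del: atLeastAtMost_iff)

lemma wd_R: "c \<in> J \<Longrightarrow> valid ws \<Longrightarrow> wd c ws \<in> R m"
  by (induction ws) (simp_all add: R_1 R_mult letter_R del: atLeastAtMost_iff)

lemmas letter_C = R_in_C[OF letter_R[where m = 0]]
lemmas wd_C = R_in_C[OF wd_R[where m = 0]]

lemma e_C: "c \<in> J \<Longrightarrow> ge c \<in> C" by (rule gens_closed(1))

lemma letter_e:
  assumes "c \<in> J" "c' \<in> J" "fst x \<in> {1..d}"
  shows "letter c x * ge c' \<approx> ge c' * letter c x"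
proof -
  have "bp c (fst x) \<in> {1..l + d}" by (rule black_pos_mem(1)[OF assms(1,3)])
  then show ?thesis
    using cg_rel[OF X_e[OF assms(2)]] cg_rel[OF X'_e[OF assms(2)]] by (simp add: letter_def)
qed

lemma wd_e:
  assumes "c \<in> J" "c' \<in> J" "valid ws"
  shows "wd c ws * ge c' \<approx> ge c' * wd c ws"
  using assms(3)
proof (induction ws)
  case (Cons x ws)
  then have v: "fst x \<in> {1..d}" "valid ws" by auto
  have "letter c x * (wd c ws * ge c') \<approx> letter c x * (ge c' * wd c ws)"
    by (rule cg_left[OF Cons.IH[OF v(2)] letter_C[OF assms(1) v(1)]])
  also have "\<dots> = (letter c x * ge c') * wd c ws" by (simp add: mult.assoc)
  also have "\<dots> \<approx> (ge c' * letter c x) * wd c ws"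
    by (rule cg_right[OF letter_e[OF assms(1,2) v(1)] wd_C[OF assms(1) v(2)]])
  finally show ?case by (simp add: mult.assoc)
qed simp

lemma letter_cancel:
  assumes "c \<in> J" "r \<in> {1..d}"
  shows "letter c (r, b) * letter c (r, \<not> b) * ge c \<approx> ge c"
  using cg_rel[OF X_X'_black[OF assms(1) black_pos_mem[OF assms]]]
    cg_rel[OF X'_X_black[OF assms(1) black_pos_mem[OF assms]]]
  by (cases b) (simp_all add: letter_def)

text \<open>The presentation commutes \<open>X\<close> with \<open>X\<close> and \<open>X'\<close>
  with \<open>X'\<close>. The mixed case holds on \<open>e(c)\<close> because \<open>X_j'\<close> is
  inverse to \<open>X_j\<close> there: insert \<open>X_j X_j'\<close>, commute \<open>X_i\<close>
  with \<open>X_j\<close>, and cancel.\<close>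

lemma X_X'_commute:
  assumes c: "c \<in> J" and i: "i \<in> {1..l + d}" and j: "j \<in> {1..l + d}" "c j = 0"
  shows "gX i * gX' j * ge c \<approx> gX' j * gX i * ge c"
proof -
  have cl: "gX i \<in> C" "gX j \<in> C" "gX' j \<in> C" "ge c \<in> C" using gens_closed c i j by blast+
  have ei: "gX i * ge c \<approx> ge c * gX i" by (rule cg_rel[OF X_e[OF c i]])
  have ej: "gX' j * ge c \<approx> ge c * gX' j" by (rule cg_rel[OF X'_e[OF c j(1)]])
  have "gX' j * gX i * ge c \<approx> gX' j * gX i * (gX j * gX' j * ge c)"
    by (rule cg_left[OF cg_sym[OF cg_rel[OF X_X'_black[OF c j]]]]) (intro C_closed cl)
  also have "\<dots> = gX' j * (gX i * gX j) * (gX' j * ge c)" by (simp add: mult.assoc)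
  also have "\<dots> \<approx> gX' j * (gX j * gX i) * (gX' j * ge c)"
    by (intro cg_right cg_left cg_rel[OF X_X] C_closed cl i j)
  also have "\<dots> \<approx> gX' j * (gX j * gX i) * (ge c * gX' j)"
    by (intro cg_left ej C_closed cl)
  also have "\<dots> = gX' j * gX j * (gX i * ge c) * gX' j" by (simp add: mult.assoc)
  also have "\<dots> \<approx> gX' j * gX j * (ge c * gX i) * gX' j"
    by (intro cg_right cg_left ei C_closed cl)
  also have "\<dots> = (gX' j * gX j * ge c) * (gX i * gX' j)" by (simp add: mult.assoc)
  also have "\<dots> \<approx> ge c * (gX i * gX' j)"
    by (intro cg_right cg_rel[OF X'_X_black[OF c j]] C_closed cl)
  also have "\<dots> = (ge c * gX i) * gX' j" by (simp add: mult.assoc)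
  also have "\<dots> \<approx> (gX i * ge c) * gX' j" by (intro cg_right cg_sym[OF ei] cl)
  also have "\<dots> = gX i * (ge c * gX' j)" by (simp add: mult.assoc)
  also have "\<dots> \<approx> gX i * (gX' j * ge c)" by (intro cg_left cg_sym[OF ej] cl)
  finally show ?thesis by (simp add: cg_sym mult.assoc)
qed

lemma letter_commute:
  assumes "c \<in> J" "fst x \<in> {1..d}" "fst y \<in> {1..d}"
  shows "letter c x * letter c y * ge c \<approx> letter c y * letter c x * ge c"
proof -
  note p = black_pos_mem[OF assms(1,2)] black_pos_mem[OF assms(1,3)]
  have e: "ge c \<in> C" by (rule e_C[OF assms(1)])
  show ?thesis
    using cg_right[OF cg_rel[OF X_X[OF p(1,3)]] e] cg_right[OF cg_rel[OF X'_X'[OF p(1,3)]] e]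
      X_X'_commute[OF assms(1) p(1) p(3,4)] cg_sym[OF X_X'_commute[OF assms(1) p(3) p(1,2)]]
    by (cases "snd x"; cases "snd y") (simp_all add: letter_def)
qed

lemma letter_commute_wd:
  assumes "c \<in> J" "fst x \<in> {1..d}" "fst y \<in> {1..d}" "valid ws"
  shows "letter c x * letter c y * wd c ws * ge c \<approx> letter c y * letter c x * wd c ws * ge c"
proof -
  have cl: "letter c x \<in> C" "letter c y \<in> C" "wd c ws \<in> C"
    using letter_C wd_C assms by auto
  have "letter c x * letter c y * (wd c ws * ge c) \<approx> letter c x * letter c y * (ge c * wd c ws)"
    by (intro cg_left wd_e assms C_closed cl)
  also have "\<dots> = (letter c x * letter c y * ge c) * wd c ws" by (simp add: mult.assoc)
  also have "\<dots> \<approx> (letter c y * letter c x * ge c) * wd c ws"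
    by (intro cg_right letter_commute assms cl)
  also have "\<dots> = letter c y * letter c x * (ge c * wd c ws)" by (simp add: mult.assoc)
  also have "\<dots> \<approx> letter c y * letter c x * (wd c ws * ge c)"
    by (intro cg_left cg_sym[OF wd_e] assms C_closed cl)
  finally show ?thesis by (simp add: mult.assoc)
qed

lemma wd_move:
  assumes "c \<in> J" "valid (vs @ x # ws)"
  shows "wd c (vs @ x # ws) * ge c \<approx> wd c (x # vs @ ws) * ge c"
  using assms(2)
proof (induction vs)
  case (Cons y vs)
  have v: "fst y \<in> {1..d}" "fst x \<in> {1..d}" "valid (vs @ x # ws)" "valid (vs @ ws)"
    using Cons.prems by auto
  have "letter c y * (wd c (vs @ x # ws) * ge c) \<approx> letter c y * (wd c (x # vs @ ws) * ge c)"
    by (rule cg_left[OF Cons.IH[OF v(3)] letter_C[OF assms(1) v(1)]])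
  also have "\<dots> = letter c y * letter c x * wd c (vs @ ws) * ge c" by (simp add: mult.assoc)
  also have "\<dots> \<approx> letter c x * letter c y * wd c (vs @ ws) * ge c"
    by (rule letter_commute_wd[OF assms(1) v(1,2,4)])
  finally show ?case by (simp add: mult.assoc)
qed simp

lemma expo_sign:
  assumes "(r, \<not> b) \<notin> set ws"
  shows "if b then 0 \<le> lookup (expo ws) r else lookup (expo ws) r \<le> 0"
  using assms
  by (induction ws) (auto simp: lookup_add lookup_single when_def split: if_splits)

lemma wd_expo_0:
  assumes "c \<in> J" "valid ws" "expo ws = 0"
  shows "wd c ws * ge c \<approx> ge c"
  using assms(2,3)
proof (induction "length ws" arbitrary: ws rule: less_induct)
  case less
  show ?case
  proof (cases ws)
    case Nil then show ?thesis by simp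
  next
    case (Cons x ws')
    obtain r b where x: "x = (r, b)" by (cases x)
    have "(r, \<not> b) \<in> set ws'"
    proof (rule ccontr)
      assume "(r, \<not> b) \<notin> set ws'"
      from expo_sign[OF this] have "lookup (expo ws) r \<noteq> 0"
        unfolding Cons x by (auto simp: lookup_add split: if_splits)
      then show False using less.prems(2) by simp
    qed
    then obtain vs us where ws': "ws' = vs @ (r, \<not> b) # us" by (meson split_list)
    have v: "r \<in> {1..d}" "valid (vs @ (r, \<not> b) # us)" "valid (vs @ us)"
      using less.prems(1) unfolding Cons x ws' by auto
    have cl: "letter c (r, b) \<in> C" "letter c (r, \<not> b) \<in> C" "wd c (vs @ us) \<in> C"
      using letter_C wd_C[OF assms(1) v(3)] assms v by auto
    have "letter c (r, b) * (wd c ws' * ge c) \<approx> letter c (r, b) * (wd c ((r, \<not> b) # vs @ us) * ge c)"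
      unfolding ws' by (rule cg_left[OF wd_move[OF assms(1) v(2)] cl(1)])
    also have "\<dots> = letter c (r, b) * letter c (r, \<not> b) * (wd c (vs @ us) * ge c)"
      by (simp add: mult.assoc)
    also have "\<dots> \<approx> letter c (r, b) * letter c (r, \<not> b) * (ge c * wd c (vs @ us))"
      by (intro cg_left wd_e assms v C_closed cl)
    also have "\<dots> = (letter c (r, b) * letter c (r, \<not> b) * ge c) * wd c (vs @ us)"
      by (simp add: mult.assoc)
    also have "\<dots> \<approx> ge c * wd c (vs @ us)"
      by (intro cg_right letter_cancel assms v cl)
    also have "\<dots> \<approx> wd c (vs @ us) * ge c" by (intro cg_sym[OF wd_e] assms v)
    also have "\<dots> \<approx> ge c"
    proof (rule less.hyps)
      show "length (vs @ us) < length ws" by (simp add: Cons ws')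
      have "single r (if b then 1 else - 1) + single r (if \<not> b then 1 else - 1) = (0 :: nat \<Rightarrow>\<^sub>0 int)"
        by (simp flip: single_add)
      then show "expo (vs @ us) = 0"
        using less.prems(2) unfolding Cons x ws' by (simp add: algebra_simps)
    qed (rule v(3))
    finally show ?thesis by (simp add: Cons x mult.assoc)
  qed
qed

definition winv :: "(nat \<times> bool) list \<Rightarrow> (nat \<times> bool) list" where
  "winv ws = map (\<lambda>x. (fst x, \<not> snd x)) ws"

lemma expo_winv: "expo (winv ws) = - expo ws"
proof (induction ws)
  case (Cons x ws)
  then show ?case by (auto simp: winv_def single_uminus)
qed (simp add: winv_def)

lemma valid_winv: "valid ws \<Longrightarrow> valid (winv ws)"
  by (auto simp: winv_def)

text \<open>Insert \<open>winv vs @ vs\<close> after \<open>ws\<close>; then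
  \<open>ws @ winv vs\<close> has exponent zero and disappears.\<close>

lemma wd_expo_cong:
  assumes c: "c \<in> J" and v: "valid ws" "valid vs" and eq: "expo ws = expo vs"
  shows "wd c ws * ge c \<approx> wd c vs * ge c"
proof -
  have v': "valid (winv vs)" by (rule valid_winv[OF v(2)])
  have cl: "wd c ws \<in> C" "wd c vs \<in> C" "wd c (winv vs) \<in> C" using wd_C c v v' by blast+
  have 1: "wd c (winv vs @ vs) * ge c \<approx> ge c"
    by (rule wd_expo_0[OF c]) (use v v' in \<open>auto simp: expo_winv\<close>)
  have 2: "wd c (ws @ winv vs) * ge c \<approx> ge c"
    by (rule wd_expo_0[OF c]) (use v v' eq in \<open>auto simp: expo_winv\<close>)
  have "wd c ws * ge c \<approx> wd c ws * (wd c (winv vs @ vs) * ge c)"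
    by (rule cg_left[OF cg_sym[OF 1] cl(1)])
  also have "\<dots> = wd c (ws @ winv vs) * (wd c vs * ge c)" by (simp add: mult.assoc)
  also have "\<dots> \<approx> wd c (ws @ winv vs) * (ge c * wd c vs)"
    unfolding wd_simps by (intro cg_left wd_e c v C_closed cl)
  also have "\<dots> = (wd c (ws @ winv vs) * ge c) * wd c vs" by (simp add: mult.assoc)
  also have "\<dots> \<approx> ge c * wd c vs" by (rule cg_right[OF 2 cl(2)])
  also have "\<dots> \<approx> wd c vs * ge c" by (rule cg_sym[OF wd_e[OF c c v(2)]])
  finally show ?thesis .
qed

definition canon :: "(nat \<Rightarrow>\<^sub>0 int) \<Rightarrow> (nat \<times> bool) list" where
  "canon m = (SOME ws. valid ws \<and> expo ws = m)"

lemma canon: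
  assumes "valid ws" shows "valid (canon (expo ws))" "expo (canon (expo ws)) = expo ws"
  using someI_ex[of "\<lambda>vs. valid vs \<and> expo vs = expo ws"] assms unfolding canon_def by auto

lemma valid_expo_ex:
  assumes "keys m \<subseteq> {1..d}"
  shows "\<exists>ws. valid ws \<and> expo ws = m"
proof -
  have single: "\<exists>ws. valid ws \<and> expo ws = single r e" if r: "r \<in> {1..d}" for r e
  proof -
    have rep: "expo (replicate k (r, b)) = single r (if b then int k else - int k)" for k b
      by (induction k) (auto simp flip: single_add)
    have "expo (replicate (nat \<bar>e\<bar>) (r, 0 \<le> e)) = single r e"
      unfolding rep by simp
    moreover have "valid (replicate (nat \<bar>e\<bar>) (r, 0 \<le> e))" using r by auto
    ultimately show ?thesis by blast
  qed
  have "\<exists>ws. valid ws \<and> expo ws = (\<Sum>r\<in>S. single r (lookup m r))"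
    if "finite S" "S \<subseteq> {1..d}" for S
    using that
  proof (induction S rule: finite_induct)
    case empty
    show ?case by (rule exI[of _ "[]"]) simp
  next
    case (insert r S)
    obtain ws where ws: "valid ws" "expo ws = (\<Sum>r\<in>S. single r (lookup m r))"
      using insert by auto
    obtain vs where vs: "valid vs" "expo vs = single r (lookup m r)"
      using single insert.prems by blast
    have "valid (vs @ ws)" using ws(1) vs(1) by auto
    moreover have "expo (vs @ ws) = (\<Sum>r\<in>insert r S. single r (lookup m r))"
      using insert.hyps ws(2) vs(2) by simp
    ultimately show ?case by blast
  qed
  moreover have "m = (\<Sum>r\<in>keys m. single r (lookup m r))"
    by (rule poly_mapping_eqI) (auto simp: lookup_sum lookup_single when_def in_keys_iff)
  ultimately show ?thesis using assms by (metis finite_keys)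
qed

lemma keys_expo: "valid ws \<Longrightarrow> keys (expo ws) \<subseteq> {1..d}"
proof (induction ws)
  case (Cons x ws)
  then show ?case
    using keys_add[of "single (fst x) (if snd x then 1 else - 1 :: int)" "expo ws"]
    by (auto split: if_splits)
qed simp

text \<open>A representative of \<open>f e(c)\<close> in the free algebra. The choice of word in
  \<open>canon\<close> is immaterial modulo the ideal by \<open>wd_expo_cong\<close>.\<close>

definition emb :: "(nat \<Rightarrow> nat) \<Rightarrow> 'k laurent \<Rightarrow> 'k hecke_poly" where
  "emb c f = (\<Sum>m\<in>keys f. nc_const (lookup f m) * (wd c (canon m) * ge c))"

lemma emb_add: "emb c (f + g) = emb c f + emb c g"
  unfolding emb_def by (rule setsum_keys_plus_distrib) (simp_all add: nc_const_add distrib_right)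

lemma emb_0 [simp]: "emb c 0 = 0" by (simp add: emb_def)

lemma emb_sum: "emb c (\<Sum>i\<in>S. f i) = (\<Sum>i\<in>S. emb c (f i))"
  by (induction S rule: infinite_finite_induct) (simp_all add: emb_add)

lemma emb_single: "emb c (single m a) = nc_const a * (wd c (canon m) * ge c)"
  by (simp add: emb_def)

lemma act_letter: "act (letter c x) F u = u (bp c (fst x)) powi (if snd x then 1 else - 1) * F u"
  by (simp add: letter_def power_int_minus)

lemma act_wd:
  assumes "valid ws" "\<And>r. r \<in> {1..d} \<Longrightarrow> u (bp c r) \<noteq> 0"
  shows "act (wd c ws) F u = mono_eval (expo ws) (\<lambda>r. u (bp c r)) * F u"
  using assms(1)
proof (induction ws)
  case (Cons x ws)
  have v: "fst x \<in> {1..d}" "valid ws" using Cons.prems by auto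
  have "mono_eval (expo (x # ws)) (\<lambda>r. u (bp c r)) =
    mono_eval (single (fst x) (if snd x then 1 else - 1)) (\<lambda>r. u (bp c r)) * mono_eval (expo ws) (\<lambda>r. u (bp c r))"
    unfolding expo_simps
    by (rule mono_eval_add) (use v keys_expo[OF v(2)] assms(2) in \<open>auto split: if_splits\<close>)
  then show ?case using Cons.IH[OF v(2)] by (simp add: act_mult act_letter)
qed simp

lemma act_emb:
  assumes c: "c \<in> J" and f: "f \<in> laurent_polys d" and u: "state u"
  shows "act (emb c f) F u = laurent_eval f (blacks u) * proj c F u"
proof (cases "colour u = c")
  case True
  have nz: "\<And>r. r \<in> {1..d} \<Longrightarrow> u (bp c r) \<noteq> 0"
    using blacks_nonzero[OF u] True by (simp add: blacks_def)
  have main: "act (wd c (canon m)) (proj c F) u = mono_eval m (blacks u) * proj c F u"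
    if "m \<in> keys f" for m
  proof -
    have "keys m \<subseteq> {1..d}" using f that by (auto simp: laurent_polys_def)
    then have "valid (canon m)" "expo (canon m) = m" using valid_expo_ex canon by metis+
    then show ?thesis using act_wd[of "canon m" u c] nz True by (simp add: blacks_def[abs_def])
  qed
  show ?thesis
    unfolding emb_def act_sum laurent_eval_def sum_distrib_right
    by (rule sum.cong) (simp_all add: act_mult main)
next
  case False
  have "act (letter c x) G u = 0" if "G u = 0" for x G using that by (simp add: act_letter)
  then have "act (wd c ws) G u = 0" if "G u = 0" for ws G
    using that by (induction ws) (simp_all add: act_mult)
  then show ?thesis using False by (simp add: emb_def act_sum act_mult proj_def)
qed

text \<open>The Laurent part maps each summand at \<open>e(c)\<close> to itself. It suffices to
  check generators on words: each prolongs the word, rescales it, or kills it.\<close>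

lemma R0_emb:
  assumes c: "c \<in> J" and "p \<in> R 0" and "f \<in> laurent_polys d"
  shows "\<exists>g\<in>laurent_polys d. p * emb c f \<approx> emb c g"
proof -
  \<comment> \<open>Linear extension from single words to Laurent polynomials, for an arbitrary left
    factor \<open>p\<close>.\<close>
  have gen: "\<exists>g\<in>laurent_polys d. p * emb c f \<approx> emb c g"
    if p: "p \<in> C" and f: "f \<in> laurent_polys d"
      and mono: "\<And>ws. valid ws \<Longrightarrow> \<exists>g\<in>laurent_polys d. p * (wd c ws * ge c) \<approx> emb c g" for p f
  proof -
    have v: "valid (canon m)" if "m \<in> keys f" for m
    proof -
      have "keys m \<subseteq> {1..d}" using f that unfolding laurent_polys_def by blast
      then show ?thesis using valid_expo_ex canon(1) by metis
    qed
    have "\<forall>m\<in>keys f. \<exists>g. g \<in> laurent_polys d \<and>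
        p * (nc_const (lookup f m) * (wd c (canon m) * ge c)) \<approx> emb c g"
    proof
      fix m assume m: "m \<in> keys f"
      let ?a = "lookup f m"
      obtain g where g: "g \<in> laurent_polys d" "p * (wd c (canon m) * ge c) \<approx> emb c g"
        using mono[OF v[OF m]] by blast
      have "emb c (Poly_Mapping.map ((*) ?a) g) = nc_const ?a * emb c g"
      proof -
        have "emb c (single 0 ?a * g) = nc_const ?a * emb c g"
        proof (induction g rule: poly_mapping_add_induct)
          case (single k b)
          then show ?case by (simp add: mult_single emb_single nc_const_mult mult.assoc)
        qed (simp_all add: distrib_left emb_add)
        then show ?thesis by (simp add: mult_map_scale_conv_mult)
      qed
      moreover have "Poly_Mapping.map ((*) ?a) g \<in> laurent_polys d"
        using g(1) by (auto simp: laurent_polys_def in_keys_iff map.rep_eq when_def split: if_splits)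
      moreover have "nc_const ?a * (p * (wd c (canon m) * ge c)) \<approx> nc_const ?a * emb c g"
        by (rule cg_left[OF g(2) C_closed(7)])
      then have "p * (nc_const ?a * (wd c (canon m) * ge c)) \<approx> nc_const ?a * emb c g"
        by (simp add: nc_const_commute[of _ p] flip: mult.assoc)
      ultimately show "\<exists>g. g \<in> laurent_polys d \<and> p * (nc_const ?a * (wd c (canon m) * ge c)) \<approx> emb c g"
        by metis
    qed
    from bchoice[OF this] obtain G where G: "\<And>m. m \<in> keys f \<Longrightarrow> G m \<in> laurent_polys d"
      "\<And>m. m \<in> keys f \<Longrightarrow> p * (nc_const (lookup f m) * (wd c (canon m) * ge c)) \<approx> emb c (G m)"
      by blast
    have "p * emb c f \<approx> (\<Sum>m\<in>keys f. emb c (G m))"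
      unfolding emb_def[of c f] sum_distrib_left by (rule cg_sum[OF G(2)])
    also have "\<dots> = emb c (\<Sum>m\<in>keys f. G m)" by (rule emb_sum[symmetric])
    finally show ?thesis using laurent_polys_sum[of "keys f" G] G(1) by blast
  qed
  have word: "\<exists>g\<in>laurent_polys d. x \<approx> emb c g" if "valid ws" "x \<approx> wd c ws * ge c" for x ws
  proof (rule bexI)
    show "single (expo ws) 1 \<in> laurent_polys d"
      using keys_expo[OF that(1)] by (simp add: laurent_polys_def)
    show "x \<approx> emb c (single (expo ws) 1)"
      using cg_trans[OF that(2) wd_expo_cong[OF c that(1) canon(1)[OF that(1)] canon(2)[OF that(1), symmetric]]]
      by (simp add: emb_single)
  qed
  have zero: "\<exists>g\<in>laurent_polys d. x \<approx> emb c g" if "x \<approx> 0" for x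
    by (rule bexI[of _ 0]) (use that in \<open>simp_all add: laurent_polys_def\<close>)
  \<comment> \<open>A factor that kills \<open>e(c)\<close> kills the whole word, because
    \<open>e(c)\<close> can be moved to its left.\<close>
  have red: "g * (wd c ws * ge c) \<approx> 0" if "g \<in> C" "g * ge c \<approx> 0" "valid ws" for g ws
  proof -
    have "g * (wd c ws * ge c) \<approx> g * (ge c * wd c ws)" by (rule cg_left[OF wd_e[OF c c that(3)] that(1)])
    also have "\<dots> = (g * ge c) * wd c ws" by (simp add: mult.assoc)
    also have "\<dots> \<approx> 0 * wd c ws" by (rule cg_right[OF that(2) wd_C[OF c that(3)]])
    finally show ?thesis by simp
  qed
  show ?thesis
    using assms(2,3)
  proof (induction arbitrary: f rule: R.induct)
    case (R_const x)
    show ?case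
    proof (rule gen[OF C_closed(7) R_const])
      fix ws assume ws: "valid ws"
      have "nc_const x * (wd c ws * ge c) \<approx> nc_const x * (wd c (canon (expo ws)) * ge c)"
        by (rule cg_left[OF wd_expo_cong[OF c ws canon(1)[OF ws] canon(2)[OF ws, symmetric]] C_closed(7)])
      then show "\<exists>g\<in>laurent_polys d. nc_const x * (wd c ws * ge c) \<approx> emb c g"
        by (intro bexI[of _ "single (expo ws) x"])
          (use keys_expo[OF ws] in \<open>simp_all add: emb_single laurent_polys_def\<close>)
    qed
  next
    case (R_e c')
    show ?case
    proof (rule gen[OF e_C[OF R_e(1)] R_e(2)])
      fix ws assume ws: "valid ws"
      have ee: "ge c' * ge c \<approx> (if c' = c then ge c' else 0)" by (rule cg_rel[OF e_orth[OF R_e(1) c]])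
      show "\<exists>g\<in>laurent_polys d. ge c' * (wd c ws * ge c) \<approx> emb c g"
      proof (cases "c' = c")
        case True
        have "(ge c * wd c ws) * ge c \<approx> (wd c ws * ge c) * ge c"
          by (rule cg_right[OF cg_sym[OF wd_e[OF c c ws]] e_C[OF c]])
        also have "\<dots> = wd c ws * (ge c * ge c)" by (simp add: mult.assoc)
        also have "\<dots> \<approx> wd c ws * ge c" by (rule cg_left[OF _ wd_C[OF c ws]]) (use ee True in simp)
        finally show ?thesis using True by (intro word[OF ws]) (simp add: mult.assoc)
      next
        case False
        then show ?thesis using ee by (intro zero red[OF e_C[OF R_e(1)] _ ws]) simp
      qed
    qed
  next
    case (R_X i)
    have iC: "gX i \<in> C" by (rule gens_closed(3)[OF R_X(1)])
    show ?case
    proof (rule gen[OF iC R_X(2)])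
      fix ws assume ws: "valid ws"
      show "\<exists>g\<in>laurent_polys d. gX i * (wd c ws * ge c) \<approx> emb c g"
      proof (cases "c i = 1")
        case True
        then show ?thesis by (intro zero red[OF iC _ ws] cg_rel[OF X_red[OF c R_X(1)]])
      next
        case False
        then have "c i = 0" using colour_cases[OF c R_X(1)] by simp
        then obtain r where r: "r \<in> {1..d}" "i = bp c r" using black_pos_ex[OF c R_X(1)] by blast
        then show ?thesis using ws
          by (intro word[of "(r, True) # ws"]) (simp_all add: letter_def mult.assoc)
      qed
    qed
  next
    case (R_X' i)
    have iC: "gX' i \<in> C" by (rule gens_closed(4)[OF R_X'(1)])
    show ?case
    proof (rule gen[OF iC R_X'(2)])
      fix ws assume ws: "valid ws"
      show "\<exists>g\<in>laurent_polys d. gX' i * (wd c ws * ge c) \<approx> emb c g"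
      proof (cases "c i = 1")
        case True
        then show ?thesis by (intro zero red[OF iC _ ws] cg_rel[OF X'_red[OF c R_X'(1)]])
      next
        case False
        then have "c i = 0" using colour_cases[OF c R_X'(1)] by simp
        then obtain r where r: "r \<in> {1..d}" "i = bp c r" using black_pos_ex[OF c R_X'(1)] by blast
        then show ?thesis using ws
          by (intro word[of "(r, False) # ws"]) (simp_all add: letter_def mult.assoc)
      qed
    qed
  next
    case (R_T r)
    then show ?case by simp
  next
    case (R_add a b)
    obtain g where g: "g \<in> laurent_polys d" "a * emb c f \<approx> emb c g" using R_add.IH(1)[OF R_add.prems] by blast
    obtain h where h: "h \<in> laurent_polys d" "b * emb c f \<approx> emb c h" using R_add.IH(2)[OF R_add.prems] by blast
    show ?case
      using cg_add[OF g(2) h(2)] laurent_polys_add[OF g(1) h(1)]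
      by (intro bexI[of _ "g + h"]) (simp_all add: emb_add distrib_right)
  next
    case (R_mult a b)
    obtain h where h: "h \<in> laurent_polys d" "b * emb c f \<approx> emb c h" using R_mult.IH(2)[OF R_mult.prems] by blast
    obtain g where g: "g \<in> laurent_polys d" "a * emb c h \<approx> emb c g" using R_mult.IH(1)[OF h(1)] by blast
    show ?case
      using cg_trans[OF cg_left[OF h(2) R_in_C[OF R_mult.hyps(1)]] g(2)] g(1)
      by (intro bexI[of _ g]) (simp_all add: mult.assoc)
  qed
qed

lemma R0_decompose:
  assumes "p \<in> R 0"
  obtains f where "\<And>c. c \<in> J \<Longrightarrow> f c \<in> laurent_polys d" "p \<approx> (\<Sum>c\<in>J. emb c (f c))"
proof -
  have "\<forall>c\<in>J. \<exists>g. g \<in> laurent_polys d \<and> p * ge c \<approx> emb c g"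
  proof
    fix c assume c: "c \<in> J"
    have v: "valid []" by simp
    have 1: "single 0 1 \<in> laurent_polys d" by (simp add: laurent_polys_def)
    have "ge c \<approx> emb c (single 0 1)"
      using wd_expo_cong[OF c v canon(1)[OF v] canon(2)[OF v, symmetric]] by (simp add: emb_single del: single_one)
    then have "p * ge c \<approx> p * emb c (single 0 1)"
      by (rule cg_left[OF _ R_in_C[OF assms]])
    then show "\<exists>g. g \<in> laurent_polys d \<and> p * ge c \<approx> emb c g"
      using R0_emb[OF c assms 1] cg_trans by blast
  qed
  from bchoice[OF this] obtain f where f: "\<And>c. c \<in> J \<Longrightarrow> f c \<in> laurent_polys d"
    "\<And>c. c \<in> J \<Longrightarrow> p * ge c \<approx> emb c (f c)" by blast
  have "p \<approx> (\<Sum>c\<in>J. emb c (f c))"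
    by (rule cg_trans[OF cg_sym[OF cg_sum_e[OF R_in_C[OF assms]]] cg_sum[OF f(2)]])
  then show ?thesis using that f(1) by blast
qed

lemma act_emb_sum:
  assumes "\<And>c. c \<in> J \<Longrightarrow> f c \<in> laurent_polys d" "state u"
  shows "act (\<Sum>c\<in>J. emb c (f c)) F u = laurent_eval (f (colour u)) (blacks u) * F u"
proof -
  have "act (\<Sum>c\<in>J. emb c (f c)) F u = (\<Sum>c\<in>J. laurent_eval (f c) (blacks u) * proj c F u)"
    unfolding act_sum by (rule sum.cong[OF refl]) (rule act_emb[OF _ assms(1) assms(2)])
  also have "\<dots> = (\<Sum>c\<in>J. if c = colour u then laurent_eval (f (colour u)) (blacks u) * F u else 0)"
    by (rule sum.cong) (auto simp: proj_def)
  also have "\<dots> = laurent_eval (f (colour u)) (blacks u) * F u"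
    using colour_in_J[OF assms(2)] finite_colour_tuples by simp
  finally show ?thesis .
qed

lemma laurent_eval_states_inject:
  assumes "c \<in> J" "f \<in> laurent_polys d" "g \<in> laurent_polys d"
    and "\<And>u. state u \<Longrightarrow> colour u = c \<Longrightarrow> laurent_eval f (blacks u) = laurent_eval g (blacks u)"
  shows "f = g"
proof (rule laurent_eval_inject[OF assms(2,3)])
  fix p assume "generic l q Q {1..d} p"
  then obtain u where u: "state u" "colour u = c" "\<And>r. r \<in> {1..d} \<Longrightarrow> blacks u r = p r"
    using state_ex[OF assms(1)] by blast
  show "laurent_eval f p = laurent_eval g p"
    using assms(4)[OF u(1,2)] laurent_eval_cong[OF assms(2) u(3)] laurent_eval_cong[OF assms(3) u(3)] by simp
qed

text \<open>On the constant function 1 a Laurent element returns its own values at the black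
  coordinates, and these determine each component.\<close>

lemma faithful_R0:
  assumes "p \<in> R 0" "vanishing p" shows "p \<in> I"
proof -
  obtain f where f: "\<And>c. c \<in> J \<Longrightarrow> f c \<in> laurent_polys d" "p \<approx> (\<Sum>c\<in>J. emb c (f c))"
    using R0_decompose[OF assms(1)] by blast
  have 0: "0 \<in> laurent_polys d" by (simp add: laurent_polys_def)
  have "f c = 0" if c: "c \<in> J" for c
  proof (rule laurent_eval_states_inject[OF c f(1)[OF c] 0])
    fix u assume u: "state u" "colour u = c"
    have "act p (\<lambda>_. 1) u = act (\<Sum>c\<in>J. emb c (f c)) (\<lambda>_. 1) u"
      using vanishingD[OF I_vanishing[OF f(2)[unfolded cg_def]] u(1)] by simp
    then show "laurent_eval (f c) (blacks u) = laurent_eval 0 (blacks u)"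
      using vanishingD[OF assms(2) u(1)] act_emb_sum[OF f(1) u(1)] u(2) by simp
  qed
  then have "(\<Sum>c\<in>J. emb c (f c)) = 0" by simp
  then show ?thesis using f(2) by (simp add: cg_zero_iff)
qed

text \<open>\<open>cyc m k\<close> and \<open>cyc_inv m k\<close> are the products of the simple transpositions occurring in
  \<^term>\<open>chain m k\<close>, in the two possible orders.\<close>

definition cyc :: "nat \<Rightarrow> nat \<Rightarrow> nat \<Rightarrow> nat" where
  "cyc m k i = (if i = k then m + 2 else if k < i \<and> i \<le> m + 2 then i - 1 else i)"

definition cyc_inv :: "nat \<Rightarrow> nat \<Rightarrow> nat \<Rightarrow> nat" where
  "cyc_inv m k i = (if i = m + 2 then k else if k \<le> i \<and> i \<le> m + 1 then i + 1 else i)"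

lemma cyc_inverse:
  assumes "k \<le> m + 2" shows "cyc m k \<circ> cyc_inv m k = id" "cyc_inv m k \<circ> cyc m k = id"
  using assms by (auto simp: cyc_def cyc_inv_def fun_eq_iff)

lemma cyc_step: "k \<le> Suc m \<Longrightarrow> cyc m k = cyc m (Suc k) \<circ> transpose k (Suc k)"
  by (auto simp: cyc_def fun_eq_iff transpose_def)

lemma cyc_inv_step: "k \<le> Suc m \<Longrightarrow> cyc_inv m k = transpose k (Suc k) \<circ> cyc_inv m (Suc k)"
  by (auto simp: cyc_inv_def fun_eq_iff transpose_def)

lemma cyc_permutes:
  assumes "1 \<le> k" "k \<le> m + 2" "m + 2 \<le> n"
  shows "cyc m k permutes {1..n}" "cyc_inv m k permutes {1..n}"
proof -
  have inv: "cyc m k (cyc_inv m k x) = x" "cyc_inv m k (cyc m k x) = x" for x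
    using cyc_inverse[OF assms(2)] by (metis comp_apply id_apply)+
  have "\<exists>!x. cyc m k x = y" "\<exists>!x. cyc_inv m k x = y" for y
    using inv by metis+
  then show "cyc m k permutes {1..n}" "cyc_inv m k permutes {1..n}"
    using assms unfolding permutes_def by (auto simp: cyc_def cyc_inv_def)
qed

text \<open>Factor \<open>i\<close> belongs to the crossing in which coordinate \<open>m + 2\<close>
  of \<open>u\<close>, by then at position \<open>i + 1\<close>, passes \<open>u i\<close>.\<close>

definition lead :: "nat \<Rightarrow> nat \<Rightarrow> (nat \<Rightarrow> 'k) \<Rightarrow> 'k" where
  "lead m k u = (\<Prod>i = k..Suc m. T_swap i (u \<circ> cyc m (Suc i)))"

text \<open>If \<open>F\<close> is supported on states in which \<open>t\<close> does not occur to the right of position \<open>k\<close>, then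
  only the summand that swaps at every step survives.\<close>

lemma act_chain:
  assumes "k \<le> m + 2" "u (m + 2) = t"
    and "\<And>v i. F v \<noteq> 0 \<Longrightarrow> k < i \<Longrightarrow> i \<le> m + 2 \<Longrightarrow> v i \<noteq> t"
  shows "act (chain m k) F u = lead m k u * F (u \<circ> cyc m k)"
  using assms(1,3)
proof (induction k arbitrary: F rule: inc_induct)
  case base
  have "cyc m (m + 2) = id" by (auto simp: cyc_def fun_eq_iff)
  then show ?case by (simp add: lead_def)
next
  case (step k)
  have k: "k \<le> Suc m" using step.hyps by simp
  \<comment> \<open>Applying \<open>op_T k\<close> may push \<open>t\<close> one place to the right,
    to \<open>Suc k\<close>, and no further; the induction hypothesis therefore applies to
    \<open>op_T k F\<close>.\<close>
  have "op_T k F v \<noteq> 0 \<Longrightarrow> Suc k < i \<Longrightarrow> i \<le> m + 2 \<Longrightarrow> v i \<noteq> t" for v i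
  proof -
    assume a: "op_T k F v \<noteq> 0" "Suc k < i" "i \<le> m + 2"
    then have "F v \<noteq> 0 \<or> F (v \<circ> transpose k (Suc k)) \<noteq> 0" by (auto simp: op_T_def)
    then show "v i \<noteq> t"
    proof
      assume "F v \<noteq> 0" then show ?thesis by (rule step.prems) (use a in auto)
    next
      assume "F (v \<circ> transpose k (Suc k)) \<noteq> 0"
      then have "(v \<circ> transpose k (Suc k)) i \<noteq> t" by (rule step.prems) (use a in auto)
      then show ?thesis using a by (simp add: transpose_def)
    qed
  qed
  then have "act (chain m (Suc k)) (op_T k F) u = lead m (Suc k) u * op_T k F (u \<circ> cyc m (Suc k))"
    by (rule step.IH)
  moreover have "op_T k F (u \<circ> cyc m (Suc k)) = T_swap k (u \<circ> cyc m (Suc k)) * F (u \<circ> cyc m k)"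
  proof -
    have t: "(u \<circ> cyc m (Suc k)) (Suc k) = t" using assms(2) by (simp add: cyc_def)
    have "Suc k \<le> m + 2" using k by simp
    \<comment> \<open>Without the last exchange \<open>t\<close> remains at \<open>Suc k\<close>,
      outside the support of \<open>F\<close>, so the \<open>T_fix\<close> term drops out.\<close>
    then have "F (u \<circ> cyc m (Suc k)) = 0" using step.prems[OF _ lessI] t by blast
    then show ?thesis using cyc_step[OF k] by (simp add: op_T_def comp_assoc)
  qed
  moreover have "lead m k u = T_swap k (u \<circ> cyc m (Suc k)) * lead m (Suc k) u"
    unfolding lead_def using k by (rule prod.atLeast_Suc_atMost)
  ultimately show ?case
    by (simp only: chain_step[OF k] act_mult act_var gen_act.simps mult_ac)
qed

text \<open>This is what genericity was made for: the factor vanishes only for two red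
  strands.\<close>

lemma T_swap_nonzero:
  assumes "state u" "1 \<le> r" "r < l + d" "u r \<noteq> 0 \<or> u (Suc r) \<noteq> 0"
  shows "T_swap r u \<noteq> 0"
proof -
  have "u (Suc r) - q * u r \<noteq> 0" "u (Suc r) - u r \<noteq> 0" if "u r \<noteq> 0" "u (Suc r) \<noteq> 0"
    using state_distinct[OF assms(1), of "Suc r" r] assms that by simp_all
  moreover have "u r - Q (zeros_upto u (Suc r)) \<noteq> 0" if "u r \<noteq> 0" "u (Suc r) = 0"
    using state_not_Q[OF assms(1), of r r] assms that by simp
  ultimately show ?thesis using assms(4) by (auto simp: T_swap_def dl_swap_def)
qed

lemma lead_nonzero:
  assumes "state u" "1 \<le> k" "Suc m < l + d"
    and "\<And>i. k \<le> i \<Longrightarrow> i \<le> Suc m \<Longrightarrow> u (m + 2) \<noteq> 0 \<or> u i \<noteq> 0"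
  shows "lead m k u \<noteq> 0"
  unfolding lead_def
proof (subst prod_zero_iff)
  show "\<not> (\<exists>i\<in>{k..Suc m}. T_swap i (u \<circ> cyc m (Suc i)) = 0)"
  proof clarify
    fix i assume i: "i \<in> {k..Suc m}" "T_swap i (u \<circ> cyc m (Suc i)) = 0"
    have "state (u \<circ> cyc m (Suc i))"
      by (rule state_comp[OF assms(1) cyc_permutes(1)]) (use i assms in auto)
    moreover have "(u \<circ> cyc m (Suc i)) i = u i" "(u \<circ> cyc m (Suc i)) (Suc i) = u (m + 2)"
      by (simp_all add: cyc_def)
    ultimately show False
      using T_swap_nonzero[of "u \<circ> cyc m (Suc i)" i] i assms by auto
  qed
qed simp

lemma chain_e:
  assumes "c \<in> J" "1 \<le> k" "k \<le> m + 2" "Suc m < l + d"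
  shows "chain m k * ge c \<approx> ge (c \<circ> cyc_inv m k) * chain m k"
  using assms(3,1,2)
proof (induction k arbitrary: c rule: inc_induct)
  case base
  have "cyc_inv m (m + 2) = id" by (auto simp: cyc_inv_def fun_eq_iff)
  then show ?case by simp
next
  case (step k)
  have k: "k \<le> Suc m" "k < l + d" using step.hyps assms by auto
  let ?c = "c \<circ> transpose k (Suc k)"
  have c': "?c \<in> J" using perm_tuple_colour_tuples[OF step.prems k(2)] by (simp add: perm_tuple_transpose)
  have C: "chain m (Suc k) \<in> C" "gT k \<in> C"
    using k assms step.prems by (auto intro!: chain_C gens_closed)
  have "chain m (Suc k) * (gT k * ge c) \<approx> chain m (Suc k) * (ge ?c * gT k)"
    by (rule cg_left[OF _ C(1)]) (use T_e_commute[OF step.prems k(2)] in \<open>simp add: perm_tuple_transpose\<close>)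
  also have "\<dots> = (chain m (Suc k) * ge ?c) * gT k" by (simp add: mult.assoc)
  also have "\<dots> \<approx> (ge (?c \<circ> cyc_inv m (Suc k)) * chain m (Suc k)) * gT k"
    by (rule cg_right[OF step.IH[OF c'] C(2)]) simp
  finally show ?case unfolding cyc_inv_step[OF k(1)] chain_step[OF k(1)] by (simp only: mult.assoc comp_assoc)
qed

text \<open>The chain carries strand \<open>k\<close> across all strands up to \<open>m + 2\<close>.
  If strand \<open>k\<close> is red, then on meeting the next red strand \<open>T_red_red\<close>
  applies. These are the summands that the representation cannot detect.\<close>

lemma chain_e_red_crossing:
  assumes "c \<in> J" "1 \<le> k" "k \<le> m + 2" "Suc m < l + d" "c k = 1" "k < i" "i \<le> m + 2" "c i = 1"
  shows "chain m k * ge c \<approx> 0"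
  using assms(3,1,2,5-8)
proof (induction k arbitrary: c rule: inc_induct)
  case base
  then show ?case by simp
next
  case (step k)
  have k: "k \<le> Suc m" "k < l + d" using step.hyps assms by auto
  let ?c = "c \<circ> transpose k (Suc k)"
  have c': "?c \<in> J" using perm_tuple_colour_tuples[OF step.prems(1,2) k(2)] by (simp add: perm_tuple_transpose)
  have C: "chain m (Suc k) \<in> C" "gT k \<in> C"
    using k assms(4) step.prems(2) by (simp_all add: chain_C gens_closed)
  show ?case
  proof (cases "c (Suc k) = 1")
    case True
    have "chain m (Suc k) * (gT k * ge c) \<approx> chain m (Suc k) * 0"
      by (rule cg_left[OF cg_rel[OF T_red_red[OF step.prems(1,2) k(2) step.prems(3)]] C(1)]) (simp add: True)
    then show ?thesis by (simp add: chain_step[OF k(1)] mult.assoc)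
  next
    case False
    then have "i \<noteq> Suc k" using step.prems(6) by blast
    then have i: "Suc k < i" using step.prems(4) by simp
    have c1: "?c (Suc k) = 1" using step.prems(3) by simp
    have c2: "?c i = 1" using step.prems(6) i by (simp add: transpose_def)
    have "chain m (Suc k) * (gT k * ge c) \<approx> chain m (Suc k) * (ge ?c * gT k)"
      by (rule cg_left[OF _ C(1)]) (use T_e_commute[OF step.prems(1,2) k(2)] in \<open>simp add: perm_tuple_transpose\<close>)
    also have "\<dots> = (chain m (Suc k) * ge ?c) * gT k" by (simp add: mult.assoc)
    also have "\<dots> \<approx> 0 * gT k"
      by (rule cg_right[OF step.IH[OF c' _ c1 i step.prems(5) c2] C(2)]) simp
    finally show ?thesis by (simp add: chain_step[OF k(1)] mult.assoc)
  qed
qed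

text \<open>Elements of \<open>R m\<close> permute only the first \<open>m + 1\<close> coordinates.
  Coordinate \<open>m + 2\<close> keeps its value throughout, so a test function may be tailored to
  it.\<close>

lemma R_act_local:
  assumes "a \<in> R m" "\<And>w. w permutes {1..Suc m} \<Longrightarrow> F (u \<circ> w) = G (u \<circ> w)"
  shows "act a F u = act a G u"
  using assms
proof (induction arbitrary: F G u rule: R.induct)
  case (R_T r)
  show ?case unfolding act_var
  proof (rule gen_act_local[where A = "{1..Suc m}"])
    show "F (u \<circ> w) = G (u \<circ> w)" if "w permutes {1..Suc m}" for w by (rule R_T.prems[OF that])
  qed (use R_T.hyps in auto)
next
  case (R_mult a b)
  show ?case unfolding act_mult
  proof (rule R_mult.IH(1))
    fix w assume w: "w permutes {1..Suc m}"
    show "act b F (u \<circ> w) = act b G (u \<circ> w)"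
    proof (rule R_mult.IH(2))
      fix w' assume "w' permutes {1..Suc m}"
      then show "F (u \<circ> w \<circ> w') = G (u \<circ> w \<circ> w')"
        unfolding comp_assoc by (intro R_mult.prems permutes_compose[OF _ w])
    qed
  qed
next
  case (R_const x)
  have "F u = G u" using R_const.prems[OF permutes_id] by (simp add: comp_def)
  then show ?case by simp
next
  case (R_e c)
  have "F u = G u" using R_e.prems[OF permutes_id] by (simp add: comp_def)
  then show ?case by (simp add: proj_def)
next
  case (R_X i)
  have "F u = G u" using R_X.prems[OF permutes_id] by (simp add: comp_def)
  then show ?case by simp
next
  case (R_X' i)
  have "F u = G u" using R_X'.prems[OF permutes_id] by (simp add: comp_def)
  then show ?case by simp
next
  case (R_add a b)
  show ?case unfolding act_add
    by (rule arg_cong2[of _ _ _ _ "(+)", OF R_add.IH(1) R_add.IH(2)]) (rule R_add.prems, assumption)+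
qed

lemma vanishing_cong: "a \<approx> b \<Longrightarrow> vanishing a \<Longrightarrow> vanishing b"
  using I_vanishing[of "a - b"] by (simp add: cg_def vanishing_def)

text \<open>The test function \<open>F\<close> sees \<open>t\<close> at position \<open>K\<close>
  only. A chain with \<open>k > K\<close> would need \<open>t\<close> at position \<open>k\<close>,
  off the support, so the first summand alone survives.\<close>

lemma vanishing_leading_term:
  assumes m: "Suc m < l + d" and K: "1 \<le> K" "K \<le> m + 2" and c: "c \<in> J"
    and a: "\<And>k. a k \<in> R m"
    and van: "vanishing (\<Sum>k = K..m + 2. a k * chain m k * ge c)"
    and good: "\<And>i. c K = 1 \<Longrightarrow> K < i \<Longrightarrow> i \<le> m + 2 \<Longrightarrow> c i \<noteq> 1"
  shows "vanishing (a K * ge (c \<circ> cyc_inv m K))"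
  unfolding vanishing_def
proof (intro allI impI)
  fix G u assume u: "state u"
  let ?c = "c \<circ> cyc_inv m K"
  define t where "t = u (m + 2)"
  \<comment> \<open>Dividing by \<open>lead\<close> compensates the factor from
    \<open>act_chain\<close>; after that the chain turns \<open>F\<close> into the arbitrary
    function \<open>G\<close>, restricted to one colour.\<close>
  define F where "F y = (if y K = t \<and> (\<forall>i. K < i \<and> i \<le> m + 2 \<longrightarrow> y i \<noteq> t) \<and> colour y = c
    then G (y \<circ> cyc_inv m K) / lead m K (y \<circ> cyc_inv m K) else 0)" for y
  have projF: "proj c F = F" by (auto simp: fun_eq_iff proj_def F_def)
  have chainF: "act (chain m k) F v = lead m k v * F (v \<circ> cyc m k)"
    if "K \<le> k" "k \<le> m + 2" "v (m + 2) = t" for k v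
    by (rule act_chain[where t = t]) (use that in \<open>auto simp: F_def split: if_splits\<close>)
  have vt: "(u \<circ> w) (m + 2) = t" if "w permutes {1..Suc m}" for w
    using permutes_not_in[OF that, of "m + 2"] by (simp add: t_def)
  have vstate: "state (u \<circ> w)" if "w permutes {1..Suc m}" for w
    by (rule state_comp[OF u permutes_subset[OF that]]) (use m in auto)
  have high: "act (a k) (act (chain m k) F) u = 0" if k: "k \<in> {K<..m + 2}" for k
  proof -
    have "act (a k) (act (chain m k) F) u = act (a k) (\<lambda>_. 0) u"
    proof (rule R_act_local[OF a])
      fix w assume w: "w permutes {1..Suc m}"
      have "(u \<circ> w \<circ> cyc m k) k = t" using vt[OF w] by (simp add: cyc_def)
      then have "F (u \<circ> w \<circ> cyc m k) = 0" using k by (auto simp: F_def)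
      then show "act (chain m k) F (u \<circ> w) = 0" using chainF[of k "u \<circ> w"] vt[OF w] k by simp
    qed
    then show ?thesis by simp
  qed
  have low: "act (a K) (act (chain m K) F) u = act (a K) (proj ?c G) u"
  proof (rule R_act_local[OF a])
    fix w assume w: "w permutes {1..Suc m}"
    let ?v = "u \<circ> w"
    let ?y = "?v \<circ> cyc m K"
    have yv: "?y \<circ> cyc_inv m K = ?v" using cyc_inverse(1)[OF K(2)] by (simp add: comp_assoc)
    have yK: "?y K = t" using vt[OF w] by (simp add: cyc_def)
    have cp: "cyc m K permutes {1..l + d}" by (rule cyc_permutes) (use K m in auto)
    have ystate: "state ?y" by (rule state_comp[OF vstate[OF w] cp])
    have col: "colour ?y = c \<longleftrightarrow> colour ?v = ?c"
    proof -
      have "colour ?y = colour ?v \<circ> cyc m K" by (rule colour_comp[OF cp])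
      moreover have "x \<circ> cyc m K = c \<longleftrightarrow> x = c \<circ> cyc_inv m K" for x
      proof
        assume a: "x \<circ> cyc m K = c"
        have "c \<circ> cyc_inv m K = x \<circ> (cyc m K \<circ> cyc_inv m K)"
          unfolding a[symmetric] by (rule comp_assoc)
        then show "x = c \<circ> cyc_inv m K" unfolding cyc_inverse(1)[OF K(2)] by simp
      next
        assume a: "x = c \<circ> cyc_inv m K"
        have "x \<circ> cyc m K = c \<circ> (cyc_inv m K \<circ> cyc m K)" unfolding a by (rule comp_assoc)
        then show "x \<circ> cyc m K = c" unfolding cyc_inverse(2)[OF K(2)] by simp
      qed
      ultimately show ?thesis by simp
    qed
    have "lead m K ?v * F ?y = proj ?c G ?v"
    proof (cases "colour ?v = ?c")
      case False
      then show ?thesis using col by (simp add: F_def proj_def)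
    next
      case True
      then have yc: "colour ?y = c" using col by blast
      have Kmem: "K \<in> {1..l + d}" using K m by simp
      have imem: "i \<in> {1..l + d}" if "K < i" "i \<le> m + 2" for i using that m by simp
      \<comment> \<open>A nonzero value occurs only once in a state. The value 0 may recur, and
        excluding that to the right of \<open>K\<close> is the purpose of
        \<open>good\<close>.\<close>
      have avoid: "?y i \<noteq> t" if i: "K < i" "i \<le> m + 2" for i
      proof (cases "t = 0")
        case t0: True
        have "colour ?y K = 1" using colour_eq_iff(2)[OF Kmem] yK t0 by blast
        then have "colour ?y i \<noteq> 1" using good[of i] i unfolding yc by blast
        then have "?y i \<noteq> 0" using colour_eq_iff(2)[OF imem[OF i]] by blast
        then show ?thesis unfolding t0 .
      next
        case False
        have "?y K \<noteq> ?y i"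
          by (rule state_distinct(1)[OF ystate Kmem imem[OF i]]) (use i False in \<open>simp_all only: yK\<close>, simp)
        then show ?thesis unfolding yK by (rule not_sym)
      qed
      have "lead m K ?v \<noteq> 0"
      proof (rule lead_nonzero[OF vstate[OF w] K(1) m])
        fix i assume i: "K \<le> i" "i \<le> Suc m"
        have "?y (Suc i) = ?v i" using i by (simp add: cyc_def)
        then show "?v (m + 2) \<noteq> 0 \<or> ?v i \<noteq> 0" using avoid[of "Suc i"] i vt[OF w] by auto
      qed
      moreover have "F ?y = G ?v / lead m K ?v"
        using yK yc avoid yv by (simp add: F_def)
      ultimately show ?thesis using True by (simp add: proj_def)
    qed
    then show "act (chain m K) F ?v = proj ?c G ?v"
      using chainF[of K ?v] vt[OF w] K by simp
  qed
  have "0 = act (\<Sum>k = K..m + 2. a k * chain m k * ge c) F u"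
    using vanishingD[OF van u] by simp
  also have "\<dots> = (\<Sum>k = K..m + 2. act (a k) (act (chain m k) F) u)"
    unfolding act_sum by (simp add: act_mult projF)
  also have "\<dots> = act (a K) (act (chain m K) F) u + (\<Sum>k\<in>{K<..m + 2}. act (a k) (act (chain m k) F) u)"
    by (rule sum.head[OF K(2)])
  also have "(\<Sum>k\<in>{K<..m + 2}. act (a k) (act (chain m k) F) u) = 0"
    by (rule sum.neutral) (use high in blast)
  finally have "act (a K) (act (chain m K) F) u = 0" by simp
  then show "act (a K * ge ?c) G u = 0" unfolding act_mult act_var gen_act.simps low .
qed

text \<open>Induction along the filtration, one colour at a time: the leading coefficient is a
  vanishing element of the smaller subalgebra, hence in the ideal.\<close>

lemma faithful_R:
  assumes "m \<le> l + d - 1" "a \<in> R m" "vanishing a" shows "a \<in> I"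
  using assms
proof (induction m arbitrary: a)
  case 0 then show ?case using faithful_R0 by blast
next
  case (Suc m)
  have m: "Suc m < l + d" using Suc.prems(1) by simp
  have aC: "a \<in> C" by (rule R_in_C[OF Suc.prems(2)])
  obtain b where b: "\<And>k. b k \<in> R m" "a \<approx> (\<Sum>k = 1..m + 2. b k * chain m k)"
    using R_Suc_decompose[OF Suc.prems(2) m] by (auto simp: N_def)
  have main: "a * ge c \<approx> 0" if c: "c \<in> J" for c
  proof -
    have ec: "ge c \<in> C" by (rule e_C[OF c])
    have bC: "b k \<in> C" for k by (rule R_in_C[OF b(1)])
    let ?t = "\<lambda>k. b k * chain m k * ge c"
    have ae: "a * ge c \<approx> (\<Sum>k = 1..m + 2. ?t k)"
      using cg_right[OF b(2) ec] unfolding sum_distrib_right .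
    then have van: "vanishing (\<Sum>k = 1..m + 2. ?t k)"
      by (rule vanishing_cong[OF _ vanishing_mult_right[OF Suc.prems(3)]])
    \<comment> \<open>Terms below \<open>K\<close> already lie in the ideal and can be subtracted,
      which makes \<open>K\<close> the leading index.\<close>
    have terms: "?t K \<in> I" if "K \<in> {1..m + 2}" for K
      using that
    proof (induction K rule: less_induct)
      case (less K)
      have K: "1 \<le> K" "K \<le> m + 2" using less.prems by auto
      have chC: "chain m K \<in> C" by (rule chain_C[OF K(1) m])
      have split: "(\<Sum>k = 1..m + 2. ?t k) = (\<Sum>k\<in>{1..<K}. ?t k) + (\<Sum>k = K..m + 2. ?t k)"
      proof -
        have "{1..m + 2} = {1..<K} \<union> {K..m + 2}" using K by auto
        then show ?thesis by (simp only:) (rule sum.union_disjoint; auto)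
      qed
      have "(\<Sum>k\<in>{1..<K}. ?t k) \<in> I"
        by (rule I_sum, rule less.IH) (use K in auto)
      then have "(\<Sum>k = 1..m + 2. ?t k) \<approx> (\<Sum>k = K..m + 2. ?t k)"
        unfolding cg_def split by (simp only: add_diff_cancel_right')
      then have vanK: "vanishing (\<Sum>k = K..m + 2. ?t k)" by (rule vanishing_cong[OF _ van])
      show ?case
      \<comment> \<open>If strand \<open>K\<close> is red and crosses another red strand,
        \<open>lead\<close> is zero and tests see nothing, but the term itself lies in the
        ideal.\<close>
      proof (cases "c K = 1 \<and> (\<exists>i. K < i \<and> i \<le> m + 2 \<and> c i = 1)")
        case True
        then obtain i where "c K = 1" "K < i" "i \<le> m + 2" "c i = 1" by blast
        then have "b K * (chain m K * ge c) \<approx> b K * 0"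
          by (intro cg_left[OF chain_e_red_crossing bC] c K m)
        then show ?thesis by (simp add: cg_zero_iff mult.assoc)
      next
        case False
        have c': "c \<circ> cyc_inv m K \<in> J"
          by (rule colour_tuples_comp[OF c cyc_permutes(2)]) (use K m in auto)
        have "vanishing (b K * ge (c \<circ> cyc_inv m K))"
          by (rule vanishing_leading_term[OF m K c b(1) vanK]) (use False in blast)
        moreover have "b K * ge (c \<circ> cyc_inv m K) \<in> R m" by (intro R_mult R_e b(1) c')
        ultimately have "b K * ge (c \<circ> cyc_inv m K) \<in> I"
          using Suc.IH m by simp
        then have "b K * ge (c \<circ> cyc_inv m K) * chain m K \<approx> 0"
          unfolding cg_zero_iff by (rule I_closed(5)[OF _ chC])
        then have "b K * (ge (c \<circ> cyc_inv m K) * chain m K) \<approx> 0" by (simp only: mult.assoc)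
        from cg_trans[OF cg_left[OF chain_e[OF c K m] bC] this]
        show ?thesis by (simp only: cg_zero_iff mult.assoc)
      qed
    qed
    have "(\<Sum>k = 1..m + 2. ?t k) \<approx> 0" unfolding cg_zero_iff by (rule I_sum[OF terms])
    then show ?thesis by (rule cg_trans[OF ae])
  qed
  have "(\<Sum>c\<in>J. a * ge c) \<approx> (\<Sum>c\<in>J. 0)" by (rule cg_sum[OF main])
  from cg_trans[OF cg_sym[OF cg_sum_e[OF aC]] this] show ?case by (simp add: cg_zero_iff)
qed

lemma faithful:
  assumes "a \<in> C" shows "a \<in> I \<longleftrightarrow> vanishing a"
  using faithful_R[OF order_refl C_in_R[OF assms]] I_vanishing by blast

end

section \<open>The centre\<close>

context hecke_parameters
begin

abbreviation H :: "'k hecke_poly set ring" where "H \<equiv> hecke_algebra l d q Q"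
abbreviation cls :: "'k hecke_poly \<Rightarrow> 'k hecke_poly set" where
  "cls \<equiv> hecke_class l d q Q"

lemma ring_H: "ring H"
  unfolding hecke_algebra_def by (rule ideal.quotient_is_ring[OF ideal_I])

lemma cls_hom: "cls \<in> ring_hom (hecke_free l d) H"
  unfolding hecke_class_def[abs_def] hecke_algebra_def by (rule ideal.rcos_ring_hom[OF ideal_I])

lemma cls_closed: "a \<in> C \<Longrightarrow> cls a \<in> carrier H"
  using ring_hom_closed[OF cls_hom] .

lemma cls_mult: "a \<in> C \<Longrightarrow> b \<in> C \<Longrightarrow> cls a \<otimes>\<^bsub>H\<^esub> cls b = cls (a * b)"
  using ring_hom_mult[OF cls_hom] by simp

lemma cls_add: "a \<in> C \<Longrightarrow> b \<in> C \<Longrightarrow> cls a \<oplus>\<^bsub>H\<^esub> cls b = cls (a + b)"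
  using ring_hom_add[OF cls_hom] by simp

lemma cls_one: "\<one>\<^bsub>H\<^esub> = cls 1"
  using ring_hom_one[OF cls_hom] by simp

lemma cls_zero: "\<zero>\<^bsub>H\<^esub> = cls 0"
  using ring_hom_zero[OF cls_hom ring_free_algebra ring_H] by simp

lemma carrier_H: "A \<in> carrier H \<Longrightarrow> \<exists>a\<in>C. A = cls a"
  unfolding hecke_algebra_def hecke_class_def by (auto simp: FactRing_def A_RCOSETS_def')

lemma cls_eq_iff:
  assumes "a \<in> C" "b \<in> C" shows "cls a = cls b \<longleftrightarrow> vanishing (a - b)"
proof -
  interpret ring "hecke_free l d :: 'k hecke_poly ring" by (rule ring_free_algebra)
  have "a \<ominus>\<^bsub>hecke_free l d\<^esub> b = a - b"
    using assms free_algebra_a_inv[of b] by (simp add: a_minus_def)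
  then show ?thesis
    using quotient_eq_iff_same_a_r_cos[OF ideal_I assms] faithful[OF C_closed(5)[OF assms]]
    by (simp add: hecke_class_def)
qed

text \<open>A calculus for the commutative part of the quotient. By faithfulness such a class is
  determined by its multiplier on states, so products, sums, powers and inverses can be computed
  pointwise.\<close>

definition acts_by :: "'k hecke_poly set \<Rightarrow> ((nat \<Rightarrow> 'k) \<Rightarrow> 'k) \<Rightarrow> bool" where
  "acts_by A \<zeta> \<longleftrightarrow> (\<exists>a\<in>C. A = cls a \<and> (\<forall>F u. state u \<longrightarrow> act a F u = \<zeta> u * F u))"

lemma acts_by_cls: "a \<in> C \<Longrightarrow> (\<And>F u. state u \<Longrightarrow> act a F u = \<zeta> u * F u) \<Longrightarrow> acts_by (cls a) \<zeta>"
  by (auto simp: acts_by_def)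

lemma acts_by_carrier: "acts_by A \<zeta> \<Longrightarrow> A \<in> carrier H"
  by (auto simp: acts_by_def cls_closed)

lemma acts_by_unique:
  assumes "acts_by A \<zeta>" "acts_by B \<eta>"
  shows "A = B \<longleftrightarrow> (\<forall>u. state u \<longrightarrow> \<zeta> u = \<eta> u)"
proof -
  obtain a where a: "a \<in> C" "A = cls a" "\<And>F u. state u \<Longrightarrow> act a F u = \<zeta> u * F u"
    using assms(1) by (auto simp: acts_by_def)
  obtain b where b: "b \<in> C" "B = cls b" "\<And>F u. state u \<Longrightarrow> act b F u = \<eta> u * F u"
    using assms(2) by (auto simp: acts_by_def)
  have "A = B \<longleftrightarrow> (\<forall>F u. state u \<longrightarrow> (\<zeta> u - \<eta> u) * F u = 0)"
    unfolding a(2) b(2) cls_eq_iff[OF a(1) b(1)] vanishing_def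
    by (simp add: a(3) b(3) left_diff_distrib)
  also have "\<dots> \<longleftrightarrow> (\<forall>u. state u \<longrightarrow> \<zeta> u = \<eta> u)"
  proof
    assume *: "\<forall>F u. state u \<longrightarrow> (\<zeta> u - \<eta> u) * F u = 0"
    show "\<forall>u. state u \<longrightarrow> \<zeta> u = \<eta> u" using *[rule_format, of _ "\<lambda>_. 1"] by simp
  qed simp
  finally show ?thesis .
qed

lemma acts_by_cong: "acts_by A \<zeta> \<Longrightarrow> (\<And>u. state u \<Longrightarrow> \<zeta> u = \<eta> u) \<Longrightarrow> acts_by A \<eta>"
  by (auto simp: acts_by_def)

lemma acts_by_mult: "acts_by A \<zeta> \<Longrightarrow> acts_by B \<eta> \<Longrightarrow> acts_by (A \<otimes>\<^bsub>H\<^esub> B) (\<lambda>u. \<zeta> u * \<eta> u)"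
  unfolding acts_by_def
  by (elim bexE conjE, rule_tac x = "a * aa" in bexI) (simp_all add: cls_mult act_mult C_closed mult.assoc)

lemma acts_by_add: "acts_by A \<zeta> \<Longrightarrow> acts_by B \<eta> \<Longrightarrow> acts_by (A \<oplus>\<^bsub>H\<^esub> B) (\<lambda>u. \<zeta> u + \<eta> u)"
  unfolding acts_by_def
  by (elim bexE conjE, rule_tac x = "a + aa" in bexI) (simp_all add: cls_add C_closed distrib_right)

lemma acts_by_one: "acts_by \<one>\<^bsub>H\<^esub> (\<lambda>_. 1)"
  unfolding cls_one by (rule acts_by_cls) (simp_all add: C_closed)

lemma acts_by_zero: "acts_by \<zero>\<^bsub>H\<^esub> (\<lambda>_. 0)"
  unfolding cls_zero by (rule acts_by_cls) (simp_all add: C_closed)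

lemma acts_by_const: "acts_by (cls (nc_const x)) (\<lambda>_. x)"
  by (rule acts_by_cls) (simp_all add: C_closed)

lemma acts_by_e: "c \<in> J \<Longrightarrow> acts_by (cls (ge c)) (\<lambda>u. if colour u = c then 1 else 0)"
  by (rule acts_by_cls) (simp_all add: e_C proj_def)

lemma acts_by_finsum:
  assumes "finite S" "\<And>i. i \<in> S \<Longrightarrow> acts_by (A i) (\<zeta> i)"
  shows "acts_by (\<Oplus>\<^bsub>H\<^esub> i \<in> S. A i) (\<lambda>u. \<Sum>i\<in>S. \<zeta> i u)"
  using assms
proof (induction S rule: finite_induct)
  interpret ring H by (rule ring_H)
  case empty
  then show ?case by (simp add: acts_by_zero)
next
  interpret ring H by (rule ring_H)
  case (insert i S)
  have "A i \<in> carrier H" "A \<in> S \<rightarrow> carrier H"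
    using insert.prems acts_by_carrier by auto
  then show ?case
    using insert acts_by_add[of "A i" "\<zeta> i"] by (simp add: finsum_insert)
qed

lemma acts_by_pow: "acts_by A \<zeta> \<Longrightarrow> acts_by (A [^]\<^bsub>H\<^esub> (n::nat)) (\<lambda>u. \<zeta> u ^ n)"
proof (induction n)
  case 0 then show ?case by (simp add: acts_by_one)
next
  case (Suc n)
  then show ?case using acts_by_mult[of "A [^]\<^bsub>H\<^esub> n" "\<lambda>u. \<zeta> u ^ n" A \<zeta>] by (simp add: mult.commute)
qed

lemma acts_by_inverse:
  assumes "acts_by A \<zeta>" "acts_by B (\<lambda>u. inverse (\<zeta> u))" "\<And>u. state u \<Longrightarrow> \<zeta> u \<noteq> 0"
  shows "inv\<^bsub>H\<^esub> A = B"
proof -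
  interpret ring H by (rule ring_H)
  have "A \<otimes>\<^bsub>H\<^esub> B = \<one>\<^bsub>H\<^esub>" "B \<otimes>\<^bsub>H\<^esub> A = \<one>\<^bsub>H\<^esub>"
    using acts_by_unique[OF acts_by_mult[OF assms(1,2)] acts_by_one]
      acts_by_unique[OF acts_by_mult[OF assms(2,1)] acts_by_one] assms(3) by simp_all
  then show ?thesis
    by (rule inv_char[OF acts_by_carrier[OF assms(1)] acts_by_carrier[OF assms(2)]])
qed

text \<open>A negative power refers to the inverse in the ring, so a class acting by the reciprocal
  has to be exhibited; this is \<open>B\<close>.\<close>

lemma acts_by_int_pow:
  assumes "acts_by A \<zeta>" "acts_by B (\<lambda>u. inverse (\<zeta> u))" "\<And>u. state u \<Longrightarrow> \<zeta> u \<noteq> 0"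
  shows "acts_by (A [^]\<^bsub>H\<^esub> (e::int)) (\<lambda>u. \<zeta> u powi e)"
proof (cases "e < 0")
  case True
  have B: "acts_by (B [^]\<^bsub>H\<^esub> nat (- e)) (\<lambda>u. inverse (\<zeta> u) ^ nat (- e))"
    by (rule acts_by_pow[OF assms(2)])
  have "inv\<^bsub>H\<^esub> (A [^]\<^bsub>H\<^esub> nat (- e)) = B [^]\<^bsub>H\<^esub> nat (- e)"
    by (rule acts_by_inverse[OF acts_by_pow[OF assms(1)] B[unfolded power_inverse]]) (simp add: assms(3))
  moreover have "A [^]\<^bsub>H\<^esub> e = inv\<^bsub>H\<^esub> (A [^]\<^bsub>H\<^esub> nat (- e))"
    unfolding int_pow_def2 using True by (rule if_P)
  moreover have "\<zeta> u powi e = inverse (\<zeta> u) ^ nat (- e)" for u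
    using True by (simp add: power_int_def)
  ultimately show ?thesis using B by simp
next
  case False
  have "A [^]\<^bsub>H\<^esub> e = A [^]\<^bsub>H\<^esub> nat e"
    unfolding int_pow_def2 using False by (rule if_not_P)
  moreover have "\<zeta> u powi e = \<zeta> u ^ nat e" for u
    using False by (simp add: power_int_def)
  ultimately show ?thesis using acts_by_pow[OF assms(1), of "nat e"] by simp
qed

lemma acts_by_sum_e:
  assumes "\<And>c. c \<in> J \<Longrightarrow> acts_by (A c) (\<zeta> c)"
    and "\<And>c u. c \<in> J \<Longrightarrow> state u \<Longrightarrow> colour u \<noteq> c \<Longrightarrow> \<zeta> c u = 0"
  shows "acts_by (\<Oplus>\<^bsub>H\<^esub> c \<in> J. A c) (\<lambda>u. \<zeta> (colour u) u)"
proof (rule acts_by_cong[OF acts_by_finsum[OF finite_colour_tuples assms(1)]])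
  fix u assume u: "state u"
  have "(\<Sum>c\<in>J. \<zeta> c u) = (\<Sum>c\<in>J. if c = colour u then \<zeta> (colour u) u else 0)"
    by (rule sum.cong) (use assms(2)[OF _ u] in auto)
  then show "(\<Sum>c\<in>J. \<zeta> c u) = \<zeta> (colour u) u"
    using colour_in_J[OF u] finite_colour_tuples by simp
qed

text \<open>The second sum, built from \<open>X'\<close>, is the inverse of \<open>x_r\<close> that
  \<open>acts_by_int_pow\<close> requires.\<close>

lemma acts_by_x:
  assumes "r \<in> {1..d}"
  shows "acts_by (hecke_x l d q Q r) (\<lambda>u. blacks u r)"
    and "acts_by (\<Oplus>\<^bsub>H\<^esub> c \<in> J. cls (gX' (bp c r) * ge c)) (\<lambda>u. inverse (blacks u r))"
proof -
  have mem: "bp c r \<in> {1..l + d}" if "c \<in> J" for c by (rule black_pos_mem(1)[OF that assms])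
  have "acts_by (\<Oplus>\<^bsub>H\<^esub> c \<in> J. cls (gX (bp c r) * ge c))
      (\<lambda>u. (\<lambda>c u. u (bp c r) * (if colour u = c then 1 else 0)) (colour u) u)"
    by (rule acts_by_sum_e, rule acts_by_cls) (use mem in \<open>simp_all add: C_closed gens_closed act_mult proj_def\<close>)
  then show "acts_by (hecke_x l d q Q r) (\<lambda>u. blacks u r)"
    by (simp add: hecke_x_def blacks_def)
  have "acts_by (\<Oplus>\<^bsub>H\<^esub> c \<in> J. cls (gX' (bp c r) * ge c))
      (\<lambda>u. (\<lambda>c u. inverse (u (bp c r)) * (if colour u = c then 1 else 0)) (colour u) u)"
    by (rule acts_by_sum_e, rule acts_by_cls) (use mem in \<open>simp_all add: C_closed gens_closed act_mult proj_def\<close>)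
  then show "acts_by (\<Oplus>\<^bsub>H\<^esub> c \<in> J. cls (gX' (bp c r) * ge c)) (\<lambda>u. inverse (blacks u r))"
    by (simp add: blacks_def)
qed

lemma acts_by_eval:
  assumes "f \<in> laurent_polys d"
  shows "acts_by (hecke_eval l d q Q f) (\<lambda>u. laurent_eval f (blacks u))"
proof -
  have fold: "acts_by (foldr (\<lambda>r y. (hecke_x l d q Q r [^]\<^bsub>H\<^esub> lookup m r) \<otimes>\<^bsub>H\<^esub> y) rs \<one>\<^bsub>H\<^esub>)
      (\<lambda>u. \<Prod>r\<leftarrow>rs. blacks u r powi lookup m r)" if "set rs \<subseteq> {1..d}" for rs and m :: "nat \<Rightarrow>\<^sub>0 int"
    using that
  proof (induction rs)
    case Nil then show ?case by (simp add: acts_by_one)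
  next
    case (Cons r rs)
    then have r: "r \<in> {1..d}" by simp
    show ?case
      using acts_by_mult[OF acts_by_int_pow[OF acts_by_x[OF r] blacks_nonzero[OF _ r]] Cons.IH] Cons.prems
      by simp
  qed
  have mono: "(\<Prod>r\<leftarrow>[1..<d + 1]. p r powi lookup m r) = mono_eval m p"
    if "m \<in> keys f" for m and p :: "nat \<Rightarrow> 'k"
  proof -
    have "(\<Prod>r\<leftarrow>[1..<d + 1]. p r powi lookup m r) = (\<Prod>r\<in>set [1..<d + 1]. p r powi lookup m r)"
      by (rule prod.distinct_set_conv_list[symmetric]) simp
    also have "set [1..<d + 1] = {1..d}" by auto
    also have "(\<Prod>r\<in>{1..d}. p r powi lookup m r) = mono_eval m p"
      using assms that by (intro mono_eval_superset[symmetric]) (auto simp: laurent_polys_def)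
    finally show ?thesis .
  qed
  have "acts_by (hecke_eval l d q Q f)
      (\<lambda>u. \<Sum>m\<in>keys f. lookup f m * (\<Prod>r\<leftarrow>[1..<d + 1]. blacks u r powi lookup m r))"
    unfolding hecke_eval_def Let_def
    by (intro acts_by_finsum acts_by_mult acts_by_const fold finite_keys) auto
  then show ?thesis
    by (rule acts_by_cong) (unfold laurent_eval_def, rule sum.cong[OF refl], simp only: mono)
qed

lemma acts_by_embed:
  assumes "F \<in> P_alg l d"
  shows "acts_by (hecke_embed l d q Q F) (\<lambda>u. laurent_eval (F (colour u)) (blacks u))"
proof -
  have "acts_by (hecke_embed l d q Q F)
      (\<lambda>u. (\<lambda>c u. laurent_eval (F c) (blacks u) * (if colour u = c then 1 else 0)) (colour u) u)"
    unfolding hecke_embed_def Let_def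
    by (rule acts_by_sum_e, intro acts_by_mult acts_by_eval acts_by_e)
      (use assms in \<open>auto simp: P_alg_def\<close>)
  then show ?thesis by simp
qed

lemma hecke_embed_inj: "inj_on (hecke_embed l d q Q) (P_alg l d)"
proof (rule inj_onI)
  fix F G :: "(nat \<Rightarrow> nat) \<Rightarrow> 'k laurent"
  assume F: "F \<in> P_alg l d" and G: "G \<in> P_alg l d" and eq: "hecke_embed l d q Q F = hecke_embed l d q Q G"
  have eq': "laurent_eval (F (colour u)) (blacks u) = laurent_eval (G (colour u)) (blacks u)" if "state u" for u
    using acts_by_unique[OF acts_by_embed[OF F] acts_by_embed[OF G]] eq that by simp
  show "F = G"
  proof
    fix c show "F c = G c"
    proof (cases "c \<in> J")
      case True
      show ?thesis
        by (rule laurent_eval_states_inject[OF True]) (use F G True eq' in \<open>auto simp: P_alg_def\<close>)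
    next
      case False
      then show ?thesis using F G by (simp add: P_alg_def)
    qed
  qed
qed

section \<open>The action of the symmetric group seen on states\<close>

lemma blacks_comp:
  assumes "state u" "w permutes {1..l + d}"
  shows "blacks (u \<circ> w) r = u (w (bp (colour u \<circ> w) r))"
  using colour_comp[OF assms(2), of u] by (simp add: blacks_def)

lemma colour_comp_in_J:
  assumes "w permutes {1..l + d}" shows "c \<circ> w \<in> J \<longleftrightarrow> c \<in> J"
proof
  assume "c \<circ> w \<in> J"
  then have "c \<circ> w \<circ> Hilbert_Choice.inv w \<in> J" by (rule colour_tuples_comp[OF _ permutes_inv[OF assms]])
  then show "c \<in> J" using permutes_inv_o(1)[OF assms] by (simp add: comp_assoc)
qed (rule colour_tuples_comp[OF _ assms])

text \<open>The action of \<open>w\<close> on Laurent polynomials corresponds to precomposition with \<open>w\<close> on states.\<close>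

lemma P_action_in_P_alg:
  assumes F: "F \<in> P_alg l d" and w: "w permutes {1..l + d}"
  shows "P_action l d w F \<in> P_alg l d"
    and "state u \<Longrightarrow> laurent_eval (P_action l d w F (colour u)) (blacks u) =
      laurent_eval (F (colour (u \<circ> w))) (blacks (u \<circ> w))"
proof -
  \<comment> \<open>\<open>perm_tuple\<close> inverts its argument once more, so the two inverses
    cancel.\<close>
  have pt: "perm_tuple (Hilbert_Choice.inv w) c = c \<circ> w" for c
    using permutes_inv_inv[OF w] by (simp add: perm_tuple_def fun_eq_iff)
  have act: "P_action l d w F c = laurent_rename (black_index c) (laurent_rename w (laurent_rename (bp (c \<circ> w)) (F (c \<circ> w))))" for c
    by (simp add: P_action_def pt Let_def)
  let ?B = "\<lambda>c. {j \<in> {1..l + d}. c j = 0}"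
  have maps: "bp (c \<circ> w) ` {1..d} \<subseteq> ?B (c \<circ> w)" "w ` ?B (c \<circ> w) \<subseteq> ?B c" "black_index c ` ?B c \<subseteq> {1..d}"
    if c: "c \<in> J" for c
  proof -
    have c': "c \<circ> w \<in> J" using c colour_comp_in_J[OF w] by blast
    show "bp (c \<circ> w) ` {1..d} \<subseteq> ?B (c \<circ> w)" 
    proof (rule image_subsetI)
      fix r assume "r \<in> {1..d}"
      from black_pos_mem[OF c' this] show "bp (c \<circ> w) r \<in> ?B (c \<circ> w)" by simp
    qed
    show "w ` ?B (c \<circ> w) \<subseteq> ?B c" using permutes_in_image[OF w] by auto
    show "black_index c ` ?B c \<subseteq> {1..d}"
    proof
      fix x assume "x \<in> black_index c ` ?B c"
      then obtain j where j: "j \<in> {1..l + d}" "c j = 0" "x = black_index c j" by blast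
      then obtain r where "r \<in> {1..d}" "j = bp c r" using black_pos_ex[OF c] by blast
      then show "x \<in> {1..d}" using j black_index_black_pos[OF c] by simp
    qed
  qed
  have keys1: "keys m \<subseteq> {1..d}" if "m \<in> keys (F c)" "c \<in> J" for c m
    using F that by (auto simp: P_alg_def laurent_polys_def)
  have keys2: "keys m \<subseteq> ?B (c \<circ> w)"
    if "m \<in> keys (laurent_rename (bp (c \<circ> w)) (F (c \<circ> w)))" "c \<in> J" for c m
    by (rule keys_laurent_rename[OF _ maps(1)[OF that(2)] that(1)], rule keys1)
      (use that(2) colour_comp_in_J[OF w] in blast)+
  have keys3: "keys m \<subseteq> ?B c"
    if "m \<in> keys (laurent_rename w (laurent_rename (bp (c \<circ> w)) (F (c \<circ> w))))" "c \<in> J" for c m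
    by (rule keys_laurent_rename[OF _ maps(2)[OF that(2)] that(1)], rule keys2[OF _ that(2)])
  show "P_action l d w F \<in> P_alg l d"
    unfolding P_alg_def mem_Collect_eq
  proof (intro conjI ballI allI impI)
    fix c assume c: "c \<in> J"
    show "P_action l d w F c \<in> laurent_polys d"
      unfolding laurent_polys_def mem_Collect_eq act
      by (intro ballI, rule keys_laurent_rename[OF _ maps(3)[OF c]], rule keys3[OF _ c])
  next
    fix c assume "c \<notin> J"
    then have "F (c \<circ> w) = 0" using F colour_comp_in_J[OF w] by (simp add: P_alg_def)
    then show "P_action l d w F c = 0" by (simp add: act laurent_rename_def)
  qed
  show "laurent_eval (P_action l d w F (colour u)) (blacks u) =
      laurent_eval (F (colour (u \<circ> w))) (blacks (u \<circ> w))" if u: "state u"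
  proof -
    let ?c = "colour u"
    have c: "?c \<in> J" by (rule colour_in_J[OF u])
    have c': "?c \<circ> w \<in> J" using c colour_comp_in_J[OF w] by blast
    have nz: "blacks u (black_index ?c j) \<noteq> 0" if "j \<in> ?B ?c" for j
      using maps(3)[OF c] that blacks_nonzero[OF u] by blast
    have "laurent_eval (P_action l d w F ?c) (blacks u) =
        laurent_eval (laurent_rename w (laurent_rename (bp (?c \<circ> w)) (F (?c \<circ> w)))) (\<lambda>j. blacks u (black_index ?c j))"
      unfolding act by (rule laurent_eval_rename[where A = "?B ?c"]) (use keys3 c nz in blast)+
    also have "\<dots> = laurent_eval (laurent_rename (bp (?c \<circ> w)) (F (?c \<circ> w))) (\<lambda>j. blacks u (black_index ?c (w j)))"
      by (rule laurent_eval_rename[where A = "?B (?c \<circ> w)"]) (use keys2 c nz maps(2)[OF c] in blast)+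
    also have "\<dots> = laurent_eval (F (?c \<circ> w)) (\<lambda>r. blacks u (black_index ?c (w (bp (?c \<circ> w) r))))"
      by (rule laurent_eval_rename[where A = "{1..d}"]) (use keys1 c' nz maps[OF c] in blast)+
    \<comment> \<open>A black position of \<open>?c \<circ> w\<close> is carried by \<open>w\<close>
      to a black position of \<open>?c\<close>; its index there, read in \<open>blacks u\<close>,
      returns the coordinate of \<open>u\<close> at that position.\<close>
    also have "\<dots> = laurent_eval (F (?c \<circ> w)) (blacks (u \<circ> w))"
    proof (rule laurent_eval_cong)
      show "F (?c \<circ> w) \<in> laurent_polys d" using F c' by (simp add: P_alg_def)
      fix r assume r: "r \<in> {1..d}"
      have "w (bp (?c \<circ> w) r) \<in> ?B ?c" using maps(1,2)[OF c] r by blast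
      then obtain s where s: "s \<in> {1..d}" "w (bp (?c \<circ> w) r) = bp ?c s"
        using black_pos_ex[OF c] by blast
      then show "blacks u (black_index ?c (w (bp (?c \<circ> w) r))) = blacks (u \<circ> w) r"
        using black_index_black_pos[OF c s(1)] blacks_comp[OF u w] by (simp add: blacks_def)
    qed
    finally show ?thesis by (simp add: colour_comp[OF w])
  qed
qed

text \<open>From equal values at all states back to equal tuples of Laurent polynomials leads the
  injectivity of the embedding.\<close>

lemma P_invariants_iff:
  assumes F: "F \<in> P_alg l d"
  shows "F \<in> P_invariants l d \<longleftrightarrow> (\<forall>w u. w permutes {1..l + d} \<longrightarrow> state u \<longrightarrow>
    laurent_eval (F (colour (u \<circ> w))) (blacks (u \<circ> w)) = laurent_eval (F (colour u)) (blacks u))"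
proof
  assume "F \<in> P_invariants l d"
  then show "\<forall>w u. w permutes {1..l + d} \<longrightarrow> state u \<longrightarrow>
    laurent_eval (F (colour (u \<circ> w))) (blacks (u \<circ> w)) = laurent_eval (F (colour u)) (blacks u)"
    using P_action_in_P_alg(2)[OF F] by (simp add: P_invariants_def)
next
  assume inv: "\<forall>w u. w permutes {1..l + d} \<longrightarrow> state u \<longrightarrow>
    laurent_eval (F (colour (u \<circ> w))) (blacks (u \<circ> w)) = laurent_eval (F (colour u)) (blacks u)"
  have "P_action l d w F = F" if w: "w permutes {1..l + d}" for w
  proof (rule inj_onD[OF hecke_embed_inj _ P_action_in_P_alg(1)[OF F w] F])
    show "hecke_embed l d q Q (P_action l d w F) = hecke_embed l d q Q F"
      unfolding acts_by_unique[OF acts_by_embed[OF P_action_in_P_alg(1)[OF F w]] acts_by_embed[OF F]]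
      using P_action_in_P_alg(2)[OF F w] inv w by simp
  qed
  then show "F \<in> P_invariants l d" using F by (simp add: P_invariants_def)
qed

section \<open>Central elements and invariant multipliers\<close>

lemma ring_centre_iff:
  assumes "z \<in> C"
  shows "cls z \<in> ring_centre H \<longleftrightarrow> (\<forall>b\<in>C. vanishing (z * b - b * z))"
proof -
  have "cls z \<in> ring_centre H \<longleftrightarrow> (\<forall>b\<in>C. cls z \<otimes>\<^bsub>H\<^esub> cls b = cls b \<otimes>\<^bsub>H\<^esub> cls z)"
    unfolding ring_centre_def using cls_closed[OF assms] cls_closed carrier_H by blast
  also have "\<dots> \<longleftrightarrow> (\<forall>b\<in>C. vanishing (z * b - b * z))"
    by (rule ball_cong[OF refl]) (simp add: cls_mult assms cls_eq_iff C_closed)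
  finally show ?thesis .
qed

text \<open>An invariant multiplier is constant on each orbit. By locality any operator therefore
  treats it as the scalar \<open>\<zeta> u\<close>.\<close>

lemma invariant_central:
  assumes F: "F \<in> P_invariants l d"
  shows "hecke_embed l d q Q F \<in> ring_centre H"
proof -
  have FP: "F \<in> P_alg l d" using F by (simp add: P_invariants_def)
  define \<zeta> where "\<zeta> u = laurent_eval (F (colour u)) (blacks u)" for u
  have inv: "\<zeta> (u \<circ> w) = \<zeta> u" if "w permutes {1..l + d}" "state u" for u w
    using F that unfolding P_invariants_iff[OF FP] \<zeta>_def by blast
  obtain z where z: "z \<in> C" "hecke_embed l d q Q F = cls z" "\<And>G u. state u \<Longrightarrow> act z G u = \<zeta> u * G u"
    using acts_by_embed[OF FP] by (auto simp: acts_by_def \<zeta>_def)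
  have "vanishing (z * b - b * z)" if b: "b \<in> C" for b
    unfolding vanishing_def
  proof (intro allI impI)
    fix G u assume u: "state u"
    have "act b (act z G) u = act b (\<lambda>v. \<zeta> u * G v) u"
    proof (rule act_local[where A = "{1..l + d}"])
      show "r \<in> {1..l + d} \<and> Suc r \<in> {1..l + d}" if "v \<in> keys b" "Gen_T r \<in> set (letters v)" for v r
        by (rule T_letters[OF b that])
      show "act z G (u \<circ> w) = \<zeta> u * G (u \<circ> w)" if "w permutes {1..l + d}" for w
        using z(3)[OF state_comp[OF u that]] inv[OF that u] by simp
    qed
    then show "act (z * b - b * z) G u = 0"
      using z(3)[OF u] by (simp add: act_mult act_fun_scale)
  qed
  then show ?thesis unfolding z(2) ring_centre_iff[OF z(1)] by blast
qed

text \<open>The constant function generates a copy of the Laurent polynomials: it is the polynomial representation.\<close>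

lemma act_one_function:
  assumes "a \<in> R m"
  shows "\<exists>p\<in>R 0. \<forall>u. state u \<longrightarrow> act a (\<lambda>_. 1) u = act p (\<lambda>_. 1) u"
proof -
  let ?one = "\<lambda>_ :: nat \<Rightarrow> 'k. 1 :: 'k"
  \<comment> \<open>Products need the stronger statement: the right factor turns 1 into a Laurent
    function, on which the left factor then acts.\<close>
  have main: "\<exists>p\<in>R 0. \<forall>u. state u \<longrightarrow> act (a * p0) ?one u = act p ?one u" if "p0 \<in> R 0" for p0
    using assms that
  proof (induction arbitrary: p0 rule: R.induct)
    case (R_T r)
    \<comment> \<open>\<open>t\<close> is \<open>T_r\<close> applied to 1. Two black strands give
      \<open>q\<close>, the sum of \<open>dl_fix\<close> and \<open>dl_swap\<close>; the other cases
      are the factors of \<open>T_swap\<close>.\<close>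
    define t where "t = (\<Sum>c\<in>J. (if c r = 0 then (if c (r + 1) = 0 then nc_const q
      else gX r - nc_const (Q (\<Sum>j = 1..r + 1. c j))) else (if c (r + 1) = 0 then 1 else 0)) * ge c)"
    have tR: "t \<in> R 0"
      unfolding t_def using R_T.hyps by (intro R_sum R_mult) (auto intro!: R_closed)
    have t: "op_T r ?one u = act t ?one u" if u: "state u" for u
    proof -
      let ?c = "colour u"
      have "act t ?one u = (\<Sum>c\<in>J. if c = ?c then (if ?c r = 0 then (if ?c (r + 1) = 0 then q
          else u r - Q (\<Sum>j = 1..r + 1. ?c j)) else (if ?c (r + 1) = 0 then 1 else 0)) else 0)"
        unfolding t_def act_sum by (rule sum.cong) (auto simp: act_mult proj_def)
      also have "\<dots> = (if ?c r = 0 then (if ?c (r + 1) = 0 then q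
          else u r - Q (\<Sum>j = 1..r + 1. ?c j)) else (if ?c (r + 1) = 0 then 1 else 0))"
        using colour_in_J[OF u] finite_colour_tuples by simp
      also have "\<dots> = op_T r ?one u"
      proof -
        have mem: "r \<in> {1..l + d}" "Suc r \<in> {1..l + d}" using R_T.hyps by auto
        have s: "(\<Sum>j = 1..r + 1. ?c j) = zeros_upto u (Suc r)" using sum_colour[of "Suc r" u] mem by simp
        have bb: "dl_fix q (u r) (u (Suc r)) + dl_swap q (u r) (u (Suc r)) = q" if "u r \<noteq> 0" "u (Suc r) \<noteq> 0"
        proof -
          have ne: "u (Suc r) - u r \<noteq> 0" using state_distinct(1)[OF u mem(1,2)] that by simp
          have "dl_fix q (u r) (u (Suc r)) + dl_swap q (u r) (u (Suc r)) = q * (u (Suc r) - u r) / (u (Suc r) - u r)"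
            unfolding dl_fix_def dl_swap_def add_divide_distrib[symmetric] by (simp add: algebra_simps)
          then show ?thesis using ne by simp
        qed
        show ?thesis
          unfolding s using colour_eq_iff(1)[OF mem(1), of u] colour_eq_iff(1)[OF mem(2), of u] bb
          by (simp add: op_T_def T_fix_def T_swap_def)
      qed
      finally show ?thesis by simp
    qed
    obtain p p' where p: "p \<in> R 0" "p' \<in> R 0" "gT r * p0 \<approx> p * gT r + p'"
      using T_R0[OF R_T.hyps(1,3) R_T.prems] by (auto simp: TP_def)
    have "act (gT r * p0) ?one u = act (p * t + p') ?one u" if u: "state u" for u
    proof -
      have "act (gT r * p0) ?one u = act p (op_T r ?one) u + act p' ?one u"
        using vanishingD[OF I_vanishing[OF p(3)[unfolded cg_def]] u, of ?one] by (simp add: act_mult)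
      also have "act p (op_T r ?one) u = act p (act t ?one) u"
        by (rule act_cong_state[OF R_in_C[OF p(1)] u t])
      finally show ?thesis by (simp add: act_mult)
    qed
    then show ?case using R_add[OF R_mult[OF p(1) tR] p(2)] by blast
  next
    case (R_add a b)
    obtain p where p: "p \<in> R 0" "\<And>u. state u \<Longrightarrow> act (a * p0) ?one u = act p ?one u"
      using R_add.IH(1)[OF R_add.prems] by blast
    obtain p' where p': "p' \<in> R 0" "\<And>u. state u \<Longrightarrow> act (b * p0) ?one u = act p' ?one u"
      using R_add.IH(2)[OF R_add.prems] by blast
    show ?case
      by (rule bexI[OF _ R.R_add[OF p(1) p'(1)]]) (simp add: distrib_right p(2) p'(2))
  next
    case (R_mult a b)
    obtain p where p: "p \<in> R 0" "\<And>u. state u \<Longrightarrow> act (b * p0) ?one u = act p ?one u"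
      using R_mult.IH(2)[OF R_mult.prems] by blast
    obtain p' where p': "p' \<in> R 0" "\<And>u. state u \<Longrightarrow> act (a * p) ?one u = act p' ?one u"
      using R_mult.IH(1)[OF p(1)] by blast
    have "act (a * b * p0) ?one u = act p' ?one u" if u: "state u" for u
    proof -
      have "act (a * b * p0) ?one u = act a (act (b * p0) ?one) u" by (simp add: act_mult)
      also have "\<dots> = act a (act p ?one) u"
        by (rule act_cong_state[OF R_in_C[OF R_mult.hyps(1)] u p(2)])
      finally show ?thesis using p'(2)[OF u] by (simp add: act_mult)
    qed
    then show ?case using p'(1) by blast
  next
    case (R_const x)
    show ?case by (rule bexI[OF _ R.R_mult[OF R.R_const[where x = x] R_const.prems]]) (intro allI impI refl)
  next
    case (R_e c)
    show ?case by (rule bexI[OF _ R.R_mult[OF R.R_e[OF R_e.hyps] R_e.prems]]) (intro allI impI refl)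
  next
    case (R_X i)
    show ?case by (rule bexI[OF _ R.R_mult[OF R.R_X[OF R_X.hyps] R_X.prems]]) (intro allI impI refl)
  next
    case (R_X' i)
    show ?case by (rule bexI[OF _ R.R_mult[OF R.R_X'[OF R_X'.hyps] R_X'.prems]]) (intro allI impI refl)
  qed
  show ?thesis using main[OF R_1] by simp
qed

text \<open>An operator commuting with multiplication by all coordinates is a multiplication operator,
  since the finitely many points of an orbit are separated by polynomials in the coordinates.\<close>

lemma commuting_with_X_acts_by_multiplication:
  assumes z: "z \<in> C" and comm: "\<And>j. j \<in> {1..l + d} \<Longrightarrow> vanishing (z * gX j - gX j * z)"
    and u: "state u"
  shows "act z G u = act z (\<lambda>_. 1) u * G u"
proof -
  \<comment> \<open>The functions \<open>g\<close> that can be pulled out of \<open>z\<close> at the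
    point \<open>u\<close>. They contain the affine functions of each coordinate and are closed
    under products.\<close>
  define M where "M = {g. \<forall>F. act z (\<lambda>x. g x * F x) u = g u * act z F u}"
  have M_affine: "(\<lambda>x. (x j - \<alpha>) * \<beta>) \<in> M" if j: "j \<in> {1..l + d}" for j \<alpha> \<beta>
  proof -
    have "act z (\<lambda>x. x j * F x) u = u j * act z F u" for F
      using vanishingD[OF comm[OF j] u, of F] by (simp add: act_mult)
    then have "act z (\<lambda>x. x j * (\<beta> * F x) + (- \<alpha> * \<beta>) * F x) u = u j * (\<beta> * act z F u) + (- \<alpha> * \<beta>) * act z F u" for F
      by (simp only: act_linear act_fun_scale)
    then show ?thesis by (simp add: M_def algebra_simps)
  qed
  have M_prod: "(\<lambda>x. \<Prod>i\<in>S. g i x) \<in> M" if "finite S" "\<And>i. i \<in> S \<Longrightarrow> g i \<in> M" for S :: "(nat \<Rightarrow> 'k) set" and g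
    using that
  proof (induction S rule: finite_induct)
    case empty then show ?case by (simp add: M_def)
  next
    case (insert i S)
    then have "g i \<in> M" "(\<lambda>x. \<Prod>i\<in>S. g i x) \<in> M" by simp_all
    then show ?case using insert.hyps by (simp add: M_def mult.assoc)
  qed
  define S where "S = (\<lambda>w. u \<circ> w) ` {w. w permutes {1..l + d}} - {u}"
  have "finite S" by (simp add: S_def finite_permutations)
  have "\<exists>j. j \<in> {1..l + d} \<and> u j \<noteq> y j" if "y \<in> S" for y
  proof (rule ccontr)
    assume *: "\<not> ?thesis"
    obtain w where w: "w permutes {1..l + d}" "y = u \<circ> w" "y \<noteq> u" using \<open>y \<in> S\<close> by (auto simp: S_def)
    have "y j = u j" for j
      using * permutes_not_in[OF w(1), of j] w(2) by (cases "j \<in> {1..l + d}") auto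
    then show False using w(3) by auto
  qed
  then obtain jj where jj: "\<And>y. y \<in> S \<Longrightarrow> jj y \<in> {1..l + d} \<and> u (jj y) \<noteq> y (jj y)" by metis
  \<comment> \<open>Interpolation: \<open>g\<close> is 1 at \<open>u\<close> and 0 at the other
    points of its orbit, each of which differs from \<open>u\<close> in some coordinate
    \<open>jj y\<close>.\<close>
  define g where "g x = (\<Prod>y\<in>S. (x (jj y) - y (jj y)) * inverse (u (jj y) - y (jj y)))" for x
  have gM: "g \<in> M"
    unfolding g_def[abs_def] by (rule M_prod[OF \<open>finite S\<close> M_affine]) (use jj in blast)
  have gu: "g u = 1"
    unfolding g_def by (rule prod.neutral) (use jj in auto)
  have gy: "g y = 0" if "y \<in> S" for y
    unfolding g_def using \<open>finite S\<close> that by (intro prod_zero) auto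
  have gF: "act z (\<lambda>x. g x * F x) u = act z F u" for F
    using gM gu by (simp add: M_def)
  have "act z G u = act z (\<lambda>x. g x * G x) u" by (simp add: gF)
  also have "\<dots> = act z (\<lambda>x. G u * (g x * 1)) u"
  proof (rule act_local[where A = "{1..l + d}"])
    show "r \<in> {1..l + d} \<and> Suc r \<in> {1..l + d}" if "v \<in> keys z" "Gen_T r \<in> set (letters v)" for v r
      by (rule T_letters[OF z that])
    show "g (u \<circ> w) * G (u \<circ> w) = G u * (g (u \<circ> w) * 1)" if "w permutes {1..l + d}" for w
    proof (cases "u \<circ> w = u")
      case True then show ?thesis by simp
    next
      case False
      then have "u \<circ> w \<in> S" using that by (auto simp: S_def)
      then show ?thesis by (simp add: gy)
    qed
  qed
  also have "\<dots> = G u * act z (\<lambda>x. g x * 1) u" by (rule act_fun_scale)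
  finally show ?thesis unfolding gF by (simp add: mult.commute)
qed

lemma central_invariant:
  assumes "A \<in> ring_centre H"
  shows "A \<in> hecke_embed l d q Q ` P_invariants l d"
proof -
  have "A \<in> carrier H" using assms by (simp add: ring_centre_def)
  then obtain z where z: "z \<in> C" "A = cls z" using carrier_H by blast
  have comm: "vanishing (z * b - b * z)" if "b \<in> C" for b
    using assms that unfolding z(2) ring_centre_iff[OF z(1)] by blast
  obtain p where p: "p \<in> R 0" "\<And>u. state u \<Longrightarrow> act z (\<lambda>_. 1) u = act p (\<lambda>_. 1) u"
    using act_one_function[OF C_in_R[OF z(1)]] by blast
  obtain f where f: "\<And>c. c \<in> J \<Longrightarrow> f c \<in> laurent_polys d" "p \<approx> (\<Sum>c\<in>J. emb c (f c))"
    using R0_decompose[OF p(1)] by blast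
  define F where "F c = (if c \<in> J then f c else 0)" for c
  have F: "F \<in> P_alg l d" using f(1) by (auto simp: F_def P_alg_def)
  define \<zeta> where "\<zeta> u = laurent_eval (F (colour u)) (blacks u)" for u
  have act: "act z G u = \<zeta> u * G u" if u: "state u" for G u
  proof -
    have "act z (\<lambda>_. 1) u = act (\<Sum>c\<in>J. emb c (f c)) (\<lambda>_. 1) u"
      using vanishingD[OF I_vanishing[OF f(2)[unfolded cg_def]] u] p(2)[OF u] by simp
    also have "\<dots> = \<zeta> u"
      using act_emb_sum[OF f(1) u] colour_in_J[OF u] by (simp add: \<zeta>_def F_def)
    finally show ?thesis
      using commuting_with_X_acts_by_multiplication[OF z(1) comm[OF gens_closed(3)] u] by simp
  qed
  have "acts_by A \<zeta>" unfolding z(2) by (rule acts_by_cls[OF z(1) act])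
  then have A: "A = hecke_embed l d q Q F"
    using acts_by_unique[OF _ acts_by_embed[OF F]] by (simp add: \<zeta>_def)
  \<comment> \<open>Apply \<open>z T_r = T_r z\<close> to the constant 1: the \<open>T_fix\<close>
    terms cancel and leave \<open>T_swap\<close> times the difference of the two
    multipliers.\<close>
  have swap: "\<zeta> (u \<circ> transpose r (Suc r)) = \<zeta> u" if r: "1 \<le> r" "r < l + d" and u: "state u" for r u
  proof (cases "u r = 0 \<and> u (Suc r) = 0")
    case True
    then have "u \<circ> transpose r (Suc r) = u" by (auto simp: fun_eq_iff transpose_def)
    then show ?thesis by simp
  next
    case False
    have us: "state (u \<circ> transpose r (Suc r))" by (rule state_comp[OF u transpose_Suc_permutes[OF r]])
    have "act z (op_T r (\<lambda>_. 1)) u = op_T r (act z (\<lambda>_. 1)) u"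
      using vanishingD[OF comm[OF gens_closed(2)[OF r]] u, of "\<lambda>_. 1"] by (simp add: act_mult)
    then have "T_swap r u * (\<zeta> (u \<circ> transpose r (Suc r)) - \<zeta> u) = 0"
      using act[OF u] act[OF us] by (auto simp: op_T_def algebra_simps)
    then show ?thesis using T_swap_nonzero[OF u r] False by auto
  qed
  define Inv where "Inv w \<longleftrightarrow> w permutes {1..l + d} \<and> (\<forall>u. state u \<longrightarrow> \<zeta> (u \<circ> w) = \<zeta> u)" for w
  have Inv_comp: "Inv (w \<circ> w')" if "Inv w" "Inv w'" for w w'
    unfolding Inv_def
  proof (intro conjI allI impI)
    show "w \<circ> w' permutes {1..l + d}" using that by (auto simp: Inv_def intro: permutes_compose)
    fix u assume u: "state u"
    have "\<zeta> (u \<circ> w \<circ> w') = \<zeta> u" using that u state_comp[OF u] by (simp add: Inv_def)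
    then show "\<zeta> (u \<circ> (w \<circ> w')) = \<zeta> u" by (simp add: comp_assoc)
  qed
  have Inv_step: "Inv (transpose r (Suc r))" if "1 \<le> r" "r < l + d" for r
    unfolding Inv_def using transpose_Suc_permutes[OF that] swap[OF that] by blast
  have Inv_transpose: "Inv (transpose a (a + Suc k))" if "1 \<le> a" "a + Suc k \<le> l + d" for a k
    using that
  proof (induction k)
    case 0 then show ?case using Inv_step[of a] by simp
  next
    case (Suc k)
    \<comment> \<open>A longer transposition is a shorter one conjugated by a simple one.\<close>
    let ?s = "transpose (a + Suc k) (Suc (a + Suc k))"
    have "Inv (?s \<circ> transpose a (a + Suc k) \<circ> ?s)"
      using Suc by (intro Inv_comp Inv_step Suc.IH) auto
    moreover have "?s \<circ> transpose a (a + Suc k) \<circ> ?s = transpose a (a + Suc (Suc k))"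
      by (auto simp: fun_eq_iff transpose_def)
    ultimately show ?case by simp
  qed
  have "Inv w" if "w permutes {1..l + d}" for w
    using that finite_atLeastAtMost[of 1 "l + d"]
  proof (induction w rule: permutes_induct)
    case id
    show ?case unfolding Inv_def by (intro conjI permutes_id allI impI) simp
  next
    case (swap a b p)
    have "Inv (transpose a b)"
    proof (cases "a < b")
      case True
      then show ?thesis using Inv_transpose[of a "b - a - 1"] swap by simp
    next
      case False
      then show ?thesis using Inv_transpose[of b "a - b - 1"] swap by (simp add: transpose_commute)
    qed
    then show ?case using swap by (intro Inv_comp)
  qed
  then have "F \<in> P_invariants l d"
    unfolding P_invariants_iff[OF F] Inv_def \<zeta>_def by blast
  then show ?thesis using A by blast
qed

lemma ring_centre_eq: "ring_centre H = hecke_embed l d q Q ` P_invariants l d"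
  using central_invariant invariant_central by blast

text \<open>Black positions are matched as \<open>\<sigma>\<close> prescribes and red ones by any
  bijection. With \<open>c' = c\<close> this realises every permutation of the \<open>x_r\<close>;
  with \<open>\<sigma> = id\<close> it links any two colours.\<close>

lemma permutation_realising:
  assumes c: "c \<in> J" and c': "c' \<in> J" and \<sigma>: "\<sigma> permutes {1..d}"
  obtains w where "w permutes {1..l + d}" "c \<circ> w = c'" "\<And>r. r \<in> {1..d} \<Longrightarrow> w (bp c' r) = bp c (\<sigma> r)"
proof -
  let ?B = "\<lambda>c. {j \<in> {1..l + d}. c j = 0}" and ?A = "\<lambda>c :: nat \<Rightarrow> nat. {j \<in> {1..l + d}. c j = 1}"
  have "card (?A c') = card (?A c)" using c c' by (simp add: colour_tuples_def)
  then obtain h where h: "bij_betw h (?A c') (?A c)"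
    using finite_same_card_bij[of "?A c'" "?A c"] by auto
  define g where "g = bp c \<circ> \<sigma> \<circ> inv_into {1..d} (bp c')"
  have g: "bij_betw g (?B c') (?B c)"
    unfolding g_def comp_assoc
    by (intro bij_betw_trans[OF bij_betw_trans[OF bij_betw_inv_into[OF bij_betw_black_pos[OF c']] permutes_imp_bij[OF \<sigma>]]
        bij_betw_black_pos[OF c], unfolded comp_assoc])
  define w where "w j = (if j \<in> ?B c' then g j else if j \<in> ?A c' then h j else j)" for j
  have U: "?B c \<union> ?A c = {1..l + d}" if "c \<in> J" for c
  proof (intro equalityI subsetI)
    fix j assume "j \<in> {1..l + d}"
    then show "j \<in> ?B c \<union> ?A c" using colour_cases[OF that, of j] by blast
  qed blast
  have wB: "bij_betw w (?B c') (?B c)"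
    using g by (rule bij_betw_cong[THEN iffD1, rotated]) (simp add: w_def)
  have wA: "bij_betw w (?A c') (?A c)"
    using h by (rule bij_betw_cong[THEN iffD1, rotated]) (simp add: w_def)
  have "bij_betw w (?B c' \<union> ?A c') (?B c \<union> ?A c)"
    by (rule bij_betw_combine[OF wB wA]) auto
  then have "bij_betw w {1..l + d} {1..l + d}" unfolding U[OF c] U[OF c'] .
  then have w: "w permutes {1..l + d}"
    by (rule bij_imp_permutes) (auto simp: w_def)
  have "c \<circ> w = c'"
  proof
    fix j show "(c \<circ> w) j = c' j"
    proof (cases "j \<in> {1..l + d}")
      case True
      then consider "j \<in> ?B c'" | "j \<in> ?A c'" using U[OF c'] by blast
      then show ?thesis
      proof cases
        case 1 then show ?thesis using bij_betw_apply[OF wB 1] by simp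
      next
        case 2 then show ?thesis using bij_betw_apply[OF wA 2] by simp
      qed
    next
      case False
      have "x j = undefined" if "x \<in> J" for x
      proof -
        have "x \<in> {1..l + d} \<rightarrow>\<^sub>E {0, 1}" using that by (simp add: colour_tuples_def)
        then show ?thesis using False by (rule PiE_arb)
      qed
      from this[OF c] this[OF c'] show ?thesis using permutes_not_in[OF w False] by simp
    qed
  qed
  moreover have "w (bp c' r) = bp c (\<sigma> r)" if r: "r \<in> {1..d}" for r
    using black_pos_mem[OF c' r] inv_into_f_f[OF bij_betw_imp_inj_on[OF bij_betw_black_pos[OF c']] r]
    by (simp add: w_def g_def)
  ultimately show ?thesis using w that by blast
qed

section \<open>Symmetric Laurent polynomials as diagonal invariants\<close>

lemma hecke_eval_eq_embed:
  assumes "f \<in> laurent_polys d"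
  shows "hecke_eval l d q Q f = hecke_embed l d q Q (\<lambda>c. if c \<in> J then f else 0)"
proof -
  have F: "(\<lambda>c. if c \<in> J then f else 0) \<in> P_alg l d" using assms by (simp add: P_alg_def)
  show ?thesis
    unfolding acts_by_unique[OF acts_by_eval[OF assms] acts_by_embed[OF F]]
    using colour_in_J by simp
qed

text \<open>Every \<open>w\<close> matches the black positions of \<open>colour u \<circ> w\<close>
  with those of \<open>colour u\<close>; in terms of their numbers this is a permutation
  \<open>\<sigma>\<close> of \<open>1..d\<close>, under which \<open>f\<close> is symmetric.\<close>

lemma constant_invariant:
  fixes f :: "'k laurent"
  assumes f: "f \<in> sym_laurent_polys d"
  shows "(\<lambda>c. if c \<in> J then f else 0) \<in> P_invariants l d"
proof -
  have fP: "f \<in> laurent_polys d" using f by (simp add: sym_laurent_polys_def)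
  have F: "(\<lambda>c. if c \<in> J then f else 0) \<in> P_alg l d" using fP by (simp add: P_alg_def)
  have "laurent_eval f (blacks (u \<circ> w)) = laurent_eval f (blacks u)"
    if w: "w permutes {1..l + d}" and u: "state u" for u w
  proof -
    let ?c = "colour u"
    have c: "?c \<in> J" by (rule colour_in_J[OF u])
    have c': "?c \<circ> w \<in> J" using c colour_comp_in_J[OF w] by blast
    have "\<exists>s. s \<in> {1..d} \<and> w (bp (?c \<circ> w) r) = bp ?c s" if r: "r \<in> {1..d}" for r
    proof -
      have "w (bp (?c \<circ> w) r) \<in> {1..l + d}" "?c (w (bp (?c \<circ> w) r)) = 0"
        using black_pos_mem[OF c' r] permutes_in_image[OF w] by auto
      then show ?thesis using black_pos_ex[OF c] by blast
    qed
    then obtain \<tau> where \<tau>: "\<And>r. r \<in> {1..d} \<Longrightarrow> \<tau> r \<in> {1..d} \<and> w (bp (?c \<circ> w) r) = bp ?c (\<tau> r)" by metis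
    define \<sigma> where "\<sigma> r = (if r \<in> {1..d} then \<tau> r else r)" for r
    have inj: "inj_on \<sigma> {1..d}"
    proof (rule inj_onI)
      fix r s assume rs: "r \<in> {1..d}" "s \<in> {1..d}" "\<sigma> r = \<sigma> s"
      then have "w (bp (?c \<circ> w) r) = w (bp (?c \<circ> w) s)" using \<tau> by (simp add: \<sigma>_def)
      then have "bp (?c \<circ> w) r = bp (?c \<circ> w) s" using permutes_inj[OF w] by (simp add: inj_eq)
      then show "r = s" using rs bij_betw_imp_inj_on[OF bij_betw_black_pos[OF c']] by (meson inj_onD)
    qed
    have "\<sigma> ` {1..d} = {1..d}"
      by (rule endo_inj_surj[OF _ _ inj]) (use \<tau> in \<open>auto simp: \<sigma>_def\<close>)
    then have \<sigma>: "\<sigma> permutes {1..d}"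
      using inj by (intro bij_imp_permutes) (auto simp: bij_betw_def \<sigma>_def)
    have "laurent_eval f (blacks (u \<circ> w)) = laurent_eval f (\<lambda>r. blacks u (\<sigma> r))"
      by (rule laurent_eval_cong[OF fP]) (use \<tau> blacks_comp[OF u w] in \<open>simp add: \<sigma>_def blacks_def\<close>)
    also have "\<dots> = laurent_eval (laurent_rename \<sigma> f) (blacks u)"
      by (rule laurent_eval_rename[where A = "{1..d}", symmetric])
        (use fP blacks_nonzero[OF u] permutes_in_image[OF \<sigma>] in \<open>auto simp: laurent_polys_def\<close>)
    also have "laurent_rename \<sigma> f = f" using f \<sigma> by (simp add: sym_laurent_polys_def)
    finally show ?thesis .
  qed
  moreover have "colour (u \<circ> w) \<in> J" "colour u \<in> J" if "w permutes {1..l + d}" "state u" for u w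
    using colour_in_J[OF state_comp[OF that(2,1)]] colour_in_J[OF that(2)] .
  ultimately show ?thesis unfolding P_invariants_iff[OF F] by (intro allI impI) simp
qed

text \<open>In \<open>key\<close>, \<open>\<sigma> = id\<close> makes all components equal, and
  \<open>c' = c\<close> makes the common component symmetric.\<close>

lemma invariant_constant:
  fixes F :: "(nat \<Rightarrow> nat) \<Rightarrow> 'k laurent"
  assumes F: "F \<in> P_invariants l d"
  obtains f where "f \<in> sym_laurent_polys d" "F = (\<lambda>c. if c \<in> J then f else 0)"
proof -
  have FP: "F \<in> P_alg l d" using F by (simp add: P_invariants_def)
  have FL: "F c \<in> laurent_polys d" if "c \<in> J" for c using FP that by (simp add: P_alg_def)
  have key: "laurent_rename \<sigma> (F c') = F c" if c: "c \<in> J" and c': "c' \<in> J" and \<sigma>: "\<sigma> permutes {1..d}" for c c' \<sigma>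
  proof (rule laurent_eval_states_inject[OF c _ FL[OF c]])
    show "laurent_rename \<sigma> (F c') \<in> laurent_polys d"
      unfolding laurent_polys_def mem_Collect_eq
    proof
      fix m assume m: "m \<in> keys (laurent_rename \<sigma> (F c'))"
      have "keys m' \<subseteq> {1..d}" if "m' \<in> keys (F c')" for m'
        using FL[OF c'] that unfolding laurent_polys_def by blast
      then show "keys m \<subseteq> {1..d}"
        by (rule keys_laurent_rename[OF _ equalityD1[OF permutes_image[OF \<sigma>]] m])
    qed
    fix u assume u: "state u" "colour u = c"
    obtain w where w: "w permutes {1..l + d}" "c \<circ> w = c'" "\<And>r. r \<in> {1..d} \<Longrightarrow> w (bp c' r) = bp c (\<sigma> r)"
      using permutation_realising[OF c c' \<sigma>] by blast
    have "laurent_eval (laurent_rename \<sigma> (F c')) (blacks u) = laurent_eval (F c') (\<lambda>r. blacks u (\<sigma> r))"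
      by (rule laurent_eval_rename[where A = "{1..d}"])
        (use FL[OF c'] blacks_nonzero[OF u(1)] permutes_in_image[OF \<sigma>] in \<open>auto simp: laurent_polys_def\<close>)
    also have "\<dots> = laurent_eval (F c') (blacks (u \<circ> w))"
      by (rule laurent_eval_cong[OF FL[OF c']])
        (use w u(2) blacks_comp[OF u(1) w(1)] in \<open>simp add: blacks_def\<close>)
    also have "\<dots> = laurent_eval (F c) (blacks u)"
      using F[unfolded P_invariants_iff[OF FP], rule_format, OF w(1) u(1)] colour_comp[OF w(1), of u] w(2) u(2)
      by simp
    finally show "laurent_eval (laurent_rename \<sigma> (F c')) (blacks u) = laurent_eval (F c) (blacks u)" .
  qed
  have F0: "F c = 0" if "c \<notin> J" for c using FP that by (simp add: P_alg_def)
  show ?thesis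
  \<comment> \<open>The case split spares the construction of a colour tuple; without one, the zero
    polynomial serves.\<close>
  proof (cases "J = {}")
    case True
    then have "F = (\<lambda>c. if c \<in> J then 0 else 0)" using F0 by auto
    moreover have "0 \<in> sym_laurent_polys d"
      by (simp add: sym_laurent_polys_def laurent_polys_def laurent_rename_def)
    ultimately show ?thesis using that by blast
  next
    case False
    then obtain c0 where c0: "c0 \<in> J" by blast
    have "F c0 \<in> sym_laurent_polys d"
      using FL[OF c0] key[OF c0 c0] by (simp add: sym_laurent_polys_def)
    moreover have "F c = F c0" if "c \<in> J" for c
      by (rule trans[OF key[OF that c0 permutes_id, symmetric] key[OF c0 c0 permutes_id]])
    then have "F = (\<lambda>c. if c \<in> J then F c0 else 0)" using F0 by auto
    ultimately show ?thesis using that by blast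
  qed
qed

lemma eval_sym_eq_embed_invariants:
  "hecke_eval l d q Q ` sym_laurent_polys d = hecke_embed l d q Q ` P_invariants l d"
proof (intro equalityI subsetI)
  fix A assume "A \<in> hecke_eval l d q Q ` sym_laurent_polys d"
  then obtain f where f: "f \<in> sym_laurent_polys d" "A = hecke_eval l d q Q f" by blast
  then have "A = hecke_embed l d q Q (\<lambda>c. if c \<in> J then f else 0)"
    by (simp add: hecke_eval_eq_embed sym_laurent_polys_def)
  then show "A \<in> hecke_embed l d q Q ` P_invariants l d" by (rule image_eqI[OF _ constant_invariant[OF f(1)]])
next
  fix A assume "A \<in> hecke_embed l d q Q ` P_invariants l d"
  then obtain F where F: "F \<in> P_invariants l d" "A = hecke_embed l d q Q F" by blast
  obtain f where f: "f \<in> sym_laurent_polys d" "F = (\<lambda>c. if c \<in> J then f else 0)"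
    using invariant_constant[OF F(1)] by blast
  then have "A = hecke_eval l d q Q f"
    using F(2) by (simp add: hecke_eval_eq_embed sym_laurent_polys_def)
  then show "A \<in> hecke_eval l d q Q ` sym_laurent_polys d" by (rule image_eqI[OF _ f(1)])
qed

end

theorem proposition1p19:
  fixes l d :: nat and q :: "'k::alg_closed_field" and Q :: "nat \<Rightarrow> 'k"
  assumes "q \<noteq> 0" and "q \<noteq> 1" and "\<And>i. i \<in> {1..l} \<Longrightarrow> Q i \<noteq> 0"
  shows "inj_on (hecke_embed l d q Q) (P_alg l d)
    \<and> ring_centre (hecke_algebra l d q Q) = hecke_eval l d q Q ` sym_laurent_polys d
    \<and> hecke_eval l d q Q ` sym_laurent_polys d = hecke_embed l d q Q ` P_invariants l d"
  by (simp only: hecke_parameters.hecke_embed_inj hecke_parameters.ring_centre_eq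
      hecke_parameters.eval_sym_eq_embed_invariants simp_thms)

end
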